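(* Let $H$ be a finite-dimensional Hopf algebra over a field $k$, and let $A(H)=H^*\otimes H$ be the associative algebra with unit $\varepsilon\otimes 1$ and product $$(\varphi\otimes h)(\varphi'\otimes h')=\varphi'^{(1)}(S^{-1}(h^{(3)}))\,\varphi'^{(3)}(S^2(h^{(1)}))\;\varphi\varphi'^{(2)}\otimes h^{(2)}h'.$$ If $M$ is a left-right anti-Yetter-Drinfeld module over $H$, then $M$ becomes a left $A(H)$-module by $$(\varphi\otimes h)m:=\varphi((hm)^{(1)})\,(hm)^{(0)}.$$ Conversely, if $M$ is a left $A(H)$-module, then $M$ becomes a left-right anti-Yetter-Drinfeld module over $H$ by $$hm:=(\varepsilon\otimes h)m,\qquad \Delta_M(m):=\sum_{i=1}^n (h_i^*\otimes 1)m\otimes h_i,$$ where $\{h_1,\ldots,h_n\}$ is a basis of $H$ and $\{h_1^*,\ldots,h_n^*\}$ is its dual basis.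
   Context: Sumless Sweedler notation: $\Delta(h)=h^{(1)}\otimes h^{(2)}$, with iterated coproducts $h^{(1)}\otimes h^{(2)}\otimes h^{(3)}$; for a right coaction $\Delta_M(m)=m^{(0)}\otimes m^{(1)}\in M\otimes H$. The antipode $S$ of $H$ is bijective. The dual Hopf algebra $H^*$ has the convolution product $(\varphi\varphi')(h)=\varphi(h^{(1)})\varphi'(h^{(2)})$, unit $\varepsilon$ (the counit of $H$), and coproduct determined by $\varphi^{(1)}(a)\varphi^{(2)}(b)=\varphi(ab)$. A left $H$-module and right $H$-comodule $M$ is a left-right anti-Yetter-Drinfeld module if for all $h\in H$, $m\in M$: $\Delta_M(hm)=h^{(2)}m^{(0)}\otimes h^{(3)}m^{(1)}S(h^{(1)})$. *)

theory Defs
  imports Complex_Main "HOL-Library.Function_Algebras"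
begin

section \<open>Vector spaces with carriers, duals and tensor products\<close>

text \<open>
  Addition is that of the ambient type.  Carriers are needed because dual spaces and tensor
  products depend on the scalar multiplications and hence cannot be types.
\<close>

record ('k, 'v) vspace =
  space :: "'v set"
  scl :: "'k \<Rightarrow> 'v \<Rightarrow> 'v"

definition is_vspace :: "('k::field, 'v::ab_group_add, 'z) vspace_scheme \<Rightarrow> bool" where
  "is_vspace V \<longleftrightarrow> vector_space (scl V) \<and> module.subspace (scl V) (space V)"

definition ground :: "('k::field, 'k) vspace" where
  "ground = \<lparr>space = UNIV, scl = (*)\<rparr>"

definition linear_on ::
    "('k::field, 'v::ab_group_add, 'y) vspace_scheme \<Rightarrow>
     ('k, 'w::ab_group_add, 'z) vspace_scheme \<Rightarrow> ('v \<Rightarrow> 'w) \<Rightarrow> bool" where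
  "linear_on V W f \<longleftrightarrow>
     (\<forall>v\<in>space V. f v \<in> space W) \<and>
     (\<forall>v\<in>space V. \<forall>v'\<in>space V. f (v + v') = f v + f v') \<and>
     (\<forall>c. \<forall>v\<in>space V. f (scl V c v) = scl W c (f v))"

definition bilinear_on ::
    "('k::field, 'v::ab_group_add, 'x) vspace_scheme \<Rightarrow>
     ('k, 'w::ab_group_add, 'y) vspace_scheme \<Rightarrow>
     ('k, 'u::ab_group_add, 'z) vspace_scheme \<Rightarrow> ('v \<Rightarrow> 'w \<Rightarrow> 'u) \<Rightarrow> bool" where
  "bilinear_on V W U f \<longleftrightarrow>
     (\<forall>v\<in>space V. linear_on W U (f v)) \<and> (\<forall>w\<in>space W. linear_on V U (\<lambda>v. f v w))"

text \<open>The full linear dual, for spaces whose carrier is the whole type.\<close>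

definition dual ::
    "('k::field, 'v::ab_group_add, 'z) vspace_scheme \<Rightarrow> ('k, 'v \<Rightarrow> 'k) vspace" where
  "dual V = \<lparr>space = {\<phi>. linear_on V ground \<phi>}, scl = (\<lambda>c \<phi> v. c * \<phi> v)\<rparr>"

text \<open>
  Model of the tensor product: \<open>v \<otimes> w\<close> is the evaluation functional
  \<open>\<beta> \<mapsto> \<beta> v w\<close> on the bilinear forms, and \<open>V \<otimes> W\<close> is the set of finite
  sums of such functionals.  Over a field this is the usual tensor product; its universal property
  is proved below (\<open>bilinear_ptensor\<close>, \<open>tensor_universal\<close> and \<open>tensor_unique\<close>).
\<close>

type_synonym ('k, 'v, 'w) tensor = "('v \<Rightarrow> 'w \<Rightarrow> 'k) \<Rightarrow> 'k"

definition ptensor ::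
    "('k::field, 'v::ab_group_add, 'y) vspace_scheme \<Rightarrow>
     ('k, 'w::ab_group_add, 'z) vspace_scheme \<Rightarrow> 'v \<Rightarrow> 'w \<Rightarrow> ('k, 'v, 'w) tensor" where
  "ptensor V W v w = (\<lambda>\<beta>. if bilinear_on V W ground \<beta> then \<beta> v w else 0)"

definition tensor ::
    "('k::field, 'v::ab_group_add, 'y) vspace_scheme \<Rightarrow>
     ('k, 'w::ab_group_add, 'z) vspace_scheme \<Rightarrow> ('k, ('k, 'v, 'w) tensor) vspace" where
  "tensor V W =
     \<lparr>space = {(\<Sum>(v, w)\<leftarrow>xs. ptensor V W v w) | xs. set xs \<subseteq> space V \<times> space W},
      scl = (\<lambda>c t \<beta>. c * t \<beta>)\<rparr>"

text \<open>
  \<open>tlift V W f\<close> is the linear map on \<open>V \<otimes> W\<close> with \<open>v \<otimes> w \<mapsto> f v w\<close>,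
  for bilinear \<open>f\<close>.  It plays the role of sumless Sweedler notation:
  \<open>tlift H H f (\<Delta> h)\<close> is \<open>f h\<^sup>(\<^sup>1\<^sup>) h\<^sup>(\<^sup>2\<^sup>)\<close>.
\<close>

definition tlift ::
    "('k::field, 'v::ab_group_add, 'y) vspace_scheme \<Rightarrow>
     ('k, 'w::ab_group_add, 'z) vspace_scheme \<Rightarrow>
     ('v \<Rightarrow> 'w \<Rightarrow> 'u::ab_group_add) \<Rightarrow> ('k, 'v, 'w) tensor \<Rightarrow> 'u" where
  "tlift V W f t =
     (THE u. \<exists>xs. set xs \<subseteq> space V \<times> space W \<and>
        t = (\<Sum>(v, w)\<leftarrow>xs. ptensor V W v w) \<and> u = (\<Sum>(v, w)\<leftarrow>xs. f v w))"

definition tmap ::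
    "('k::field, 'v::ab_group_add, 'a) vspace_scheme \<Rightarrow>
     ('k, 'w::ab_group_add, 'b) vspace_scheme \<Rightarrow>
     ('k, 'v'::ab_group_add, 'c) vspace_scheme \<Rightarrow>
     ('k, 'w'::ab_group_add, 'd) vspace_scheme \<Rightarrow>
     ('v \<Rightarrow> 'v') \<Rightarrow> ('w \<Rightarrow> 'w') \<Rightarrow> ('k, 'v, 'w) tensor \<Rightarrow> ('k, 'v', 'w') tensor" where
  "tmap V W V' W' f g = tlift V W (\<lambda>v w. ptensor V' W' (f v) (g w))"

text \<open>The associator \<open>(U \<otimes> V) \<otimes> W \<rightarrow> U \<otimes> (V \<otimes> W)\<close>.\<close>

definition tassoc ::
    "('k::field, 'u::ab_group_add, 'a) vspace_scheme \<Rightarrow>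
     ('k, 'v::ab_group_add, 'b) vspace_scheme \<Rightarrow>
     ('k, 'w::ab_group_add, 'c) vspace_scheme \<Rightarrow>
     ('k, ('k, 'u, 'v) tensor, 'w) tensor \<Rightarrow> ('k, 'u, ('k, 'v, 'w) tensor) tensor" where
  "tassoc U V W =
     tlift (tensor U V) W
       (\<lambda>t w. tlift U V (\<lambda>u v. ptensor U (tensor V W) u (ptensor V W v w)) t)"


subsection \<open>Universal property of the tensor product\<close>

lemma is_vspace_ground: "is_vspace ground"
proof -
  have vs: "vector_space ((*) :: 'k::field \<Rightarrow> 'k \<Rightarrow> 'k)"
    by unfold_locales (auto simp: algebra_simps)
  then interpret vector_space "(*) :: 'k::field \<Rightarrow> 'k \<Rightarrow> 'k" .
  show ?thesis by (simp add: is_vspace_def ground_def vs)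
qed

lemma sum_list_ptensor_apply:
  "(\<Sum>(v, w)\<leftarrow>xs. ptensor V W v w) \<beta> =
     (if bilinear_on V W ground \<beta> then (\<Sum>(v, w)\<leftarrow>xs. \<beta> v w) else 0)"
  by (induction xs) (auto simp: ptensor_def)

lemma vector_space_pointwise:
  "vector_space (\<lambda>(c::'k::field) (t :: 'x \<Rightarrow> 'k) x. c * t x)"
  by unfold_locales (auto simp: fun_eq_iff algebra_simps)

lemma is_vspace_dual: "is_vspace (dual V)"
proof -
  interpret vector_space "\<lambda>(c::'k::field) (t :: 'x::ab_group_add \<Rightarrow> 'k) x. c * t x"
    by (rule vector_space_pointwise)
  show ?thesis
    by (auto simp: is_vspace_def dual_def vector_space_pointwise subspace_def linear_on_def
        ground_def algebra_simps)
qed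

lemma is_vspace_tensor:
  fixes V :: "('k::field, 'v::ab_group_add, 'y) vspace_scheme"
    and W :: "('k, 'w::ab_group_add, 'z) vspace_scheme"
  assumes "is_vspace V" "is_vspace W"
  shows "is_vspace (tensor V W)"
proof -
  interpret VV: vector_space "scl V" using assms by (simp add: is_vspace_def)
  interpret vector_space "\<lambda>(c::'k) (t :: ('v \<Rightarrow> 'w \<Rightarrow> 'k) \<Rightarrow> 'k) x. c * t x"
    by (rule vector_space_pointwise)
  have V: "VV.subspace (space V)" using assms by (simp add: is_vspace_def)
  have "subspace (space (tensor V W))"
  proof (rule subspaceI)
    show "0 \<in> space (tensor V W)"
      by (auto simp: tensor_def intro!: exI[of _ "[]"])
  next
    fix x y assume "x \<in> space (tensor V W)" "y \<in> space (tensor V W)"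
    then obtain xs ys where
      "set xs \<subseteq> space V \<times> space W" "x = (\<Sum>(v, w)\<leftarrow>xs. ptensor V W v w)"
      "set ys \<subseteq> space V \<times> space W" "y = (\<Sum>(v, w)\<leftarrow>ys. ptensor V W v w)"
      by (auto simp: tensor_def)
    then show "x + y \<in> space (tensor V W)"
      by (auto simp: tensor_def intro!: exI[of _ "xs @ ys"])
  next
    fix c :: 'k and x assume "x \<in> space (tensor V W)"
    then obtain xs where xs: "set xs \<subseteq> space V \<times> space W"
      and x: "x = (\<Sum>(v, w)\<leftarrow>xs. ptensor V W v w)"
      by (auto simp: tensor_def)
    let ?ys = "map (\<lambda>(v, w). (scl V c v, w)) xs"
    have ys: "set ?ys \<subseteq> space V \<times> space W"
      using xs VV.subspace_scale[OF V] by auto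
    have "(\<lambda>\<beta>. c * x \<beta>) = (\<Sum>(v, w)\<leftarrow>?ys. ptensor V W v w)"
    proof
      fix \<beta>
      show "c * x \<beta> = (\<Sum>(v, w)\<leftarrow>?ys. ptensor V W v w) \<beta>"
      proof (cases "bilinear_on V W ground \<beta>")
        case True
        have "c * (\<Sum>(v, w)\<leftarrow>xs. \<beta> v w) = (\<Sum>(v, w)\<leftarrow>?ys. \<beta> v w)"
          using xs True
          by (induction xs) (auto simp: algebra_simps bilinear_on_def linear_on_def ground_def)
        then show ?thesis using True by (simp only: x sum_list_ptensor_apply if_True)
      qed (simp only: x sum_list_ptensor_apply if_False, simp)
    qed
    then show "(\<lambda>\<beta>. c * x \<beta>) \<in> space (tensor V W)"
      unfolding tensor_def vspace.select_convs using ys by blast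
  qed
  then show ?thesis
    by (simp add: is_vspace_def tensor_def vector_space_pointwise)
qed

lemma ptensor_in_tensor:
  "v \<in> space V \<Longrightarrow> w \<in> space W \<Longrightarrow> ptensor V W v w \<in> space (tensor V W)"
  by (auto simp: tensor_def intro!: exI[of _ "[(v, w)]"])

lemma bilinear_ptensor: "bilinear_on V W (tensor V W) (ptensor V W)"
  unfolding bilinear_on_def linear_on_def
  by (auto intro: ptensor_in_tensor)
    (auto simp: ptensor_def tensor_def fun_eq_iff bilinear_on_def linear_on_def ground_def)

lemma bilinear_well_defined:
  fixes U :: "('k::field, 'u::ab_group_add, 'z) vspace_scheme"
  assumes U: "is_vspace U" and f: "bilinear_on V W U f"
    and xs: "set xs \<subseteq> space V \<times> space W" and ys: "set ys \<subseteq> space V \<times> space W"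
    and eq: "(\<Sum>(v, w)\<leftarrow>xs. ptensor V W v w) = (\<Sum>(v, w)\<leftarrow>ys. ptensor V W v w)"
  shows "(\<Sum>(v, w)\<leftarrow>xs. f v w) = (\<Sum>(v, w)\<leftarrow>ys. f v w)"
proof (rule ccontr)
  assume neq: "\<not> ?thesis"
  define d where "d = (\<Sum>(v, w)\<leftarrow>xs. f v w) - (\<Sum>(v, w)\<leftarrow>ys. f v w)"
  have d: "d \<noteq> 0" using neq by (simp add: d_def)
  interpret UU: vector_space "scl U" using U by (simp add: is_vspace_def)
  interpret K: vector_space "(*) :: 'k \<Rightarrow> 'k \<Rightarrow> 'k"
    by unfold_locales (auto simp: algebra_simps)
  interpret P: vector_space_pair "scl U" "(*) :: 'k \<Rightarrow> 'k \<Rightarrow> 'k" by unfold_locales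
  have "UU.independent {d}" using d by simp
  from P.linear_independent_extend[OF this, of "\<lambda>_. 1"]
  obtain g where g: "Vector_Spaces.linear (scl U) (*) g" "g d = 1" by auto
  interpret g: Vector_Spaces.linear "scl U" "(*)" g by (rule g)
  let ?\<beta> = "\<lambda>v w. g (f v w)"
  have b: "bilinear_on V W ground ?\<beta>"
    using f by (auto simp: bilinear_on_def linear_on_def ground_def g.add g.scale)
  have *: "g (\<Sum>(v, w)\<leftarrow>zs. f v w) = (\<Sum>(v, w)\<leftarrow>zs. ?\<beta> v w)" for zs
    by (induction zs) (auto simp: g.add)
  have "(\<Sum>(v, w)\<leftarrow>xs. ?\<beta> v w) = (\<Sum>(v, w)\<leftarrow>ys. ?\<beta> v w)"
    using fun_cong[OF eq, of ?\<beta>] b by (simp only: sum_list_ptensor_apply if_True)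
  then have "g d = 0" by (simp add: d_def g.diff *)
  with g show False by simp
qed

lemma tlift_sum_list:
  assumes U: "is_vspace U" and f: "bilinear_on V W U f"
    and xs: "set xs \<subseteq> space V \<times> space W"
  shows "tlift V W f (\<Sum>(v, w)\<leftarrow>xs. ptensor V W v w) = (\<Sum>(v, w)\<leftarrow>xs. f v w)"
  unfolding tlift_def
proof (rule the_equality)
  fix u
  assume "\<exists>ys. set ys \<subseteq> space V \<times> space W \<and>
    (\<Sum>(v, w)\<leftarrow>xs. ptensor V W v w) = (\<Sum>(v, w)\<leftarrow>ys. ptensor V W v w) \<and>
    u = (\<Sum>(v, w)\<leftarrow>ys. f v w)"
  then obtain ys where ys: "set ys \<subseteq> space V \<times> space W"
    and eq: "(\<Sum>(v, w)\<leftarrow>xs. ptensor V W v w) = (\<Sum>(v, w)\<leftarrow>ys. ptensor V W v w)"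
    and u: "u = (\<Sum>(v, w)\<leftarrow>ys. f v w)"
    by (elim exE conjE)
  show "u = (\<Sum>(v, w)\<leftarrow>xs. f v w)"
    unfolding u by (rule bilinear_well_defined[OF U f xs ys eq, symmetric])
qed (intro exI[of _ xs] conjI xs refl)

theorem tensor_universal:
  assumes V: "is_vspace V" and U: "is_vspace U"
    and f: "bilinear_on V W U f"
  shows "linear_on (tensor V W) U (tlift V W f)"
    and "v \<in> space V \<Longrightarrow> w \<in> space W \<Longrightarrow> tlift V W f (ptensor V W v w) = f v w"
proof -
  interpret VV: vector_space "scl V" using V by (simp add: is_vspace_def)
  interpret UU: vector_space "scl U" using U by (simp add: is_vspace_def)
  have sV: "VV.subspace (space V)" using V by (simp add: is_vspace_def)
  have sU: "UU.subspace (space U)" using U by (simp add: is_vspace_def)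
  have mem: "(\<Sum>(v, w)\<leftarrow>xs. f v w) \<in> space U" if "set xs \<subseteq> space V \<times> space W" for xs
    using that
    by (induction xs)
      (use f in \<open>auto simp: bilinear_on_def linear_on_def
        intro!: UU.subspace_add[OF sU] UU.subspace_0[OF sU]\<close>)
  note L = tlift_sum_list[OF U f]
  show "v \<in> space V \<Longrightarrow> w \<in> space W \<Longrightarrow> tlift V W f (ptensor V W v w) = f v w"
    using L[of "[(v, w)]"] by simp
  show "linear_on (tensor V W) U (tlift V W f)"
    unfolding linear_on_def
  proof (intro conjI ballI allI)
    fix x assume "x \<in> space (tensor V W)"
    then obtain xs where xs: "set xs \<subseteq> space V \<times> space W"
      and x: "x = (\<Sum>(v, w)\<leftarrow>xs. ptensor V W v w)"
      by (auto simp: tensor_def)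
    show "tlift V W f x \<in> space U" unfolding x L[OF xs] by (rule mem[OF xs])
    {
      fix y assume "y \<in> space (tensor V W)"
      then obtain ys where ys: "set ys \<subseteq> space V \<times> space W"
        and y: "y = (\<Sum>(v, w)\<leftarrow>ys. ptensor V W v w)"
        by (auto simp: tensor_def)
      show "tlift V W f (x + y) = tlift V W f x + tlift V W f y"
        using L[of "xs @ ys"] L[OF xs] L[OF ys] xs ys by (simp add: x y)
    }
    fix c
    let ?ys = "map (\<lambda>(v, w). (scl V c v, w)) xs"
    have ys: "set ?ys \<subseteq> space V \<times> space W"
      using xs VV.subspace_scale[OF sV] by auto
    have 1: "scl (tensor V W) c x = (\<Sum>(v, w)\<leftarrow>?ys. ptensor V W v w)"
    proof
      fix \<beta>
      show "scl (tensor V W) c x \<beta> = (\<Sum>(v, w)\<leftarrow>?ys. ptensor V W v w) \<beta>"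
      proof (cases "bilinear_on V W ground \<beta>")
        case True
        have "c * (\<Sum>(v, w)\<leftarrow>xs. \<beta> v w) = (\<Sum>(v, w)\<leftarrow>?ys. \<beta> v w)"
          using xs True
          by (induction xs) (auto simp: algebra_simps bilinear_on_def linear_on_def ground_def)
        then show ?thesis using True
          by (simp only: x sum_list_ptensor_apply if_True tensor_def vspace.select_convs)
      qed (simp only: x sum_list_ptensor_apply if_False tensor_def vspace.select_convs, simp)
    qed
    have 2: "(\<Sum>(v, w)\<leftarrow>?ys. f v w) = scl U c (\<Sum>(v, w)\<leftarrow>xs. f v w)"
      using xs f
      by (induction xs) (auto simp: UU.scale_right_distrib bilinear_on_def linear_on_def)
    show "tlift V W f (scl (tensor V W) c x) = scl U c (tlift V W f x)"
      unfolding 1 L[OF ys] 2 unfolding x L[OF xs] ..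
  qed
qed

theorem tensor_unique:
  assumes g: "linear_on (tensor V W) U g" and g': "linear_on (tensor V W) U g'"
    and eq: "\<And>v w. v \<in> space V \<Longrightarrow> w \<in> space W \<Longrightarrow> g (ptensor V W v w) = g' (ptensor V W v w)"
    and t: "t \<in> space (tensor V W)"
  shows "g t = g' t"
proof -
  obtain xs where xs: "set xs \<subseteq> space V \<times> space W"
    and t: "t = (\<Sum>(v, w)\<leftarrow>xs. ptensor V W v w)"
    using t by (auto simp: tensor_def)
  have z: "0 \<in> space (tensor V W)"
    by (auto simp: tensor_def intro!: exI[of _ "[]"])
  have z0: "h 0 = 0" if "linear_on (tensor V W) U h" for h
  proof -
    have "h (0 + 0) = h 0 + h 0" using that z unfolding linear_on_def by blast
    then show ?thesis by simp
  qed
  show ?thesis unfolding t using xs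
  proof (induction xs)
    case Nil
    then show ?case using z0[OF g] z0[OF g'] by (simp add: zero_fun_def)
  next
    case (Cons p xs)
    obtain v w where p: "p = (v, w)" by (cases p)
    have vw: "v \<in> space V" "w \<in> space W" using Cons.prems p by auto
    have m: "(\<Sum>(v, w)\<leftarrow>xs. ptensor V W v w) \<in> space (tensor V W)"
      using Cons.prems by (auto simp: tensor_def)
    have "h (ptensor V W v w + (\<Sum>(v, w)\<leftarrow>xs. ptensor V W v w)) =
        h (ptensor V W v w) + h (\<Sum>(v, w)\<leftarrow>xs. ptensor V W v w)"
      if "linear_on (tensor V W) U h" for h
      using that m ptensor_in_tensor[OF vw] unfolding linear_on_def by blast
    from this[OF g] this[OF g'] show ?case
      using Cons eq[OF vw] by (simp add: p plus_fun_def)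
  qed
qed


section \<open>Algebras and modules\<close>

record ('k, 'a) alg = "('k, 'a) vspace" +
  amult :: "'a \<Rightarrow> 'a \<Rightarrow> 'a"
  aone :: 'a

definition unital_algebra :: "('k::field, 'a::ab_group_add, 'z) alg_scheme \<Rightarrow> bool" where
  "unital_algebra A \<longleftrightarrow>
     is_vspace A \<and>
     bilinear_on A A A (amult A) \<and>
     (\<forall>a\<in>space A. \<forall>b\<in>space A. \<forall>c\<in>space A.
        amult A (amult A a b) c = amult A a (amult A b c)) \<and>
     aone A \<in> space A \<and>
     (\<forall>a\<in>space A. amult A (aone A) a = a \<and> amult A a (aone A) = a)"

definition left_module ::
    "('k::field, 'a::ab_group_add, 'y) alg_scheme \<Rightarrow>
     ('k, 'm::ab_group_add, 'z) vspace_scheme \<Rightarrow> ('a \<Rightarrow> 'm \<Rightarrow> 'm) \<Rightarrow> bool" where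
  "left_module A M act \<longleftrightarrow>
     is_vspace M \<and>
     bilinear_on A M M act \<and>
     (\<forall>a\<in>space A. \<forall>b\<in>space A. \<forall>m\<in>space M. act (amult A a b) m = act a (act b m)) \<and>
     (\<forall>m\<in>space M. act (aone A) m = m)"


section \<open>Hopf algebras\<close>

text \<open>
  The carrier of a Hopf algebra is required to be the whole type, and its multiplication and
  unit are those of the type class \<open>ring_1\<close>.  The requirement \<open>0 \<noteq> 1\<close> of that class is no
  restriction, since \<open>\<epsilon> 1 = 1\<close> excludes the zero ring.
\<close>

record ('k, 'h) hopf = "('k, 'h) vspace" +
  comult :: "'h \<Rightarrow> ('k, 'h, 'h) tensor"
  counit :: "'h \<Rightarrow> 'k"
  antipode :: "'h \<Rightarrow> 'h"

definition hopf_alg :: "('k::field, 'h::ring_1) hopf \<Rightarrow> ('k, 'h) alg" where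
  "hopf_alg H = \<lparr>space = space H, scl = scl H, amult = (*), aone = 1\<rparr>"

definition hopf_algebra :: "('k::field, 'h::ring_1) hopf \<Rightarrow> bool" where
  "hopf_algebra H \<longleftrightarrow>
     space H = UNIV \<and>
     unital_algebra (hopf_alg H) \<and>
     linear_on H (tensor H H) (comult H) \<and>
     linear_on H ground (counit H) \<and>
     (\<forall>h. tassoc H H H (tmap H H (tensor H H) H (comult H) id (comult H h)) =
          tmap H H H (tensor H H) id (comult H) (comult H h)) \<and>
     (\<forall>h. tlift H H (\<lambda>a b. scl H (counit H a) b) (comult H h) = h) \<and>
     (\<forall>h. tlift H H (\<lambda>a b. scl H (counit H b) a) (comult H h) = h) \<and>
     comult H 1 = ptensor H H 1 1 \<and>
     (\<forall>g h. comult H (g * h) =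
        tlift H H (\<lambda>a b. tlift H H (\<lambda>c d. ptensor H H (a * c) (b * d)) (comult H h))
          (comult H g)) \<and>
     counit H 1 = 1 \<and>
     (\<forall>g h. counit H (g * h) = counit H g * counit H h) \<and>
     linear_on H H (antipode H) \<and>
     (\<forall>h. tlift H H (\<lambda>a b. antipode H a * b) (comult H h) = scl H (counit H h) 1) \<and>
     (\<forall>h. tlift H H (\<lambda>a b. a * antipode H b) (comult H h) = scl H (counit H h) 1)"

text \<open>
  \<open>sweedler3 V \<Delta> f h\<close> is \<open>f h\<^sup>(\<^sup>1\<^sup>) h\<^sup>(\<^sup>2\<^sup>) h\<^sup>(\<^sup>3\<^sup>)\<close> for a coproduct \<open>\<Delta>\<close> on \<open>V\<close> and trilinear
  \<open>f\<close>, the iterated coproduct being \<open>(id \<otimes> \<Delta>) \<circ> \<Delta>\<close>.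
\<close>

definition sweedler3 ::
    "('k::field, 'v::ab_group_add, 'z) vspace_scheme \<Rightarrow> ('v \<Rightarrow> ('k, 'v, 'v) tensor) \<Rightarrow>
     ('v \<Rightarrow> 'v \<Rightarrow> 'v \<Rightarrow> 'u::ab_group_add) \<Rightarrow> 'v \<Rightarrow> 'u" where
  "sweedler3 V \<Delta> f h = tlift V V (\<lambda>a x. tlift V V (f a) (\<Delta> x)) (\<Delta> h)"


section \<open>The dual Hopf algebra\<close>

definition convolution ::
    "('k::field, 'h::ring_1) hopf \<Rightarrow> ('h \<Rightarrow> 'k) \<Rightarrow> ('h \<Rightarrow> 'k) \<Rightarrow> 'h \<Rightarrow> 'k" where
  "convolution H \<phi> \<psi> = (\<lambda>h. tlift H H (\<lambda>a b. \<phi> a * \<psi> b) (comult H h))"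

text \<open>The description determines a unique tensor when \<open>H\<close> is finite-dimensional.\<close>

definition dual_comult ::
    "('k::field, 'h::ring_1) hopf \<Rightarrow> ('h \<Rightarrow> 'k) \<Rightarrow> ('k, 'h \<Rightarrow> 'k, 'h \<Rightarrow> 'k) tensor" where
  "dual_comult H \<phi> =
     (THE t. t \<in> space (tensor (dual H) (dual H)) \<and>
        (\<forall>a b. tlift (dual H) (dual H) (\<lambda>\<phi>1 \<phi>2. \<phi>1 a * \<phi>2 b) t = \<phi> (a * b)))"


section \<open>Anti-Yetter-Drinfeld modules\<close>

definition right_comodule ::
    "('k::field, 'h::ring_1) hopf \<Rightarrow> ('k, 'm::ab_group_add, 'z) vspace_scheme \<Rightarrow>
     ('m \<Rightarrow> ('k, 'm, 'h) tensor) \<Rightarrow> bool" where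
  "right_comodule H M \<rho> \<longleftrightarrow>
     is_vspace M \<and>
     linear_on M (tensor M H) \<rho> \<and>
     (\<forall>m\<in>space M. tassoc M H H (tmap M H (tensor M H) H \<rho> id (\<rho> m)) =
                  tmap M H M (tensor H H) id (comult H) (\<rho> m)) \<and>
     (\<forall>m\<in>space M. tlift M H (\<lambda>m' h. scl M (counit H h) m') (\<rho> m) = m)"

definition ayd_module ::
    "('k::field, 'h::ring_1) hopf \<Rightarrow> ('k, 'm::ab_group_add, 'z) vspace_scheme \<Rightarrow>
     ('h \<Rightarrow> 'm \<Rightarrow> 'm) \<Rightarrow> ('m \<Rightarrow> ('k, 'm, 'h) tensor) \<Rightarrow> bool" where
  "ayd_module H M act \<rho> \<longleftrightarrow>
     left_module (hopf_alg H) M act \<and>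
     right_comodule H M \<rho> \<and>
     (\<forall>h. \<forall>m\<in>space M.
        \<rho> (act h m) =
          sweedler3 H (comult H) (\<lambda>h1 h2 h3.
            tlift M H (\<lambda>m0 m1. ptensor M H (act h2 m0) (h3 * m1 * antipode H h1)) (\<rho> m)) h)"


section \<open>The algebra A(H) and the two constructions\<close>

definition AH_mult ::
    "('k::field, 'h::ring_1) hopf \<Rightarrow>
     ('k, 'h \<Rightarrow> 'k, 'h) tensor \<Rightarrow> ('k, 'h \<Rightarrow> 'k, 'h) tensor \<Rightarrow> ('k, 'h \<Rightarrow> 'k, 'h) tensor" where
  "AH_mult H x y =
     tlift (dual H) H (\<lambda>\<phi> h.
       tlift (dual H) H (\<lambda>\<psi> h'.
         sweedler3 H (comult H) (\<lambda>h1 h2 h3.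
           sweedler3 (dual H) (dual_comult H) (\<lambda>\<psi>1 \<psi>2 \<psi>3.
             scl (tensor (dual H) H)
               (\<psi>1 (inv (antipode H) h3) * \<psi>3 (antipode H (antipode H h1)))
               (ptensor (dual H) H (convolution H \<phi> \<psi>2) (h2 * h')))
             \<psi>) h) y) x"

definition AH :: "('k::field, 'h::ring_1) hopf \<Rightarrow> ('k, ('k, 'h \<Rightarrow> 'k, 'h) tensor) alg" where
  "AH H =
     \<lparr>space = space (tensor (dual H) H), scl = scl (tensor (dual H) H),
      amult = AH_mult H, aone = ptensor (dual H) H (counit H) 1\<rparr>"

definition AH_action ::
    "('k::field, 'h::ring_1) hopf \<Rightarrow> ('k, 'm::ab_group_add, 'z) vspace_scheme \<Rightarrow>
     ('h \<Rightarrow> 'm \<Rightarrow> 'm) \<Rightarrow> ('m \<Rightarrow> ('k, 'm, 'h) tensor) \<Rightarrow>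
     ('k, 'h \<Rightarrow> 'k, 'h) tensor \<Rightarrow> 'm \<Rightarrow> 'm" where
  "AH_action H M act \<rho> x m =
     tlift (dual H) H (\<lambda>\<phi> h. tlift M H (\<lambda>m0 m1. scl M (\<phi> m1) m0) (\<rho> (act h m))) x"

definition H_action ::
    "('k::field, 'h::ring_1) hopf \<Rightarrow> (('k, 'h \<Rightarrow> 'k, 'h) tensor \<Rightarrow> 'm \<Rightarrow> 'm) \<Rightarrow>
     'h \<Rightarrow> 'm \<Rightarrow> 'm" where
  "H_action H act h m = act (ptensor (dual H) H (counit H) h) m"

text \<open>
  For a basis \<open>B\<close> of \<open>H\<close> and \<open>b \<in> B\<close>, the dual basis element \<open>b\<^sup>*\<close> is the coordinate
  functional \<open>h \<mapsto> representation B h b\<close>.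
\<close>

definition dual_basis ::
    "('k::field, 'h::ab_group_add, 'z) vspace_scheme \<Rightarrow> 'h set \<Rightarrow> 'h \<Rightarrow> 'h \<Rightarrow> 'k" where
  "dual_basis H B b = (\<lambda>h. module.representation (scl H) B h b)"

definition H_coaction ::
    "('k::field, 'h::ring_1) hopf \<Rightarrow> 'h set \<Rightarrow> ('k, 'm::ab_group_add, 'z) vspace_scheme \<Rightarrow>
     (('k, 'h \<Rightarrow> 'k, 'h) tensor \<Rightarrow> 'm \<Rightarrow> 'm) \<Rightarrow> 'm \<Rightarrow> ('k, 'm, 'h) tensor" where
  "H_coaction H B M act m =
     (\<Sum>b\<in>B. ptensor M H (act (ptensor (dual H) H (dual_basis H B b) 1) m) b)"

end

theory Submission
  imports Defs
begin

text \<open>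
  The scalar \<open>f h\<^sup>(\<^sup>1\<^sup>) h\<^sup>(\<^sup>2\<^sup>)\<close> is written as an explicit double sum over the basis (\<open>sw\<close> below), so that
  linearity and exchange of summations hold without side conditions, and every identity in a vector
  space is tested against linear functionals.  A module over \<open>H\<^sup>* \<otimes> H\<close> with either of the two
  structures amounts to an action \<open>A\<close> of \<open>H\<close> and an action \<open>P\<close> of \<open>H\<^sup>*\<close> with a commutation rule:
  being an \<open>A(H)\<close>-module means
  \<open>A h (P \<psi> m) = P (\<psi> (S\<^sup>-\<^sup>1 h\<^sup>(\<^sup>3\<^sup>) \<cdot> S\<^sup>2 h\<^sup>(\<^sup>1\<^sup>))) (A h\<^sup>(\<^sup>2\<^sup>) m)\<close>, and being anti-Yetter-Drinfeld means
  \<open>P \<phi> (A h m) = A h\<^sup>(\<^sup>2\<^sup>) (P (\<phi> (h\<^sup>(\<^sup>3\<^sup>) \<cdot> S h\<^sup>(\<^sup>1\<^sup>))) m)\<close>.  Substituting one rule into the other makes all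
  antipodes cancel, so the two rules are equivalent.  Associativity of \<open>A(H)\<close> follows because left
  multiplications by \<open>\<phi> \<otimes> 1\<close> and \<open>\<epsilon> \<otimes> h\<close> satisfy the first rule.
\<close>

section \<open>Forms on tensor products\<close>

text \<open>The inverse and the square of the antipode in the product of A(H) are forced. The
  anti-Yetter-Drinfeld rule wraps an argument as \<open>c * y * S a\<close> with the outer legs of
  \<open>h\<close>; undoing it needs factors that cancel against neighbouring legs. For neighbours
  \<open>c'\<close>, \<open>c\<close> this is \<open>T c * c'\<close>, since \<open>T\<close> is an
  antipode for the opposite coproduct, and for \<open>a\<close>, \<open>a'\<close> it is
  \<open>S a' * S (S a)\<close>, the image of an antipode law under \<open>S\<close>. Finite
  dimension enters through the canonical element of the dual and \<open>H\<close>: it trades a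
  coaction for an action of the dual algebra and makes the coproduct of the dual explicit. The
  obstacle is the encoding. \<open>tlift\<close> is a definite description, controlled only for
  bilinear integrands, so nested Sweedler expressions carry nested bilinearity obligations. A
  tensor, however, is itself a functional on bilinear forms, so a linear functional applied to a
  \<open>tlift\<close> is the same tensor evaluated at a scalar form. This is why passing to scalars
  is the uniform method.\<close>

lemma sum_fun_apply: "(\<Sum>i\<in>I. f i) x = (\<Sum>i\<in>I. f i x)"
  by (induction I rule: infinite_finite_induct) auto

lemma linear_onD:
  assumes "linear_on V U f"
  shows "v \<in> space V \<Longrightarrow> f v \<in> space U"
    and "v \<in> space V \<Longrightarrow> v' \<in> space V \<Longrightarrow> f (v + v') = f v + f v'"
    and "v \<in> space V \<Longrightarrow> f (scl V c v) = scl U c (f v)"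
  using assms by (auto simp: linear_on_def)

lemma linear_on_ground_iff:
  "linear_on V ground f \<longleftrightarrow>
     (\<forall>v\<in>space V. \<forall>v'\<in>space V. f (v + v') = f v + f v') \<and>
     (\<forall>c. \<forall>v\<in>space V. f (scl V c v) = c * f v)"
  by (simp add: linear_on_def ground_def)

lemma space_dual [simp]: "\<phi> \<in> space (dual V) \<longleftrightarrow> linear_on V ground \<phi>"
  by (simp add: dual_def)

lemma scl_dual [simp]: "scl (dual V) c \<phi> = (\<lambda>v. c * \<phi> v)"
  by (simp add: dual_def)

lemma scl_tensor [simp]: "scl (tensor V W) c t = (\<lambda>\<beta>. c * t \<beta>)"
  by (simp add: tensor_def)

lemma space_ground [simp]: "x \<in> space ground"
  by (simp add: ground_def)

lemma bilinear_onD: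
  assumes "bilinear_on V W U f"
  shows "v \<in> space V \<Longrightarrow> linear_on W U (f v)"
    and "w \<in> space W \<Longrightarrow> linear_on V U (\<lambda>v. f v w)"
    and "v \<in> space V \<Longrightarrow> w \<in> space W \<Longrightarrow> f v w \<in> space U"
  using assms by (auto simp: bilinear_on_def linear_on_def)

lemma bilinear_onI:
  assumes "\<And>v. v \<in> space V \<Longrightarrow> linear_on W U (f v)"
    and "\<And>w. w \<in> space W \<Longrightarrow> linear_on V U (\<lambda>v. f v w)"
  shows "bilinear_on V W U f"
  using assms by (auto simp: bilinear_on_def)

lemma is_vspaceD:
  assumes "is_vspace U"
  shows "0 \<in> space U" "x \<in> space U \<Longrightarrow> y \<in> space U \<Longrightarrow> x + y \<in> space U"
    "x \<in> space U \<Longrightarrow> scl U c x \<in> space U"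
    "(\<And>i. i \<in> I \<Longrightarrow> f i \<in> space U) \<Longrightarrow> (\<Sum>i\<in>I. f i) \<in> space U"
    "scl U 0 x = 0" "scl U 1 x = x" "scl U c (scl U d x) = scl U (c * d) x"
    "scl U (c + d) x = scl U c x + scl U d x" "scl U c (x + y) = scl U c x + scl U c y"
proof -
  interpret vector_space "scl U" using assms by (simp add: is_vspace_def)
  have s: "subspace (space U)" using assms by (simp add: is_vspace_def)
  show "0 \<in> space U" "x \<in> space U \<Longrightarrow> y \<in> space U \<Longrightarrow> x + y \<in> space U"
    "x \<in> space U \<Longrightarrow> scl U c x \<in> space U"
    "(\<And>i. i \<in> I \<Longrightarrow> f i \<in> space U) \<Longrightarrow> (\<Sum>i\<in>I. f i) \<in> space U"
    "scl U 0 x = 0" "scl U 1 x = x" "scl U c (scl U d x) = scl U (c * d) x"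
    "scl U (c + d) x = scl U c x + scl U d x" "scl U c (x + y) = scl U c x + scl U c y"
    using s by (auto simp: subspace_0 subspace_add subspace_scale subspace_sum algebra_simps)
qed

lemma linear_on_0:
  assumes "linear_on V U f" "is_vspace V"
  shows "f 0 = 0"
proof -
  have "f (0 + 0) = f 0 + f 0"
    using linear_onD(2)[OF assms(1)] is_vspaceD(1)[OF assms(2)] by blast
  then show ?thesis by simp
qed

lemma linear_on_sum:
  assumes "linear_on V U f" "is_vspace V" "\<And>i. i \<in> I \<Longrightarrow> g i \<in> space V"
  shows "f (\<Sum>i\<in>I. g i) = (\<Sum>i\<in>I. f (g i))"
  using assms(3)
proof (induction I rule: infinite_finite_induct)
  case (insert x F)
  then show ?case
    using linear_onD(2)[OF assms(1), of "g x" "sum g F"] is_vspaceD(4)[OF assms(2), of F g] by simp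
qed (simp_all add: linear_on_0[OF assms(1,2)])

lemma linear_on_compose:
  "linear_on V W f \<Longrightarrow> linear_on W U g \<Longrightarrow> linear_on V U (\<lambda>v. g (f v))"
  by (simp add: linear_on_def)

lemma bilinear_on_compose:
  "bilinear_on V W U f \<Longrightarrow> linear_on U X g \<Longrightarrow> bilinear_on V W X (\<lambda>v w. g (f v w))"
  by (simp add: bilinear_on_def linear_on_def)

text \<open>A nonzero difference is a linearly independent singleton, so a functional with value 1
  on it extends to the whole ambient type. The extension is linear everywhere, hence on the carrier;
  thus \<open>x\<close> and \<open>y\<close> may be any elements of the type.\<close>

lemma functionals_separate:
  fixes U :: "('k::field, 'u::ab_group_add, 'z) vspace_scheme"
  assumes U: "is_vspace U" and eq: "\<And>\<gamma>. linear_on U ground \<gamma> \<Longrightarrow> \<gamma> x = \<gamma> y"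
  shows "x = y"
proof (rule ccontr)
  assume "x \<noteq> y"
  interpret UU: vector_space "scl U" using U by (simp add: is_vspace_def)
  interpret K: vector_space "(*) :: 'k \<Rightarrow> 'k \<Rightarrow> 'k"
    by unfold_locales (auto simp: algebra_simps)
  interpret P: vector_space_pair "scl U" "(*) :: 'k \<Rightarrow> 'k \<Rightarrow> 'k" by unfold_locales
  have "UU.independent {x - y}" using \<open>x \<noteq> y\<close> by simp
  from P.linear_independent_extend[OF this, of "\<lambda>_. 1"]
  obtain g where g: "Vector_Spaces.linear (scl U) (*) g" "g (x - y) = 1" by auto
  interpret g: Vector_Spaces.linear "scl U" "(*)" g by (rule g)
  have "linear_on U ground g"
    by (simp add: linear_on_ground_iff g.add g.scale)
  from eq[OF this] g(2) show False by (simp add: g.diff)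
qed

text \<open>Additivity and homogeneity are equations in \<open>U\<close>, so separation by
  functionals reduces them to linearity of scalar functions; only membership in the carrier is
  checked directly.\<close>

lemma linear_on_functionalsI:
  assumes V: "is_vspace V" and U: "is_vspace U" and "\<And>v. v \<in> space V \<Longrightarrow> f v \<in> space U"
    and lin: "\<And>\<gamma>. linear_on U ground \<gamma> \<Longrightarrow> linear_on V ground (\<lambda>v. \<gamma> (f v))"
  shows "linear_on V U f"
  unfolding linear_on_def
proof (intro conjI ballI allI)
  fix v v' c assume v: "v \<in> space V"
  show fv: "f v \<in> space U" using v assms(3) by blast
  show "f (scl V c v) = scl U c (f v)"
    by (rule functionals_separate[OF U])
      (use lin v fv in \<open>auto simp: linear_on_ground_iff\<close>)
  assume v': "v' \<in> space V"
  then have "f v' \<in> space U" using assms(3) by blast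
  show "f (v + v') = f v + f v'"
    by (rule functionals_separate[OF U])
      (use lin v fv v' \<open>f v' \<in> space U\<close> in \<open>auto simp: linear_on_ground_iff\<close>)
qed

lemma linear_on_scl_left:
  assumes "is_vspace U" "x \<in> space U" "linear_on V ground f"
  shows "linear_on V U (\<lambda>v. scl U (f v) x)"
  using assms(2,3)
  by (auto simp: linear_on_def ground_def is_vspaceD[OF assms(1)])

section \<open>Tensors as functionals on bilinear forms\<close>

lemma tensorE:
  assumes "t \<in> space (tensor V W)"
  obtains xs where "set xs \<subseteq> space V \<times> space W" "t = (\<Sum>(v, w)\<leftarrow>xs. ptensor V W v w)"
  using assms by (auto simp: tensor_def)

lemma tensor_eval_not_bilinear:
  "t \<in> space (tensor V W) \<Longrightarrow> \<not> bilinear_on V W ground \<beta> \<Longrightarrow> t \<beta> = 0"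
  by (elim tensorE) (simp only: sum_list_ptensor_apply if_False)

text \<open>Tensors vanish on every map that is not bilinear, because \<open>ptensor\<close> has the
  default value 0 there; the bilinear forms therefore decide equality.\<close>

lemma tensor_eqI:
  assumes "s \<in> space (tensor V W)" "t \<in> space (tensor V W)"
    and "\<And>\<beta>. bilinear_on V W ground \<beta> \<Longrightarrow> s \<beta> = t \<beta>"
  shows "s = t"
proof
  show "s \<beta> = t \<beta>" for \<beta>
    using assms tensor_eval_not_bilinear[of s V W \<beta>] tensor_eval_not_bilinear[of t V W \<beta>] by metis
qed

lemma ptensor_eval: "bilinear_on V W ground \<beta> \<Longrightarrow> ptensor V W v w \<beta> = \<beta> v w"
  by (simp add: ptensor_def)

lemma linear_on_tensor_eval: "linear_on (tensor V W) ground (\<lambda>t. t \<beta>)"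
  by (simp add: linear_on_ground_iff)

text \<open>For a list of pure tensors representing \<open>t\<close>, \<open>tlift\<close> is the
  corresponding sum of values of \<open>f\<close>, and \<gamma> passes through the sum. The result
  is again \<open>t\<close>, evaluated at a scalar form. This removes the definite description from
  scalar computations.\<close>

lemma form_tlift:
  assumes U: "is_vspace U" and f: "bilinear_on V W U f" and \<gamma>: "linear_on U ground \<gamma>"
    and t: "t \<in> space (tensor V W)"
  shows "\<gamma> (tlift V W f t) = t (\<lambda>v w. \<gamma> (f v w))"
proof -
  obtain xs where xs: "set xs \<subseteq> space V \<times> space W" and t: "t = (\<Sum>(v, w)\<leftarrow>xs. ptensor V W v w)"
    using t by (rule tensorE)
  have "(\<Sum>(v, w)\<leftarrow>xs. f v w) \<in> space U \<and>
      \<gamma> (\<Sum>(v, w)\<leftarrow>xs. f v w) = (\<Sum>(v, w)\<leftarrow>xs. \<gamma> (f v w))"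
    using xs
  proof (induction xs)
    case Nil
    then show ?case using linear_on_0[OF \<gamma> U] is_vspaceD(1)[OF U] by simp
  next
    case (Cons p xs)
    obtain v w where p: "p = (v, w)" by (cases p)
    have "f v w \<in> space U" using Cons.prems by (auto simp: p intro: bilinear_onD(3)[OF f])
    then show ?case
      using Cons linear_onD(2)[OF \<gamma>, of "f v w" "\<Sum>(v, w)\<leftarrow>xs. f v w"]
        is_vspaceD(2)[OF U, of "f v w" "\<Sum>(v, w)\<leftarrow>xs. f v w"]
      by (simp add: p)
  qed
  moreover have "tlift V W f t = (\<Sum>(v, w)\<leftarrow>xs. f v w)"
    unfolding t by (rule tlift_sum_list[OF U f xs])
  moreover have "t (\<lambda>v w. \<gamma> (f v w)) = (\<Sum>(v, w)\<leftarrow>xs. \<gamma> (f v w))"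
    using bilinear_on_compose[OF f \<gamma>] unfolding t by (simp only: sum_list_ptensor_apply if_True)
  ultimately show ?thesis by simp
qed

lemma tlift_ground:
  assumes "bilinear_on V W ground f" "t \<in> space (tensor V W)"
  shows "tlift V W f t = t f"
proof -
  have "linear_on ground ground (\<lambda>x. x)" by (simp add: linear_on_def)
  from form_tlift[OF is_vspace_ground assms(1) this assms(2)] show ?thesis .
qed

lemma form_tensor:
  assumes "is_vspace V" "is_vspace W" "linear_on (tensor V W) ground g" "t \<in> space (tensor V W)"
  shows "g t = t (\<lambda>v w. g (ptensor V W v w))"
proof (rule tensor_unique[OF assms(3) linear_on_tensor_eval _ assms(4)])
  fix v w assume "v \<in> space V" "w \<in> space W"
  then show "g (ptensor V W v w) = ptensor V W v w (\<lambda>v w. g (ptensor V W v w))"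
    using bilinear_on_compose[OF bilinear_ptensor assms(3)] by (simp add: ptensor_eval)
qed

text \<open>Additivity in the form is not automatic: maps that are not bilinear can have a bilinear
  sum, and there the default value 0 of \<open>ptensor\<close> would break it. Hence each summand
  has to be bilinear.\<close>

lemma tensor_eval_sum:
  assumes t: "t \<in> space (tensor V W)" and "\<And>i. i \<in> I \<Longrightarrow> bilinear_on V W ground (\<beta> i)"
  shows "t (\<lambda>v w. \<Sum>i\<in>I. \<beta> i v w) = (\<Sum>i\<in>I. t (\<beta> i))"
proof -
  have 1: "bilinear_on V W ground (\<lambda>v w. \<Sum>i\<in>I. \<beta> i v w)"
    using assms(2)
    by (auto simp: bilinear_on_def linear_on_ground_iff sum.distrib sum_distrib_left
        intro!: sum.cong)
  obtain xs where xs: "set xs \<subseteq> space V \<times> space W" and t: "t = (\<Sum>(v, w)\<leftarrow>xs. ptensor V W v w)"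
    using t by (rule tensorE)
  have "(\<Sum>(v, w)\<leftarrow>xs. \<Sum>i\<in>I. \<beta> i v w) = (\<Sum>i\<in>I. \<Sum>(v, w)\<leftarrow>xs. \<beta> i v w)"
    by (induction xs) (auto simp: sum.distrib)
  also have "\<dots> = (\<Sum>i\<in>I. t (\<beta> i))"
    by (rule sum.cong[OF refl]) (simp only: t assms(2) sum_list_ptensor_apply if_True)
  finally show ?thesis
    unfolding t by (simp only: sum_list_ptensor_apply if_True 1)
qed

text \<open>Iterated Sweedler notation places one \<open>tlift\<close> in the integrand of another,
  and the outer one needs bilinearity of the inner one in its tensor and a parameter. For fixed
  \<open>t\<close> one representing list serves all \<open>n\<close>, so under a functional the
  value is a finite sum of linear functions of \<open>n\<close>.\<close>

lemma bilinear_on_tlift: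
  assumes V: "is_vspace V" and U: "is_vspace U"
    and F: "\<And>n. n \<in> space N \<Longrightarrow> bilinear_on V W U (F n)"
    and N: "\<And>v w. v \<in> space V \<Longrightarrow> w \<in> space W \<Longrightarrow> linear_on N U (\<lambda>n. F n v w)"
    and vN: "is_vspace N"
  shows "bilinear_on (tensor V W) N U (\<lambda>t n. tlift V W (F n) t)"
proof (rule bilinear_onI)
  fix t assume t: "t \<in> space (tensor V W)"
  obtain xs where xs: "set xs \<subseteq> space V \<times> space W" and t': "t = (\<Sum>(v, w)\<leftarrow>xs. ptensor V W v w)"
    using t by (rule tensorE)
  show "linear_on N U (\<lambda>n. tlift V W (F n) t)"
  proof (rule linear_on_functionalsI[OF vN U])
    show "tlift V W (F n) t \<in> space U" if "n \<in> space N" for n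
      using tensor_universal(1)[OF V U F[OF that]] t by (rule linear_onD)
    fix \<gamma> assume \<gamma>: "linear_on U ground \<gamma>"
    have e: "\<gamma> (tlift V W (F n) t) = (\<Sum>(v, w)\<leftarrow>xs. \<gamma> (F n v w))" if "n \<in> space N" for n
      unfolding form_tlift[OF U F[OF that] \<gamma> t]
      using bilinear_on_compose[OF F[OF that] \<gamma>] unfolding t'
      by (simp only: sum_list_ptensor_apply if_True)
    have "linear_on N ground (\<lambda>n. \<Sum>(v, w)\<leftarrow>xs. \<gamma> (F n v w))"
      using xs
    proof (induction xs)
      case (Cons p xs)
      obtain v w where p: "p = (v, w)" by (cases p)
      have "linear_on N ground (\<lambda>n. \<gamma> (F n v w))"
        using Cons.prems by (intro linear_on_compose[OF N \<gamma>]) (auto simp: p)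
      with Cons show ?case by (auto simp: p linear_on_ground_iff algebra_simps)
    qed (simp add: linear_on_ground_iff)
    then show "linear_on N ground (\<lambda>n. \<gamma> (tlift V W (F n) t))"
      using is_vspaceD(2,3)[OF vN] by (auto simp: linear_on_ground_iff e)
  qed
qed (rule tensor_universal(1)[OF V U F])

lemma tensor_eval_mult: "bilinear_on V W ground \<beta> \<Longrightarrow> t \<in> space (tensor V W) \<Longrightarrow>
    t (\<lambda>v w. c * \<beta> v w) = c * t \<beta>"
proof -
  assume b: "bilinear_on V W ground \<beta>" and t: "t \<in> space (tensor V W)"
  have "linear_on ground ground (\<lambda>x. c * x)"
    by (simp add: linear_on_def ground_def algebra_simps)
  from form_tlift[OF is_vspace_ground b this t] show ?thesis by (simp add: tlift_ground[OF b t])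
qed

text \<open>Either both maps are bilinear or neither is, since bilinearity inspects only the
  carriers and these are closed under the operations; in the second case \<open>t\<close> vanishes
  on both. This matters for dual spaces and modules, whose carriers can be proper subsets of their
  types.\<close>

lemma tensor_eval_cong:
  assumes V: "is_vspace V" and W: "is_vspace W" and t: "t \<in> space (tensor V W)"
    and eq: "\<And>v w. v \<in> space V \<Longrightarrow> w \<in> space W \<Longrightarrow> \<beta> v w = \<beta>' v w"
  shows "t \<beta> = t \<beta>'"
proof (cases "bilinear_on V W ground \<beta>")
  case True
  have b: "bilinear_on V W ground \<beta>'"
    using True eq is_vspaceD(2,3)[OF V] is_vspaceD(2,3)[OF W]
    by (auto simp: bilinear_on_def linear_on_ground_iff)
  obtain xs where xs: "set xs \<subseteq> space V \<times> space W" and t: "t = (\<Sum>(v, w)\<leftarrow>xs. ptensor V W v w)"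
    using t by (rule tensorE)
  have "(\<Sum>(v, w)\<leftarrow>xs. \<beta> v w) = (\<Sum>(v, w)\<leftarrow>xs. \<beta>' v w)"
    using xs by (induction xs) (auto simp: eq)
  then show ?thesis unfolding t using True b by (simp only: sum_list_ptensor_apply if_True)
next
  case False
  have "\<not> bilinear_on V W ground \<beta>'"
    using False eq is_vspaceD(2,3)[OF V] is_vspaceD(2,3)[OF W]
    by (auto simp: bilinear_on_def linear_on_ground_iff)
  with False show ?thesis using tensor_eval_not_bilinear[OF t] by metis
qed

text \<open>The scalar case of \<open>bilinear_on_tlift\<close>, where \<open>tlift\<close> is
  evaluation, with the arguments exchanged. It yields, for instance, the forms that are paired with
  coassociativity axioms.\<close>

lemma bilinear_on_eval:
  assumes V: "is_vspace V" and U: "is_vspace U"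
    and b: "\<And>u. u \<in> space U \<Longrightarrow> bilinear_on V W ground (f u)"
    and l: "\<And>v w. v \<in> space V \<Longrightarrow> w \<in> space W \<Longrightarrow> linear_on U ground (\<lambda>u. f u v w)"
  shows "bilinear_on U (tensor V W) ground (\<lambda>u t. t (f u))"
proof -
  have *: "bilinear_on (tensor V W) U ground (\<lambda>t u. tlift V W (f u) t)"
    by (rule bilinear_on_tlift[OF V is_vspace_ground b l U])
  have e: "tlift V W (f u) t = t (f u)" if "u \<in> space U" "t \<in> space (tensor V W)" for u t
    by (rule tlift_ground[OF b[OF that(1)] that(2)])
  show ?thesis
    using * is_vspaceD(2,3)[OF U]
    by (auto simp: bilinear_on_def linear_on_ground_iff e)
qed

lemma tmap_eval:
  assumes V: "is_vspace V" "is_vspace W" "is_vspace V'" "is_vspace W'"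
    and f: "linear_on V V' f" and g: "linear_on W W' g" and t: "t \<in> space (tensor V W)"
  shows "tmap V W V' W' f g t \<in> space (tensor V' W')"
    and "bilinear_on V' W' ground \<beta> \<Longrightarrow> tmap V W V' W' f g t \<beta> = t (\<lambda>v w. \<beta> (f v) (g w))"
proof -
  have b: "bilinear_on V W (tensor V' W') (\<lambda>v w. ptensor V' W' (f v) (g w))"
    using bilinear_ptensor[of V' W'] f g by (simp add: bilinear_on_def linear_on_def)
  have U: "is_vspace (tensor V' W')" by (rule is_vspace_tensor[OF V(3,4)])
  show "tmap V W V' W' f g t \<in> space (tensor V' W')"
    unfolding tmap_def using linear_onD(1)[OF tensor_universal(1)[OF V(1) U b] t] .
  assume "bilinear_on V' W' ground \<beta>"
  then show "tmap V W V' W' f g t \<beta> = t (\<lambda>v w. \<beta> (f v) (g w))"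
    unfolding tmap_def using form_tlift[OF U b linear_on_tensor_eval[of V' W' \<beta>] t]
    by (simp add: ptensor_eval)
qed

lemma tassoc_eval:
  assumes U: "is_vspace U" and V: "is_vspace V" and W: "is_vspace W"
    and t: "t \<in> space (tensor (tensor U V) W)"
  shows "tassoc U V W t \<in> space (tensor U (tensor V W))"
    and "bilinear_on U (tensor V W) ground \<beta> \<Longrightarrow>
      tassoc U V W t \<beta> = t (\<lambda>s w. s (\<lambda>u v. \<beta> u (ptensor V W v w)))"
proof -
  note VW = is_vspace_tensor[OF V W]
  note UV = is_vspace_tensor[OF U V]
  note UVW = is_vspace_tensor[OF U VW]
  have p: "bilinear_on U V (tensor U (tensor V W)) (\<lambda>u v. ptensor U (tensor V W) u (ptensor V W v w))"
    if "w \<in> space W" for w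
    using that bilinear_ptensor[of U "tensor V W"] bilinear_ptensor[of V W]
    by (simp add: bilinear_on_def linear_on_def)
  have b: "bilinear_on (tensor U V) W (tensor U (tensor V W))
     (\<lambda>t w. tlift U V (\<lambda>u v. ptensor U (tensor V W) u (ptensor V W v w)) t)"
  proof (rule bilinear_on_tlift[OF U UVW p _ W])
    show "linear_on W (tensor U (tensor V W)) (\<lambda>w. ptensor U (tensor V W) u (ptensor V W v w))"
      if "u \<in> space U" "v \<in> space V" for u v
      using that bilinear_ptensor[of U "tensor V W"] bilinear_ptensor[of V W]
      by (simp add: bilinear_on_def linear_on_def)
  qed
  show "tassoc U V W t \<in> space (tensor U (tensor V W))"
    unfolding tassoc_def using linear_onD(1)[OF tensor_universal(1)[OF UV UVW b] t] .
  assume \<beta>: "bilinear_on U (tensor V W) ground \<beta>"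
  have "tassoc U V W t \<beta> =
      t (\<lambda>s w. tlift U V (\<lambda>u v. ptensor U (tensor V W) u (ptensor V W v w)) s \<beta>)"
    unfolding tassoc_def by (rule form_tlift[OF UVW b linear_on_tensor_eval t])
  also have "\<dots> = t (\<lambda>s w. s (\<lambda>u v. \<beta> u (ptensor V W v w)))"
    by (rule tensor_eval_cong[OF UV W t])
      (simp add: form_tlift[OF UVW p linear_on_tensor_eval] ptensor_eval[OF \<beta>])
  finally show "tassoc U V W t \<beta> = t (\<lambda>s w. s (\<lambda>u v. \<beta> u (ptensor V W v w)))" .
qed

lemma linear_on_lin_intros:
  "linear_on V ground f \<Longrightarrow> linear_on V ground (\<lambda>x. f x * c)"
  "linear_on V ground f \<Longrightarrow> linear_on V ground (\<lambda>x. c * f x)"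
  "(\<And>i. i \<in> I \<Longrightarrow> linear_on V ground (F i)) \<Longrightarrow> linear_on V ground (\<lambda>x. \<Sum>i\<in>I. F i x)"
  by (auto simp: linear_on_ground_iff algebra_simps sum.distrib sum_distrib_left intro!: sum.cong)

text \<open>The integrands are compared inside the definite description, so an integrand can be
  rewritten before its bilinearity has been established.\<close>

lemma tlift_cong:
  assumes "\<And>v w. v \<in> space V \<Longrightarrow> w \<in> space W \<Longrightarrow> f v w = g v w"
  shows "tlift V W f t = tlift V W g t"
proof -
  have "(\<Sum>(v, w)\<leftarrow>xs. f v w) = (\<Sum>(v, w)\<leftarrow>xs. g v w)" if "set xs \<subseteq> space V \<times> space W" for xs
    using that assms by (induction xs) auto
  then have "(\<lambda>u. \<exists>xs. set xs \<subseteq> space V \<times> space W \<and> t = (\<Sum>(v, w)\<leftarrow>xs. ptensor V W v w) \<and>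
        u = (\<Sum>(v, w)\<leftarrow>xs. f v w)) =
    (\<lambda>u. \<exists>xs. set xs \<subseteq> space V \<times> space W \<and> t = (\<Sum>(v, w)\<leftarrow>xs. ptensor V W v w) \<and>
        u = (\<Sum>(v, w)\<leftarrow>xs. g v w))"
    by (intro ext iffI) metis+
  then show ?thesis unfolding tlift_def by simp
qed

text \<open>Intended for spaces where coordinates and vectors reproduce the elements of a proper
  carrier: in a dual space the vectors \<open>x i\<close> are the dual basis and the coordinates
  \<open>p i\<close> are evaluations at basis elements.\<close>

lemma tensor_expand_left:
  assumes V: "is_vspace V" and W: "is_vspace W" and t: "t \<in> space (tensor V W)"
    and \<beta>: "bilinear_on V W ground \<beta>"
    and p: "\<And>i. i \<in> I \<Longrightarrow> linear_on V ground (p i)" and x: "\<And>i. i \<in> I \<Longrightarrow> x i \<in> space V"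
    and eq: "\<And>v w. v \<in> space V \<Longrightarrow> w \<in> space W \<Longrightarrow> \<beta> v w = (\<Sum>i\<in>I. p i v * \<beta> (x i) w)"
  shows "t \<beta> = (\<Sum>i\<in>I. t (\<lambda>v w. p i v * \<beta> (x i) w))"
proof -
  have "t \<beta> = t (\<lambda>v w. \<Sum>i\<in>I. p i v * \<beta> (x i) w)"
    by (rule tensor_eval_cong[OF V W t eq])
  also have "\<dots> = (\<Sum>i\<in>I. t (\<lambda>v w. p i v * \<beta> (x i) w))"
    using p x \<beta> by (intro tensor_eval_sum[OF t] bilinear_onI linear_on_lin_intros)
      (auto dest: bilinear_onD)
  finally show ?thesis .
qed

lemma tensor_expand_right:
  assumes V: "is_vspace V" and W: "is_vspace W" and t: "t \<in> space (tensor V W)"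
    and \<beta>: "bilinear_on V W ground \<beta>"
    and p: "\<And>i. i \<in> I \<Longrightarrow> linear_on W ground (p i)" and x: "\<And>i. i \<in> I \<Longrightarrow> x i \<in> space W"
    and eq: "\<And>v w. v \<in> space V \<Longrightarrow> w \<in> space W \<Longrightarrow> \<beta> v w = (\<Sum>i\<in>I. p i w * \<beta> v (x i))"
  shows "t \<beta> = (\<Sum>i\<in>I. t (\<lambda>v w. p i w * \<beta> v (x i)))"
proof -
  have "t \<beta> = t (\<lambda>v w. \<Sum>i\<in>I. p i w * \<beta> v (x i))"
    by (rule tensor_eval_cong[OF V W t eq])
  also have "\<dots> = (\<Sum>i\<in>I. t (\<lambda>v w. p i w * \<beta> v (x i)))"
    using p x \<beta> by (intro tensor_eval_sum[OF t] bilinear_onI linear_on_lin_intros)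
      (auto dest: bilinear_onD)
  finally show ?thesis .
qed

lemma linear_on_ground_scl:
  "linear_on V ground f \<Longrightarrow> v \<in> space V \<Longrightarrow> f (scl V c v) = c * f v"
  by (simp add: linear_on_ground_iff)

lemma linear_on_dual_eval: "x \<in> space V \<Longrightarrow> linear_on (dual V) ground (\<lambda>\<phi>. \<phi> x)"
  by (simp add: linear_on_ground_iff)

lemma linear_on_dualI:
  assumes "\<And>v. v \<in> space V \<Longrightarrow> linear_on W ground (f v)" "\<And>w. linear_on V ground (\<lambda>v. f v w)"
  shows "linear_on V (dual W) f"
  using assms by (auto simp: linear_on_def ground_def fun_eq_iff)

lemma AH_simps [simp]:
  "space (AH H) = space (tensor (dual H) H)" "scl (AH H) = scl (tensor (dual H) H)"
  "amult (AH H) = AH_mult H" "aone (AH H) = ptensor (dual H) H (counit H) 1"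
  by (simp_all add: AH_def)

lemma linear_on_AH:
  "linear_on (AH H) U f \<longleftrightarrow> linear_on (tensor (dual H) H) U f"
  "linear_on V (AH H) g \<longleftrightarrow> linear_on V (tensor (dual H) H) g"
  by (simp_all add: linear_on_def)

lemma bilinear_on_AH:
  "bilinear_on (AH H) V W f \<longleftrightarrow> bilinear_on (tensor (dual H) H) V W f"
  "bilinear_on U (AH H) X g \<longleftrightarrow> bilinear_on U (tensor (dual H) H) X g"
  "bilinear_on Y Z (AH H) k \<longleftrightarrow> bilinear_on Y Z (tensor (dual H) H) k"
  by (simp_all add: bilinear_on_def linear_on_AH)

section \<open>Scalar Sweedler calculus\<close>

locale finite_hopf =
  fixes H :: "('k::field, 'h::ring_1) hopf" and B :: "'h set"
  assumes hopf: "hopf_algebra H" and bij_S: "bij (antipode H)"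
    and basis: "finite_dimensional_vector_space (scl H) B"
begin

abbreviation lin :: "('h \<Rightarrow> 'k) \<Rightarrow> bool" where "lin \<equiv> linear_on H ground"
abbreviation endo :: "('h \<Rightarrow> 'h) \<Rightarrow> bool" where "endo \<equiv> linear_on H H"
abbreviation S :: "'h \<Rightarrow> 'h" where "S \<equiv> antipode H"
abbreviation T :: "'h \<Rightarrow> 'h" where "T \<equiv> inv (antipode H)"
abbreviation eps :: "'h \<Rightarrow> 'k" where "eps \<equiv> counit H"
abbreviation coord :: "'h \<Rightarrow> 'h \<Rightarrow> 'k" where "coord \<equiv> dual_basis H B"

text \<open>The coefficients are the structure constants of the coproduct. As \<open>f\<close> is
  sampled at basis vectors only, the value is the Sweedler expression for bilinear \<open>f\<close>;
  for other \<open>f\<close> it is still a finite sum that can be rearranged freely.\<close>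

definition sw :: "'h \<Rightarrow> ('h \<Rightarrow> 'h \<Rightarrow> 'k) \<Rightarrow> 'k" where
  "sw h f = (\<Sum>i\<in>B. \<Sum>j\<in>B. comult H h (\<lambda>a b. coord i a * coord j b) * f i j)"

definition sw3 :: "'h \<Rightarrow> ('h \<Rightarrow> 'h \<Rightarrow> 'h \<Rightarrow> 'k) \<Rightarrow> 'k" where
  "sw3 h f = sw h (\<lambda>a x. sw x (f a))"

lemma space_H [simp]: "space H = UNIV"
  using hopf by (simp add: hopf_algebra_def)

lemma is_vspace_H: "is_vspace H"
  using hopf unfolding hopf_algebra_def unital_algebra_def hopf_alg_def is_vspace_def
  by simp

lemma bilinear_H_iff:
  "bilinear_on H H ground f \<longleftrightarrow> (\<forall>a. lin (f a)) \<and> (\<forall>b. lin (\<lambda>a. f a b))"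
  by (simp add: bilinear_on_def)

lemma bilinear_H_I: "(\<And>a. lin (f a)) \<Longrightarrow> (\<And>b. lin (\<lambda>a. f a b)) \<Longrightarrow> bilinear_on H H ground f"
  by (simp add: bilinear_H_iff)

lemma linear_mult: "endo (\<lambda>x. x * c)" "endo (\<lambda>x. c * x)"
  using hopf unfolding hopf_algebra_def unital_algebra_def hopf_alg_def bilinear_on_def
  by (auto simp: linear_on_def)

lemma linear_S: "endo S"
  using hopf unfolding hopf_algebra_def by blast

lemma S_T [simp]: "S (T x) = x"
  using bij_S by (simp add: bij_def surj_f_inv_f)

lemma T_S [simp]: "T (S x) = x"
  using bij_S by (simp add: bij_def inv_f_f)

lemma linear_T: "endo T"
proof -
  have "T (x + y) = T x + T y" for x y
    using linear_onD(2)[OF linear_S, of "T x" "T y"] T_S[of "T x + T y"] by simp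
  moreover have "T (scl H c x) = scl H c (T x)" for c x
    using linear_onD(3)[OF linear_S, of "T x" c] T_S[of "scl H c (T x)"] by simp
  ultimately show ?thesis by (simp add: linear_on_def)
qed

lemma lin_comp: "lin f \<Longrightarrow> endo e \<Longrightarrow> lin (\<lambda>x. f (e x))"
  by (rule linear_on_compose)

lemma endo_intros:
  "endo (\<lambda>x. x)"
  "endo e \<Longrightarrow> endo (\<lambda>x. e x * c)"
  "endo e \<Longrightarrow> endo (\<lambda>x. c * e x)"
  "endo e \<Longrightarrow> endo (\<lambda>x. S (e x))"
  "endo e \<Longrightarrow> endo (\<lambda>x. T (e x))"
  by (simp add: linear_on_def)
    (assumption | erule linear_on_compose, rule linear_mult linear_S linear_T)+

lemma lin_eps: "lin eps"
  using hopf unfolding hopf_algebra_def by blast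

lemma basis_expansion: "(\<Sum>b\<in>B. scl H (coord b h) b) = h"
proof -
  interpret V: finite_dimensional_vector_space "scl H" B by (rule basis)
  show ?thesis unfolding dual_basis_def
    by (rule V.sum_representation_eq)
      (auto simp: V.independent_Basis V.span_Basis V.finite_Basis)
qed

lemma lin_coord: "lin (coord b)"
proof -
  interpret V: finite_dimensional_vector_space "scl H" B by (rule basis)
  show ?thesis
    by (auto simp: linear_on_ground_iff dual_basis_def V.independent_Basis V.span_Basis
        V.representation_add V.representation_scale)
qed

lemma lin_expansion:
  assumes "lin f"
  shows "(\<Sum>b\<in>B. coord b h * f b) = f h"
proof -
  have "f h = f (\<Sum>b\<in>B. scl H (coord b h) b)" by (simp add: basis_expansion)
  also have "\<dots> = (\<Sum>b\<in>B. f (scl H (coord b h) b))"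
    by (rule linear_on_sum[OF assms is_vspace_H]) simp
  finally show ?thesis using assms by (simp add: linear_on_ground_iff)
qed

lemma dual_expansion:
  assumes "lin f"
  shows "(\<lambda>h. \<Sum>b\<in>B. f b * coord b h) = f"
  using lin_expansion[OF assms] by (simp add: mult.commute)

lemma comult_in_tensor: "comult H h \<in> space (tensor H H)"
  using hopf unfolding hopf_algebra_def linear_on_def by simp

lemma linear_comult: "linear_on H (tensor H H) (comult H)"
  using hopf unfolding hopf_algebra_def by blast

text \<open>Expansion along the basis in both arguments writes \<open>f\<close> as a combination of
  products of coordinate functionals. These are bilinear, so the tensor is additive and homogeneous
  on them.\<close>

lemma comult_eval:
  assumes f: "bilinear_on H H ground f"
  shows "comult H h f = sw h f"
proof -
  have f1: "lin (f a)" and f2: "lin (\<lambda>a. f a b)" for a b using f by (auto simp: bilinear_H_iff)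
  have b: "bilinear_on H H ground (\<lambda>a b. coord i a * coord j b)" for i j
    by (intro bilinear_H_I linear_on_lin_intros lin_coord)
  have "f = (\<lambda>a b. \<Sum>i\<in>B. \<Sum>j\<in>B. f i j * (coord i a * coord j b))"
  proof (intro ext)
    fix a b
    have "f a b = (\<Sum>i\<in>B. coord i a * (\<Sum>j\<in>B. coord j b * f i j))"
      by (simp add: lin_expansion f1 lin_expansion[OF f2])
    then show "f a b = (\<Sum>i\<in>B. \<Sum>j\<in>B. f i j * (coord i a * coord j b))"
      by (simp add: sum_distrib_left mult_ac)
  qed
  then have "comult H h f = comult H h (\<lambda>a b. \<Sum>i\<in>B. \<Sum>j\<in>B. f i j * (coord i a * coord j b))"
    by simp
  also have "\<dots> = (\<Sum>i\<in>B. comult H h (\<lambda>a b. \<Sum>j\<in>B. f i j * (coord i a * coord j b)))"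
    by (intro tensor_eval_sum[OF comult_in_tensor] bilinear_H_I linear_on_lin_intros lin_coord)
  also have "\<dots> = (\<Sum>i\<in>B. \<Sum>j\<in>B. comult H h (\<lambda>a b. f i j * (coord i a * coord j b)))"
    by (intro sum.cong refl tensor_eval_sum[OF comult_in_tensor] bilinear_H_I linear_on_lin_intros
        lin_coord)
  also have "\<dots> = sw h f"
    by (simp add: sw_def tensor_eval_mult[OF b comult_in_tensor] mult.commute)
  finally show ?thesis .
qed

lemma sw_mult: "sw h (\<lambda>a b. c * f a b) = c * sw h f" "sw h (\<lambda>a b. f a b * c) = sw h f * c"
  by (simp_all add: sw_def sum_distrib_left sum_distrib_right mult_ac)

lemma sw_sum: "sw h (\<lambda>a b. \<Sum>i\<in>I. f i a b) = (\<Sum>i\<in>I. sw h (f i))"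
proof -
  have "sw h (\<lambda>a b. \<Sum>i\<in>I. f i a b) = (\<Sum>i\<in>B. \<Sum>l\<in>I. \<Sum>j\<in>B. comult H h (\<lambda>a b. coord i a * coord j b) * f l i j)"
    by (simp add: sw_def sum_distrib_left) (intro sum.cong refl sum.swap)
  also have "\<dots> = (\<Sum>i\<in>I. sw h (f i))"
    unfolding sw_def by (rule sum.swap)
  finally show ?thesis .
qed

lemma sw_swap: "sw g (\<lambda>a b. sw h (\<lambda>c d. F a b c d)) = sw h (\<lambda>c d. sw g (\<lambda>a b. F a b c d))"
proof -
  have "sw g (\<lambda>a b. sw h (\<lambda>c d. F a b c d)) =
      (\<Sum>i\<in>B. \<Sum>j\<in>B. sw g (\<lambda>a b. comult H h (\<lambda>a b. coord i a * coord j b) * F a b i j))"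
    by (simp add: sw_def[of h] sw_sum)
  then show ?thesis by (simp only: sw_mult sw_def[of h])
qed

lemma sw_cong: "(\<And>a b. f a b = g a b) \<Longrightarrow> sw h f = sw h g"
  by (simp add: sw_def)

lemma sw3_cong: "(\<And>a b c. f a b c = g a b c) \<Longrightarrow> sw3 h f = sw3 h g"
  by (simp add: sw3_def sw_def)

lemma sw3_mult: "sw3 h (\<lambda>a b d. c * f a b d) = c * sw3 h f" "sw3 h (\<lambda>a b d. f a b d * c) = sw3 h f * c"
  by (simp_all add: sw3_def sw_mult)

lemma sw3_sum: "sw3 h (\<lambda>a b c. \<Sum>i\<in>I. f i a b c) = (\<Sum>i\<in>I. sw3 h (f i))"
  by (simp add: sw3_def sw_sum)

lemma sw_sw3_swap: "sw g (\<lambda>a b. sw3 h (\<lambda>c d e. F a b c d e)) = sw3 h (\<lambda>c d e. sw g (\<lambda>a b. F a b c d e))"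
  unfolding sw3_def by (subst sw_swap) (intro sw_cong sw_swap)

lemma linear_on_sw: "(\<And>a b. linear_on V ground (\<lambda>v. F v a b)) \<Longrightarrow> linear_on V ground (\<lambda>v. sw c (F v))"
  unfolding sw_def by (intro linear_on_lin_intros)

lemma linear_on_sw3: "(\<And>a b d. linear_on V ground (\<lambda>v. F v a b d)) \<Longrightarrow> linear_on V ground (\<lambda>v. sw3 c (F v))"
  unfolding sw3_def by (intro linear_on_sw)

lemma lin_sw: "endo e \<Longrightarrow> lin (\<lambda>x. sw (e x) f)"
proof -
  assume e: "endo e"
  have "lin (\<lambda>h. comult H h \<beta>)" for \<beta>
    using linear_on_compose[OF linear_comult linear_on_tensor_eval] .
  from linear_on_compose[OF e this] show ?thesis
    unfolding sw_def by (intro linear_on_lin_intros)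
qed

lemma lin_sw3: "endo e \<Longrightarrow> lin (\<lambda>x. sw3 (e x) f)"
  unfolding sw3_def by (rule lin_sw)

lemmas lin_intros = bilinear_H_I linear_on_lin_intros endo_intros linear_on_sw linear_on_sw3
  lin_sw lin_sw3 lin_eps lin_comp[OF lin_eps] lin_coord lin_comp[OF lin_coord]

text \<open>The axiom is an equation between elements of an iterated tensor product. It is paired
  with the form \<open>\<lambda>a t. t (f a)\<close>: since a tensor is a functional, this feeds the
  last two legs to \<open>f a\<close> without any choice of representatives.\<close>

lemma coassoc:
  assumes f: "\<And>b c. lin (\<lambda>a. f a b c)" "\<And>a c. lin (\<lambda>b. f a b c)" "\<And>a b. lin (\<lambda>c. f a b c)"
  shows "sw h (\<lambda>x c. sw x (\<lambda>a b. f a b c)) = sw h (\<lambda>a x. sw x (f a))"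
proof -
  have bf: "bilinear_on H H ground (f a)" for a
    by (intro bilinear_H_I f)
  have bf': "bilinear_on H H ground (\<lambda>a b. f a b c)" for c
    by (intro bilinear_H_I f)
  have b: "bilinear_on H (tensor H H) ground (\<lambda>a t. t (f a))"
    by (rule bilinear_on_eval[OF is_vspace_H is_vspace_H bf f(1)])
  have ax: "tassoc H H H (tmap H H (tensor H H) H (comult H) id (comult H h)) =
          tmap H H H (tensor H H) id (comult H) (comult H h)"
    using hopf unfolding hopf_algebra_def by blast
  have id: "linear_on H H id" by (simp add: linear_on_def)
  note VS = is_vspace_H is_vspace_tensor[OF is_vspace_H is_vspace_H]
  have "tassoc H H H (tmap H H (tensor H H) H (comult H) id (comult H h)) (\<lambda>a t. t (f a)) =
      tmap H H (tensor H H) H (comult H) id (comult H h) (\<lambda>s w. s (\<lambda>u v. f u v w))"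
    by (subst tassoc_eval(2)[OF VS(1) VS(1) VS(1) tmap_eval(1)[OF VS(1) VS(1) VS(2) VS(1) linear_comult id comult_in_tensor] b])
      (simp add: ptensor_eval[OF bf])
  also have "\<dots> = comult H h (\<lambda>x w. comult H x (\<lambda>u v. f u v w))"
  proof (subst tmap_eval(2)[OF VS(1) VS(1) VS(2) VS(1) linear_comult id comult_in_tensor])
    show "bilinear_on (tensor H H) H ground (\<lambda>s w. s (\<lambda>u v. f u v w))"
      using bilinear_on_eval[OF is_vspace_H is_vspace_H bf' f(3)] by (auto simp: bilinear_on_def)
  qed simp
  also have "\<dots> = sw h (\<lambda>x c. sw x (\<lambda>a b. f a b c))"
    unfolding comult_eval[OF bf'] by (intro comult_eval lin_intros f)
  finally have 1: "tassoc H H H (tmap H H (tensor H H) H (comult H) id (comult H h)) (\<lambda>a t. t (f a)) = \<dots>" .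
  have "tmap H H H (tensor H H) id (comult H) (comult H h) (\<lambda>a t. t (f a)) = comult H h (\<lambda>a x. comult H x (f a))"
    by (subst tmap_eval(2)[OF VS(1) VS(1) VS(1) VS(2) id linear_comult comult_in_tensor b]) simp
  also have "\<dots> = sw h (\<lambda>a x. sw x (f a))"
    unfolding comult_eval[OF bf] by (intro comult_eval lin_intros f)
  finally show ?thesis using 1 ax by metis
qed

lemma comult_tlift_eval:
  assumes f: "bilinear_on H H H f" and l: "lin l"
  shows "l (tlift H H f (comult H h)) = sw h (\<lambda>a b. l (f a b))"
  unfolding form_tlift[OF is_vspace_H f l comult_in_tensor]
  by (rule comult_eval[OF bilinear_on_compose[OF f l]])

lemma lin_scl: "lin f \<Longrightarrow> f (scl H c x) = c * f x"
  by (simp add: linear_on_ground_iff)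

lemma sw_counit:
  assumes f: "lin f"
  shows "sw h (\<lambda>a b. eps a * f b) = f h" "sw h (\<lambda>a b. eps b * f a) = f h"
proof -
  note L = is_vspaceD[OF is_vspace_H]
  have e: "eps (x + y) = eps x + eps y" "eps (scl H c x) = c * eps x" for c x y
    using lin_eps by (auto simp: linear_on_ground_iff)
  have b: "bilinear_on H H H (\<lambda>a b. scl H (eps a) b)" "bilinear_on H H H (\<lambda>a b. scl H (eps b) a)"
    by (simp_all add: bilinear_on_def linear_on_def L(7-9) e mult_ac)
  have ax: "tlift H H (\<lambda>a b. scl H (eps a) b) (comult H h) = h"
    "tlift H H (\<lambda>a b. scl H (eps b) a) (comult H h) = h"
    using hopf unfolding hopf_algebra_def by blast+
  show "sw h (\<lambda>a b. eps a * f b) = f h"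
    using comult_tlift_eval[OF b(1) f, of h] unfolding ax by (simp only: lin_scl[OF f])
  show "sw h (\<lambda>a b. eps b * f a) = f h"
    using comult_tlift_eval[OF b(2) f, of h] unfolding ax by (simp only: lin_scl[OF f])
qed

lemma sw_S:
  assumes f: "lin f"
  shows "sw h (\<lambda>a b. f (S a * b)) = eps h * f 1" "sw h (\<lambda>a b. f (a * S b)) = eps h * f 1"
proof -
  have b: "bilinear_on H H H (\<lambda>a b. S a * b)" "bilinear_on H H H (\<lambda>a b. a * S b)"
    by (intro bilinear_onI endo_intros)+
  have ax: "tlift H H (\<lambda>a b. S a * b) (comult H h) = scl H (eps h) 1"
    "tlift H H (\<lambda>a b. a * S b) (comult H h) = scl H (eps h) 1"
    using hopf unfolding hopf_algebra_def by blast+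
  show "sw h (\<lambda>a b. f (S a * b)) = eps h * f 1"
    using comult_tlift_eval[OF b(1) f, of h] unfolding ax by (simp only: lin_scl[OF f])
  show "sw h (\<lambda>a b. f (a * S b)) = eps h * f 1"
    using comult_tlift_eval[OF b(2) f, of h] unfolding ax by (simp only: lin_scl[OF f])
qed

lemma eps_mult: "eps (g * h) = eps g * eps h" and eps_1: "eps 1 = 1"
  using hopf unfolding hopf_algebra_def by blast+

lemma sw_1:
  assumes "\<And>b. lin (\<lambda>a. f a b)" "\<And>a. lin (f a)"
  shows "sw 1 f = f 1 1"
proof -
  have b: "bilinear_on H H ground f" using assms by (intro lin_intros)
  have "comult H 1 = ptensor H H 1 1" using hopf unfolding hopf_algebra_def by blast
  then show ?thesis by (simp add: comult_eval[OF b, symmetric] ptensor_eval[OF b])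
qed

lemma sw_times:
  assumes f: "\<And>b. lin (\<lambda>a. f a b)" "\<And>a. lin (f a)"
  shows "sw (g * h) f = sw g (\<lambda>a b. sw h (\<lambda>c d. f (a * c) (b * d)))"
proof -
  have b: "bilinear_on H H ground f" using f by (intro lin_intros)
  note VS = is_vspace_H is_vspace_tensor[OF is_vspace_H is_vspace_H]
  have p: "linear_on H (tensor H H) (\<lambda>x. ptensor H H (e x) y)"
    "linear_on H (tensor H H) (\<lambda>x. ptensor H H y (e x))" if "endo e" for e y
    using that bilinear_ptensor[of H H] by (auto simp: bilinear_on_def linear_on_def)
  have b1: "bilinear_on H H (tensor H H) (\<lambda>c d. ptensor H H (a * c) (b * d))" for a b
    by (intro bilinear_onI p endo_intros)
  have "bilinear_on (tensor H H) H (tensor H H) (\<lambda>t a. tlift H H (\<lambda>c d. ptensor H H (a * c) (b * d)) t)" for b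
    by (rule bilinear_on_tlift[OF VS(1) VS(2) b1 _ VS(1)]) (intro p endo_intros)
  moreover have "bilinear_on (tensor H H) H (tensor H H) (\<lambda>t b. tlift H H (\<lambda>c d. ptensor H H (a * c) (b * d)) t)" for a
    by (rule bilinear_on_tlift[OF VS(1) VS(2) b1 _ VS(1)]) (intro p endo_intros)
  ultimately have b2: "bilinear_on H H (tensor H H)
      (\<lambda>a b. tlift H H (\<lambda>c d. ptensor H H (a * c) (b * d)) (comult H h))"
    by (intro bilinear_onI) (auto dest: bilinear_onD(1)[OF _ comult_in_tensor])
  have ax: "comult H (g * h) = tlift H H (\<lambda>a b. tlift H H (\<lambda>c d. ptensor H H (a * c) (b * d)) (comult H h)) (comult H g)"
    using hopf unfolding hopf_algebra_def by blast
  have "comult H (g * h) f = comult H g (\<lambda>a b. comult H h (\<lambda>c d. f (a * c) (b * d)))"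
    unfolding ax form_tlift[OF VS(2) b2 linear_on_tensor_eval comult_in_tensor]
      form_tlift[OF VS(2) b1 linear_on_tensor_eval comult_in_tensor]
    by (simp add: ptensor_eval[OF b])
  also have "\<dots> = sw g (\<lambda>a b. sw h (\<lambda>c d. f (a * c) (b * d)))"
  proof -
    have "comult H h (\<lambda>c d. f (a * c) (b * d)) = sw h (\<lambda>c d. f (a * c) (b * d))" for a b
      by (intro comult_eval lin_intros lin_comp[OF f(1)] lin_comp[OF f(2)])
    then show ?thesis
      by (simp only:) (intro comult_eval lin_intros lin_comp[OF f(1)] lin_comp[OF f(2)])
  qed
  finally show ?thesis by (simp only: comult_eval[OF b])
qed

section \<open>The antipode and its inverse reverse products and coproducts\<close>

lemma S_1: "S 1 = 1"
proof (rule functionals_separate[OF is_vspace_H])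
  fix f assume f: "lin f"
  have "sw 1 (\<lambda>a b. f (S a * b)) = f (S 1 * 1)"
    by (intro sw_1 lin_comp[OF f] endo_intros)
  then show "f (S 1) = f 1" by (simp add: sw_S[OF f] eps_1)
qed

lemma eps_S: "eps (S h) = eps h"
proof -
  have "eps h * eps 1 = sw h (\<lambda>a b. eps (S a * b))"
    by (rule sw_S(1)[OF lin_eps, symmetric])
  also have "\<dots> = sw h (\<lambda>a b. eps b * eps (S a))"
    by (simp add: eps_mult mult.commute)
  also have "\<dots> = eps (S h)"
    by (intro sw_counit lin_comp[OF lin_eps] endo_intros)
  finally show ?thesis by (simp add: eps_1)
qed

text \<open>Uniqueness of convolution inverses: as maps of the pair \<open>g\<close>,
  \<open>h\<close>, \<open>S (g * h)\<close> is a left inverse and \<open>S h * S g\<close> a right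
  inverse of the multiplication. The sum \<open>X\<close> is the convolution of left inverse,
  multiplication and right inverse, contracted once from each side.\<close>

lemma S_mult: "S (g * h) = S h * S g"
proof (rule functionals_separate[OF is_vspace_H])
  fix f assume f: "lin f"
  note LI = lin_intros lin_comp[OF f]
  define F where "F g1 g2 g3 h1 h2 h3 = f (S (g1 * h1) * (g2 * h2) * (S h3 * S g3))" for g1 g2 g3 h1 h2 h3
  define X where "X = sw g (\<lambda>g1 g'. sw g' (\<lambda>g2 g3. sw h (\<lambda>h1 h'. sw h' (\<lambda>h2 h3. F g1 g2 g3 h1 h2 h3))))"
  \<comment> \<open>The contraction goes inside out: only after \<open>h2 * S h3\<close> has
    collapsed do \<open>g2\<close> and \<open>S g3\<close> become adjacent.\<close>
  have "X = sw g (\<lambda>g1 g'. sw h (\<lambda>h1 h'. sw g' (\<lambda>g2 g3. sw h' (\<lambda>h2 h3. f ((S (g1 * h1) * g2) * (h2 * S h3) * S g3)))))"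
    unfolding X_def F_def
    by (rule sw_cong, subst sw_swap) (simp add: mult.assoc)
  also have "\<dots> = sw g (\<lambda>g1 g'. sw h (\<lambda>h1 h'. sw g' (\<lambda>g2 g3. eps h' * f ((S (g1 * h1) * g2) * 1 * S g3))))"
    by (intro sw_cong sw_S(2)[where f = "\<lambda>x. f ((S _ * _) * x * S _)"] LI)
  also have "\<dots> = sw g (\<lambda>g1 g'. sw h (\<lambda>h1 h'. eps h' * sw g' (\<lambda>g2 g3. f (S (g1 * h1) * (g2 * S g3)))))"
    by (simp add: sw_mult mult.assoc)
  also have "\<dots> = sw g (\<lambda>g1 g'. sw h (\<lambda>h1 h'. eps h' * (eps g' * f (S (g1 * h1) * 1))))"
    by (intro sw_cong arg_cong[where f = "\<lambda>x. _ * x"] sw_S(2)[where f = "\<lambda>x. f (S _ * x)"] LI)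
  also have "\<dots> = sw g (\<lambda>g1 g'. eps g' * f (S (g1 * h)))"
  proof (rule sw_cong)
    fix g1 g'
    have "sw h (\<lambda>h1 h'. eps h' * (eps g' * f (S (g1 * h1) * 1))) = eps g' * f (S (g1 * h) * 1)"
      by (intro sw_counit(2) LI)
    then show "sw h (\<lambda>h1 h'. eps h' * (eps g' * f (S (g1 * h1) * 1))) = eps g' * f (S (g1 * h))"
      by simp
  qed
  also have "\<dots> = f (S (g * h))"
    by (intro sw_counit(2) LI)
  finally have 1: "X = f (S (g * h))" .
  \<comment> \<open>Coassociativity now pairs the first two legs in both variables; as the coproduct
    is multiplicative, they are the two legs of \<open>g' * h'\<close>, and a single antipode law
    applies.\<close>
  have "X = sw g (\<lambda>g1 g'. sw g' (\<lambda>g2 g3. sw h (\<lambda>h' h3. sw h' (\<lambda>h1 h2. F g1 g2 g3 h1 h2 h3))))"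
    unfolding X_def F_def by (intro sw_cong coassoc[symmetric] LI)
  also have "\<dots> = sw g (\<lambda>g' g3. sw g' (\<lambda>g1 g2. sw h (\<lambda>h' h3. sw h' (\<lambda>h1 h2. F g1 g2 g3 h1 h2 h3))))"
    unfolding F_def by (intro coassoc[symmetric] LI)
  also have "\<dots> = sw g (\<lambda>g' g3. sw h (\<lambda>h' h3. sw g' (\<lambda>g1 g2. sw h' (\<lambda>h1 h2. F g1 g2 g3 h1 h2 h3))))"
    by (intro sw_cong sw_swap)
  also have "\<dots> = sw g (\<lambda>g' g3. sw h (\<lambda>h' h3. sw (g' * h') (\<lambda>u v. f (S u * v * (S h3 * S g3)))))"
    unfolding F_def by (intro sw_cong sw_times[symmetric] LI)
  also have "\<dots> = sw g (\<lambda>g' g3. sw h (\<lambda>h' h3. eps (g' * h') * f (1 * (S h3 * S g3))))"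
    by (intro sw_cong sw_S(1)[where f = "\<lambda>x. f (x * (S _ * S _))"] LI)
  also have "\<dots> = sw g (\<lambda>g' g3. eps g' * sw h (\<lambda>h' h3. eps h' * f (S h3 * S g3)))"
    by (simp add: eps_mult sw_mult mult.assoc)
  also have "\<dots> = sw g (\<lambda>g' g3. eps g' * f (S h * S g3))"
    by (intro sw_cong arg_cong[where f = "\<lambda>x. _ * x"] sw_counit LI)
  also have "\<dots> = f (S h * S g)"
    by (intro sw_counit LI)
  finally show "f (S (g * h)) = f (S h * S g)" using 1 by simp
qed

text \<open>Again uniqueness of convolution inverses, now for maps into the tensor square: the
  coproduct after \<open>S\<close> is a left inverse of the coproduct, and the flipped pair of
  antipodes is a right inverse.\<close>

lemma sw_of_S:
  assumes f: "\<And>b. lin (\<lambda>a. f a b)" "\<And>a. lin (f a)"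
  shows "sw (S h) f = sw h (\<lambda>a b. f (S b) (S a))"
proof -
  note LI = lin_intros lin_comp[OF f(1)] lin_comp[OF f(2)]
  \<comment> \<open>Of the five legs, \<open>a\<close> belongs to the left inverse, \<open>b\<close>
    and \<open>c\<close> to the coproduct, \<open>d\<close> and \<open>e\<close> to the right
    inverse. Because of the flip, \<open>c\<close> meets \<open>S d\<close>; these are neighbouring
    legs and contract first, after which \<open>b\<close> and \<open>e\<close> are
    neighbours.\<close>
  define F where "F a b c d e = sw (S a) (\<lambda>u v. f (u * (b * S e)) (v * (c * S d)))" for a b c d e
  define X where "X = sw h (\<lambda>a x. sw x (\<lambda>b y. sw y (\<lambda>c z. sw z (\<lambda>d e. F a b c d e))))"
  have l: "lin (\<lambda>a. F a b c d e)" "lin (\<lambda>b. F a b c d e)" "lin (\<lambda>c. F a b c d e)"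
     "lin (\<lambda>d. F a b c d e)" "lin (\<lambda>e. F a b c d e)" for a b c d e
    unfolding F_def by (intro LI)+
  have "X = sw h (\<lambda>a x. sw x (\<lambda>b y. sw y (\<lambda>w e. sw w (\<lambda>c d. F a b c d e))))"
    unfolding X_def by (intro sw_cong coassoc[symmetric] LI l)
  also have "\<dots> = sw h (\<lambda>a x. sw x (\<lambda>b y. sw y (\<lambda>w e. eps w * F a b 1 1 e)))"
  proof (intro sw_cong)
    fix a b w e
    have "sw w (\<lambda>c d. F a b c d e) = sw (S a) (\<lambda>u v. sw w (\<lambda>c d. f (u * (b * S e)) (v * (c * S d))))"
      unfolding F_def by (rule sw_swap)
    also have "\<dots> = sw (S a) (\<lambda>u v. eps w * f (u * (b * S e)) (v * 1))"
      by (intro sw_cong sw_S(2)[where f = "\<lambda>x. f _ (_ * x)"] LI)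
    also have "\<dots> = eps w * F a b 1 1 e"
      by (simp add: F_def sw_mult S_1)
    finally show "sw w (\<lambda>c d. F a b c d e) = eps w * F a b 1 1 e" .
  qed
  also have "\<dots> = sw h (\<lambda>a x. sw x (\<lambda>b e. F a b 1 1 e))"
    by (intro sw_cong sw_counit l)
  also have "\<dots> = sw h (\<lambda>a x. eps x * F a 1 1 1 1)"
  proof (intro sw_cong)
    fix a x
    have "sw x (\<lambda>b e. F a b 1 1 e) = sw (S a) (\<lambda>u v. sw x (\<lambda>b e. f (u * (b * S e)) (v * (1 * S 1))))"
      unfolding F_def by (rule sw_swap)
    also have "\<dots> = sw (S a) (\<lambda>u v. eps x * f (u * 1) (v * (1 * S 1)))"
      by (intro sw_cong sw_S(2)[where f = "\<lambda>x. f (_ * x) _"] LI)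
    also have "\<dots> = eps x * F a 1 1 1 1"
      by (simp add: F_def sw_mult S_1)
    finally show "sw x (\<lambda>b e. F a b 1 1 e) = eps x * F a 1 1 1 1" .
  qed
  also have "\<dots> = F h 1 1 1 1"
    by (intro sw_counit l)
  also have "\<dots> = sw (S h) f"
    by (simp add: F_def S_1)
  finally have 1: "X = sw (S h) f" .
  \<comment> \<open>In the other bracketing \<open>b\<close> and \<open>c\<close> are the legs of a
    single \<open>w\<close>, so the left inverse merges with them into the coproduct of
    \<open>S a * w\<close>.\<close>
  have "X = sw h (\<lambda>a x. sw x (\<lambda>w z. sw w (\<lambda>b c. sw z (\<lambda>d e. F a b c d e))))"
    unfolding X_def by (intro sw_cong coassoc[symmetric] LI l)
  also have "\<dots> = sw h (\<lambda>x z. sw x (\<lambda>a w. sw w (\<lambda>b c. sw z (\<lambda>d e. F a b c d e))))"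
    by (intro coassoc[symmetric] LI l)
  also have "\<dots> = sw h (\<lambda>x z. sw x (\<lambda>a w. sw z (\<lambda>d e. sw w (\<lambda>b c. F a b c d e))))"
    by (intro sw_cong sw_swap)
  also have "\<dots> = sw h (\<lambda>x z. sw z (\<lambda>d e. sw x (\<lambda>a w. sw w (\<lambda>b c. F a b c d e))))"
    by (intro sw_cong sw_swap)
  also have "\<dots> = sw h (\<lambda>x z. sw z (\<lambda>d e. eps x * f (S e) (S d)))"
  proof (intro sw_cong)
    fix x d e
    have "sw x (\<lambda>a w. sw w (\<lambda>b c. F a b c d e)) =
        sw x (\<lambda>a w. sw (S a * w) (\<lambda>u v. f (u * S e) (v * S d)))"
    proof (rule sw_cong)
      fix a w
      have "sw (S a * w) (\<lambda>u v. f (u * S e) (v * S d)) =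
          sw (S a) (\<lambda>u v. sw w (\<lambda>b c. f (u * b * S e) (v * c * S d)))"
        by (intro sw_times LI)
      also have "\<dots> = sw w (\<lambda>b c. F a b c d e)"
        unfolding F_def by (subst sw_swap) (simp add: mult.assoc)
      finally show "sw w (\<lambda>b c. F a b c d e) = sw (S a * w) (\<lambda>u v. f (u * S e) (v * S d))" by simp
    qed
    also have "\<dots> = eps x * sw 1 (\<lambda>u v. f (u * S e) (v * S d))"
      by (intro sw_S(1)[where f = "\<lambda>y. sw y (\<lambda>u v. f (u * S e) (v * S d))"] LI)
    also have "sw 1 (\<lambda>u v. f (u * S e) (v * S d)) = f (1 * S e) (1 * S d)"
      by (intro sw_1 LI)
    finally show "sw x (\<lambda>a w. sw w (\<lambda>b c. F a b c d e)) = eps x * f (S e) (S d)" by simp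
  qed
  also have "\<dots> = sw h (\<lambda>x z. eps x * sw z (\<lambda>d e. f (S e) (S d)))"
    by (simp add: sw_mult)
  also have "\<dots> = sw h (\<lambda>d e. f (S e) (S d))"
    by (intro sw_counit LI)
  finally show ?thesis using 1 by simp
qed

lemma T_1: "T 1 = 1"
  using T_S[of 1] by (simp add: S_1)

lemma T_mult: "T (g * h) = T h * T g"
  using T_S[of "T h * T g"] by (simp add: S_mult)

lemma eps_T: "eps (T h) = eps h"
  using eps_S[of "T h"] by simp

lemma sw_of_T:
  assumes f: "\<And>b. lin (\<lambda>a. f a b)" "\<And>a. lin (f a)"
  shows "sw (T h) f = sw h (\<lambda>a b. f (T b) (T a))"
proof -
  have "sw (S (T h)) (\<lambda>a b. f (T b) (T a)) = sw (T h) (\<lambda>a b. f (T (S a)) (T (S b)))"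
    by (intro sw_of_S lin_intros lin_comp[OF f(1)] lin_comp[OF f(2)])
  then show ?thesis by simp
qed

text \<open>Apply \<open>T\<close> to the antipode laws: it exchanges the factors, so
  \<open>T\<close> acts as an antipode for the opposite coproduct.\<close>

lemma sw_T:
  assumes f: "lin f"
  shows "sw h (\<lambda>a b. f (T b * a)) = eps h * f 1" "sw h (\<lambda>a b. f (b * T a)) = eps h * f 1"
proof -
  have fT: "lin (\<lambda>x. f (T x))" by (intro lin_comp[OF f] endo_intros)
  show "sw h (\<lambda>a b. f (T b * a)) = eps h * f 1"
    using sw_S(1)[OF fT, of h] by (simp add: T_mult T_1)
  show "sw h (\<lambda>a b. f (b * T a)) = eps h * f 1"
    using sw_S(2)[OF fT, of h] by (simp add: T_mult T_1)
qed

text \<open>The antipode laws after another application of \<open>S\<close>, which reverses the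
  factors and leaves a double antipode on one leg.\<close>

lemma sw_SS:
  assumes f: "lin f"
  shows "sw h (\<lambda>a b. f (S b * S (S a))) = eps h * f 1" "sw h (\<lambda>a b. f (S (S b) * S a)) = eps h * f 1"
proof -
  have fS: "lin (\<lambda>x. f (S x))" by (intro lin_comp[OF f] endo_intros)
  show "sw h (\<lambda>a b. f (S b * S (S a))) = eps h * f 1"
    using sw_S(1)[OF fS, of h] by (simp add: S_mult S_1)
  show "sw h (\<lambda>a b. f (S (S b) * S a)) = eps h * f 1"
    using sw_S(2)[OF fS, of h] by (simp add: S_mult S_1)
qed

section \<open>Threefold and fivefold coproducts\<close>

lemma sw3_1:
  assumes f: "\<And>b c. lin (\<lambda>a. f a b c)" "\<And>a c. lin (\<lambda>b. f a b c)" "\<And>a b. lin (\<lambda>c. f a b c)"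
  shows "sw3 1 f = f 1 1 1"
proof -
  have "sw3 1 f = sw 1 (f 1)" unfolding sw3_def by (intro sw_1 lin_intros f)
  also have "\<dots> = f 1 1 1" by (intro sw_1 lin_intros f)
  finally show ?thesis .
qed

lemma sw3_times:
  assumes f: "\<And>b c. lin (\<lambda>a. f a b c)" "\<And>a c. lin (\<lambda>b. f a b c)" "\<And>a b. lin (\<lambda>c. f a b c)"
  shows "sw3 (g * h) f = sw3 g (\<lambda>a b c. sw3 h (\<lambda>a' b' c'. f (a * a') (b * b') (c * c')))"
proof -
  note LI = lin_intros lin_comp[OF f(1)] lin_comp[OF f(2)] lin_comp[OF f(3)]
  have "sw3 (g * h) f = sw g (\<lambda>a x. sw h (\<lambda>a' x'. sw (x * x') (f (a * a'))))"
    unfolding sw3_def by (intro sw_times LI f)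
  also have "\<dots> = sw g (\<lambda>a x. sw h (\<lambda>a' x'. sw x (\<lambda>b c. sw x' (\<lambda>b' c'. f (a * a') (b * b') (c * c')))))"
    by (intro sw_cong sw_times LI f)
  also have "\<dots> = sw g (\<lambda>a x. sw x (\<lambda>b c. sw h (\<lambda>a' x'. sw x' (\<lambda>b' c'. f (a * a') (b * b') (c * c')))))"
    by (intro sw_cong sw_swap)
  finally show ?thesis unfolding sw3_def .
qed

lemma sw3_counit:
  assumes "lin f"
  shows "sw3 h (\<lambda>a b c. eps a * eps c * f b) = f h"
proof -
  have "sw3 h (\<lambda>a b c. eps a * eps c * f b) = sw h (\<lambda>a x. eps a * sw x (\<lambda>b c. eps c * f b))"
    by (simp add: sw3_def sw_mult mult.assoc)
  then show ?thesis by (simp add: sw_counit assms)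
qed

text \<open>Both sides are the fivefold coproduct with legs \<open>a\<close>, \<open>a'\<close>,
  \<open>b\<close>, \<open>c'\<close>, \<open>c\<close> in this order. A split middle leg arises
  when two commutation rules are applied in succession; the other bracketing makes \<open>a\<close>,
  \<open>a'\<close> and \<open>c'\<close>, \<open>c\<close> adjacent pairs, where antipodes can
  cancel.\<close>

lemma sw3_nested:
  assumes F: "\<And>b c d e. lin (\<lambda>a. F a b c d e)" "\<And>a c d e. lin (\<lambda>b. F a b c d e)"
    "\<And>a b d e. lin (\<lambda>c. F a b c d e)" "\<And>a b c e. lin (\<lambda>d. F a b c d e)"
    "\<And>a b c d. lin (\<lambda>e. F a b c d e)"
  shows "sw3 h (\<lambda>a b c. sw3 b (\<lambda>a' b' c'. F a a' b' c' c)) =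
    sw3 h (\<lambda>x b y. sw x (\<lambda>a a'. sw y (\<lambda>c' c. F a a' b c' c)))"
proof -
  have "sw3 h (\<lambda>a b c. sw3 b (\<lambda>a' b' c'. F a a' b' c' c)) =
      sw h (\<lambda>a x. sw x (\<lambda>a' z. sw z (\<lambda>y c. sw y (\<lambda>b' c'. F a a' b' c' c))))"
    unfolding sw3_def by (intro sw_cong coassoc lin_intros F)
  also have "\<dots> = sw h (\<lambda>a x. sw x (\<lambda>a' z. sw z (\<lambda>b' v. sw v (\<lambda>c' c. F a a' b' c' c))))"
    by (intro sw_cong coassoc lin_intros F)
  also have "\<dots> = sw h (\<lambda>u z. sw u (\<lambda>a a'. sw z (\<lambda>b' v. sw v (\<lambda>c' c. F a a' b' c' c))))"
    by (intro coassoc[symmetric] lin_intros F)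
  also have "\<dots> = sw h (\<lambda>u z. sw z (\<lambda>b' v. sw u (\<lambda>a a'. sw v (\<lambda>c' c. F a a' b' c' c))))"
    by (intro sw_cong sw_swap)
  finally show ?thesis unfolding sw3_def .
qed

text \<open>One rule uses the outer legs, the other the three legs of the middle one. After
  regrouping, the pair \<open>c'\<close>, \<open>c\<close> collapses by \<open>sw_T\<close> and the
  pair \<open>a\<close>, \<open>a'\<close> by \<open>sw_SS\<close>; the two remaining counits are
  absorbed. The functional \<open>t\<close> is a spectator that carries whatever depends on the
  middle leg alone.\<close>

lemma sw3_twist_untwist:
  assumes t: "lin t" and \<phi>: "lin \<phi>"
  shows "sw3 h (\<lambda>a b c. sw3 b (\<lambda>a' b' c'. t b' * \<phi> (T c * (c' * y * S a') * S (S a)))) = t h * \<phi> y"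
    and "sw3 h (\<lambda>a b c. sw3 b (\<lambda>a' b' c'. t b' * \<phi> (c * (T c' * y * S (S a')) * S a))) = t h * \<phi> y"
proof -
  note LI = lin_intros lin_comp[OF t] lin_comp[OF \<phi>] t
  have "sw3 h (\<lambda>a b c. sw3 b (\<lambda>a' b' c'. t b' * \<phi> (T c * (c' * y * S a') * S (S a)))) =
      sw3 h (\<lambda>u b v. sw u (\<lambda>a a'. sw v (\<lambda>c' c. t b * \<phi> (T c * (c' * y * S a') * S (S a)))))"
    by (intro sw3_nested LI)
  also have "\<dots> = sw3 h (\<lambda>u b v. sw u (\<lambda>a a'. eps v * (t b * \<phi> (1 * (y * (S a' * S (S a)))))))"
  proof (intro sw3_cong sw_cong)
    fix u b v a a'
    have "sw v (\<lambda>c' c. t b * \<phi> ((T c * c') * (y * (S a' * S (S a))))) = eps v * (t b * \<phi> (1 * (y * (S a' * S (S a)))))"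
      by (intro sw_T(1)[where f = "\<lambda>x. t b * \<phi> (x * _)"] LI)
    then show "sw v (\<lambda>c' c. t b * \<phi> (T c * (c' * y * S a') * S (S a))) = eps v * (t b * \<phi> (1 * (y * (S a' * S (S a)))))"
      by (simp add: mult.assoc)
  qed
  also have "\<dots> = sw3 h (\<lambda>u b v. eps u * (eps v * (t b * \<phi> (1 * (y * 1)))))"
    by (intro sw3_cong sw_SS(1)[where f = "\<lambda>x. _ * (_ * \<phi> (1 * (y * x)))"] LI)
  also have "\<dots> = t h * \<phi> y"
    using sw3_counit[OF t, of h] by (simp add: sw3_mult mult.assoc[symmetric])
  finally show "sw3 h (\<lambda>a b c. sw3 b (\<lambda>a' b' c'. t b' * \<phi> (T c * (c' * y * S a') * S (S a)))) = t h * \<phi> y" .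
  have "sw3 h (\<lambda>a b c. sw3 b (\<lambda>a' b' c'. t b' * \<phi> (c * (T c' * y * S (S a')) * S a))) =
      sw3 h (\<lambda>u b v. sw u (\<lambda>a a'. sw v (\<lambda>c' c. t b * \<phi> (c * (T c' * y * S (S a')) * S a))))"
    by (intro sw3_nested LI)
  also have "\<dots> = sw3 h (\<lambda>u b v. sw u (\<lambda>a a'. eps v * (t b * \<phi> (1 * (y * (S (S a') * S a))))))"
  proof (intro sw3_cong sw_cong)
    fix u b v a a'
    have "sw v (\<lambda>c' c. t b * \<phi> ((c * T c') * (y * (S (S a') * S a)))) = eps v * (t b * \<phi> (1 * (y * (S (S a') * S a))))"
      by (intro sw_T(2)[where f = "\<lambda>x. t b * \<phi> (x * _)"] LI)
    then show "sw v (\<lambda>c' c. t b * \<phi> (c * (T c' * y * S (S a')) * S a)) = eps v * (t b * \<phi> (1 * (y * (S (S a') * S a))))"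
      by (simp add: mult.assoc)
  qed
  also have "\<dots> = sw3 h (\<lambda>u b v. eps u * (eps v * (t b * \<phi> (1 * (y * 1)))))"
    by (intro sw3_cong sw_SS(2)[where f = "\<lambda>x. _ * (_ * \<phi> (1 * (y * x)))"] LI)
  also have "\<dots> = t h * \<phi> y"
    using sw3_counit[OF t, of h] by (simp add: sw3_mult mult.assoc[symmetric])
  finally show "sw3 h (\<lambda>a b c. sw3 b (\<lambda>a' b' c'. t b' * \<phi> (c * (T c' * y * S (S a')) * S a))) = t h * \<phi> y" .
qed

section \<open>The dual Hopf algebra and \<open>A(H)\<close>\<close>

abbreviation D :: "('k, 'h \<Rightarrow> 'k) vspace" where "D \<equiv> dual H"

lemma dual_eval [simp]: "linear_on D ground (\<lambda>\<phi>. \<phi> x)"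
  by (rule linear_on_dual_eval) simp

text \<open>The values of \<phi> on the basis are its coordinates in the dual basis, so this is
  linearity of \<open>K\<close>.\<close>

lemma dual_form_expansion:
  assumes K: "linear_on D ground K" and \<phi>: "lin \<phi>"
  shows "(\<Sum>i\<in>B. \<phi> i * K (coord i)) = K \<phi>"
proof -
  have "\<phi> = (\<Sum>i\<in>B. scl D (\<phi> i) (coord i))"
    using dual_expansion[OF \<phi>] by (simp add: fun_eq_iff sum_fun_apply)
  then have "K \<phi> = K (\<Sum>i\<in>B. scl D (\<phi> i) (coord i))" by simp
  also have "\<dots> = (\<Sum>i\<in>B. K (scl D (\<phi> i) (coord i)))"
    by (rule linear_on_sum[OF K is_vspace_dual]) (simp add: lin_intros)
  also have "\<dots> = (\<Sum>i\<in>B. \<phi> i * K (coord i))"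
    using linear_on_ground_scl[OF K, of "coord _"] by (simp add: lin_coord)
  finally show ?thesis by simp
qed

lemma dual_tensor_expand:
  assumes W: "is_vspace W" and t: "t \<in> space (tensor D W)" and \<beta>: "bilinear_on D W ground \<beta>"
  shows "t \<beta> = (\<Sum>i\<in>B. t (\<lambda>\<phi> w. \<phi> i * \<beta> (coord i) w))"
  by (rule tensor_expand_left[OF is_vspace_dual W t \<beta>])
    (auto simp: lin_coord dual_form_expansion[OF bilinear_onD(2)[OF \<beta>]])

lemma tensor_dual_expand:
  assumes V: "is_vspace V" and t: "t \<in> space (tensor V D)" and \<beta>: "bilinear_on V D ground \<beta>"
  shows "t \<beta> = (\<Sum>i\<in>B. t (\<lambda>v \<phi>. \<phi> i * \<beta> v (coord i)))"
  by (rule tensor_expand_right[OF V is_vspace_dual t \<beta>])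
    (auto simp: lin_coord dual_form_expansion[OF bilinear_onD(1)[OF \<beta>]])

lemma bilinear_dual_eval: "bilinear_on D D ground (\<lambda>\<phi> \<psi>. \<phi> a * \<psi> b)"
  by (intro bilinear_onI linear_on_lin_intros dual_eval)

lemma bilinear_dual_H_eval: "lin \<chi> \<Longrightarrow> bilinear_on D H ground (\<lambda>\<phi> h. \<phi> x * \<chi> h)"
  by (intro bilinear_onI linear_on_lin_intros dual_eval)

text \<open>Expansion along the dual basis in both legs shows that the products of evaluations span
  the bilinear forms on the dual.\<close>

lemma dual_dual_tensor_eqI:
  assumes s: "s \<in> space (tensor D D)" and t: "t \<in> space (tensor D D)"
    and eq: "\<And>a b. s (\<lambda>\<phi> \<psi>. \<phi> a * \<psi> b) = t (\<lambda>\<phi> \<psi>. \<phi> a * \<psi> b)"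
  shows "s = t"
proof (rule tensor_eqI[OF s t])
  fix \<beta> assume \<beta>: "bilinear_on D D ground \<beta>"
  have "u \<beta> = (\<Sum>i\<in>B. \<Sum>j\<in>B. \<beta> (coord i) (coord j) * u (\<lambda>\<phi> \<psi>. \<phi> i * \<psi> j))"
    if u: "u \<in> space (tensor D D)" for u
  proof -
    have b: "bilinear_on D D ground (\<lambda>\<phi> w. \<phi> i * \<beta> (coord i) w)" for i
      by (intro bilinear_onI linear_on_lin_intros dual_eval bilinear_onD(1)[OF \<beta>]) (simp add: lin_coord)
    have "u \<beta> = (\<Sum>i\<in>B. u (\<lambda>\<phi> w. \<phi> i * \<beta> (coord i) w))"
      by (rule dual_tensor_expand[OF is_vspace_dual u \<beta>])
    also have "\<dots> = (\<Sum>i\<in>B. \<Sum>j\<in>B. u (\<lambda>\<phi> \<psi>. \<psi> j * (\<phi> i * \<beta> (coord i) (coord j))))"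
      by (intro sum.cong refl tensor_dual_expand[OF is_vspace_dual u b])
    also have "\<dots> = (\<Sum>i\<in>B. \<Sum>j\<in>B. u (\<lambda>\<phi> \<psi>. \<beta> (coord i) (coord j) * (\<phi> i * \<psi> j)))"
      by (simp add: mult_ac)
    finally show ?thesis by (simp add: tensor_eval_mult[OF bilinear_dual_eval u])
  qed
  from this[OF s] this[OF t] eq show "s \<beta> = t \<beta>" by simp
qed

text \<open>Expanding the dual leg suffices: \<beta> becomes a sum of evaluations at basis elements
  times the functionals \<open>\<beta> (coord i)\<close> on \<open>H\<close>. Elements of A(H) are
  compared through these matrix coefficients.\<close>

lemma dual_H_tensor_eqI:
  assumes s: "s \<in> space (tensor D H)" and t: "t \<in> space (tensor D H)"
    and eq: "\<And>x \<chi>. lin \<chi> \<Longrightarrow> s (\<lambda>\<phi> h. \<phi> x * \<chi> h) = t (\<lambda>\<phi> h. \<phi> x * \<chi> h)"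
  shows "s = t"
proof (rule tensor_eqI[OF s t])
  fix \<beta> assume \<beta>: "bilinear_on D H ground \<beta>"
  have "s (\<lambda>\<phi> w. \<phi> i * \<beta> (coord i) w) = t (\<lambda>\<phi> w. \<phi> i * \<beta> (coord i) w)" for i
    by (rule eq) (rule bilinear_onD(1)[OF \<beta>], simp add: lin_coord)
  then show "s \<beta> = t \<beta>"
    unfolding dual_tensor_expand[OF is_vspace_H s \<beta>] dual_tensor_expand[OF is_vspace_H t \<beta>] by simp
qed

lemma linear_on_dual_H_tensorI:
  assumes V: "is_vspace V" and f: "\<And>v. v \<in> space V \<Longrightarrow> f v \<in> space (tensor D H)"
    and lin: "\<And>x \<chi>. lin \<chi> \<Longrightarrow> linear_on V ground (\<lambda>v. f v (\<lambda>\<phi> h. \<phi> x * \<chi> h))"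
  shows "linear_on V (tensor D H) f"
  unfolding linear_on_def
proof (intro conjI ballI allI)
  note T = is_vspace_tensor[OF is_vspace_dual is_vspace_H]
  note L = is_vspaceD(2,3)[OF T]
  fix v v' c assume v: "v \<in> space V"
  show fv: "f v \<in> space (tensor D H)" using v by (rule f)
  show "f (scl V c v) = scl (tensor D H) c (f v)"
  proof (rule dual_H_tensor_eqI)
    show "f (scl V c v) \<in> space (tensor D H)" using v by (intro f is_vspaceD[OF V])
    show "scl (tensor D H) c (f v) \<in> space (tensor D H)" using fv by (rule L)
  qed (use v lin in \<open>simp add: linear_on_ground_iff\<close>)
  assume v': "v' \<in> space V"
  show "f (v + v') = f v + f v'"
  proof (rule dual_H_tensor_eqI)
    show "f (v + v') \<in> space (tensor D H)" using v v' by (intro f is_vspaceD[OF V])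
    show "f v + f v' \<in> space (tensor D H)" using fv f[OF v'] by (rule L)
  qed (use v v' lin in \<open>simp add: linear_on_ground_iff\<close>)
qed

text \<open>The witness is read off from the expansion of \<open>a\<close> in
  \<open>\<psi> (a * b)\<close> along the basis. The uniqueness demanded by the definite description
  holds because evaluations separate tensors.\<close>

lemma dual_comult_eq:
  assumes \<psi>: "lin \<psi>"
  shows "dual_comult H \<psi> = (\<Sum>i\<in>B. ptensor D D (coord i) (\<lambda>x. \<psi> (i * x)))" (is "_ = ?t")
  unfolding dual_comult_def
proof (rule the_equality)
  have t: "?t \<in> space (tensor D D)"
    by (intro is_vspaceD(4)[OF is_vspace_tensor[OF is_vspace_dual is_vspace_dual]] ptensor_in_tensor)
      (simp_all add: lin_coord lin_comp[OF \<psi>] endo_intros)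
  have *: "?t (\<lambda>\<phi>1 \<phi>2. \<phi>1 a * \<phi>2 b) = \<psi> (a * b)" for a b
    using lin_expansion[OF lin_comp[OF \<psi> linear_mult(1)], of a b]
    by (simp add: sum_fun_apply ptensor_eval[OF bilinear_dual_eval])
  show "?t \<in> space (tensor D D) \<and> (\<forall>a b. tlift D D (\<lambda>\<phi>1 \<phi>2. \<phi>1 a * \<phi>2 b) ?t = \<psi> (a * b))"
    using t * by (simp only: tlift_ground[OF bilinear_dual_eval t] simp_thms)
  fix s assume s: "s \<in> space (tensor D D) \<and> (\<forall>a b. tlift D D (\<lambda>\<phi>1 \<phi>2. \<phi>1 a * \<phi>2 b) s = \<psi> (a * b))"
  show "s = ?t"
    by (rule dual_dual_tensor_eqI[OF _ t]) (use s * in \<open>auto simp: tlift_ground[OF bilinear_dual_eval]\<close>)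
qed

lemma dual_comult_in_tensor: "lin \<psi> \<Longrightarrow> dual_comult H \<psi> \<in> space (tensor D D)"
  unfolding dual_comult_eq
  by (intro is_vspaceD(4)[OF is_vspace_tensor[OF is_vspace_dual is_vspace_dual]] ptensor_in_tensor)
    (simp_all add: lin_coord lin_comp endo_intros)

lemma dual_comult_eval:
  "lin \<psi> \<Longrightarrow> bilinear_on D D ground \<beta> \<Longrightarrow>
     dual_comult H \<psi> \<beta> = (\<Sum>i\<in>B. \<beta> (coord i) (\<lambda>x. \<psi> (i * x)))"
  by (simp add: dual_comult_eq sum_fun_apply ptensor_eval)

lemma linear_dual_comult: "linear_on D (tensor D D) (dual_comult H)"
proof (rule linear_on_functionalsI[OF is_vspace_dual is_vspace_tensor[OF is_vspace_dual is_vspace_dual]])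
  show "dual_comult H \<psi> \<in> space (tensor D D)" if "\<psi> \<in> space D" for \<psi>
    using that by (simp add: dual_comult_in_tensor)
  fix \<gamma> assume \<gamma>: "linear_on (tensor D D) ground \<gamma>"
  let ?\<beta> = "\<lambda>\<phi> \<psi>. \<gamma> (ptensor D D \<phi> \<psi>)"
  have b: "bilinear_on D D ground ?\<beta>" by (rule bilinear_on_compose[OF bilinear_ptensor \<gamma>])
  have m: "linear_on D D (\<lambda>\<psi> x. \<psi> (i * x))" for i
    by (rule linear_on_dualI) (simp_all add: lin_comp endo_intros)
  have "linear_on D ground (\<lambda>\<psi>. \<Sum>i\<in>B. ?\<beta> (coord i) (\<lambda>x. \<psi> (i * x)))"
    by (intro linear_on_lin_intros linear_on_compose[OF m bilinear_onD(1)[OF b]]) (simp add: lin_coord)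
  moreover have "\<gamma> (dual_comult H \<psi>) = (\<Sum>i\<in>B. ?\<beta> (coord i) (\<lambda>x. \<psi> (i * x)))" if "lin \<psi>" for \<psi>
    using form_tensor[OF is_vspace_dual is_vspace_dual \<gamma> dual_comult_in_tensor[OF that]]
    by (simp add: dual_comult_eval[OF that b])
  ultimately show "linear_on D ground (\<lambda>\<psi>. \<gamma> (dual_comult H \<psi>))"
    using is_vspaceD(2,3)[OF is_vspace_dual[of H]] by (simp add: linear_on_ground_iff)
qed

text \<open>Evaluating the outer legs at \<open>u\<close> and \<open>v\<close> undoes the coproduct
  of the dual and leaves \<psi> with both factors inserted. The linear map \<open>K\<close> is
  arbitrary so that this collapse can take place inside the tensor product that defines the
  multiplication of A(H).\<close>

lemma dual_sweedler3:
  assumes U: "is_vspace U" and K: "linear_on D U K" and \<psi>: "lin \<psi>"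
  shows "sweedler3 D (dual_comult H) (\<lambda>\<psi>1 \<psi>2 \<psi>3. scl U (\<psi>1 u * \<psi>3 v) (K \<psi>2)) \<psi> =
    K (\<lambda>x. \<psi> (u * x * v))"
proof (rule functionals_separate[OF U])
  fix \<gamma> assume \<gamma>: "linear_on U ground \<gamma>"
  let ?f = "\<lambda>\<psi>1 \<psi>2 \<psi>3. scl U (\<psi>1 u * \<psi>3 v) (K \<psi>2)"
  define \<kappa> where "\<kappa> = (\<lambda>\<phi>. \<gamma> (K \<phi>))"
  have \<kappa>: "linear_on D ground \<kappa>" unfolding \<kappa>_def by (rule linear_on_compose[OF K \<gamma>])
  have \<gamma>f: "\<gamma> (?f a b c) = a u * c v * \<kappa> b" if "lin b" for a b c
    using linear_on_ground_scl[OF \<gamma> linear_onD(1)[OF K]] that by (simp add: \<kappa>_def)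
  note sclL = is_vspaceD[OF U]
  have lK: "linear_on D U (\<lambda>b. scl U c (K b))" for c
    using K by (auto simp: linear_on_def sclL mult_ac)
  have b1: "bilinear_on D D U (?f a)" for a
    by (intro bilinear_onI lK linear_on_scl_left[OF U] linear_onD(1)[OF K] linear_on_lin_intros dual_eval)
  have lin3: "linear_on D U (\<lambda>a. ?f a b c)" if "lin b" for b c
    using that by (intro linear_on_scl_left[OF U] linear_onD(1)[OF K] linear_on_lin_intros dual_eval) simp
  have "bilinear_on (tensor D D) D U (\<lambda>t a. tlift D D (?f a) t)"
    by (rule bilinear_on_tlift[OF is_vspace_dual U _ _ is_vspace_dual]) (simp_all add: b1 lin3)
  then have b2: "bilinear_on D D U (\<lambda>a x. tlift D D (?f a) (dual_comult H x))"
    by (intro bilinear_onI linear_on_compose[OF linear_dual_comult tensor_universal(1)[OF is_vspace_dual U b1]])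
      (rule bilinear_onD(1)[OF _ dual_comult_in_tensor], simp_all)
  have inner: "\<gamma> (tlift D D (?f a) (dual_comult H x)) = a u * \<kappa> (\<lambda>y. x (y * v))" if x: "lin x" for a x
  proof -
    note dt = dual_comult_in_tensor[OF x]
    have b3: "bilinear_on D D ground (\<lambda>b c. a u * c v * \<kappa> b)"
      by (intro bilinear_onI linear_on_lin_intros dual_eval \<kappa>)
    have "\<gamma> (tlift D D (?f a) (dual_comult H x)) = dual_comult H x (\<lambda>b c. \<gamma> (?f a b c))"
      by (rule form_tlift[OF U b1 \<gamma> dt])
    also have "\<dots> = dual_comult H x (\<lambda>b c. a u * c v * \<kappa> b)"
      by (rule tensor_eval_cong[OF is_vspace_dual is_vspace_dual dt]) (simp add: \<gamma>f)
    also have "\<dots> = (\<Sum>i\<in>B. a u * x (i * v) * \<kappa> (coord i))"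
      by (rule dual_comult_eval[OF x b3])
    also have "\<dots> = a u * \<kappa> (\<lambda>y. x (y * v))"
      using dual_form_expansion[OF \<kappa> lin_comp[OF x linear_mult(1)], of v]
      by (simp add: sum_distrib_left[symmetric] mult.assoc)
    finally show ?thesis .
  qed
  have mv: "linear_on D D (\<lambda>x y. x (y * v))"
    by (rule linear_on_dualI) (simp_all add: lin_comp[OF _ linear_mult(1)])
  have b4: "bilinear_on D D ground (\<lambda>a x. a u * \<kappa> (\<lambda>y. x (y * v)))"
    by (intro bilinear_onI linear_on_lin_intros dual_eval linear_on_compose[OF mv \<kappa>])
  note dt = dual_comult_in_tensor[OF \<psi>]
  \<comment> \<open>Expanding \<kappa> along the dual basis makes the linearity in \<open>i\<close>
    visible.\<close>
  have "lin (\<lambda>i. \<Sum>j\<in>B. \<psi> (i * (j * v)) * \<kappa> (coord j))"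
    by (intro lin_intros lin_comp[OF \<psi>])
  moreover have "\<kappa> (\<lambda>y. \<psi> (i * (y * v))) = (\<Sum>j\<in>B. \<psi> (i * (j * v)) * \<kappa> (coord j))" for i
    by (rule dual_form_expansion[OF \<kappa>, symmetric]) (intro lin_comp[OF \<psi>] endo_intros)
  ultimately have l: "lin (\<lambda>i. \<kappa> (\<lambda>y. \<psi> (i * (y * v))))" by simp
  have "\<gamma> (sweedler3 D (dual_comult H) ?f \<psi>) = dual_comult H \<psi> (\<lambda>a x. \<gamma> (tlift D D (?f a) (dual_comult H x)))"
    unfolding sweedler3_def by (rule form_tlift[OF U b2 \<gamma> dt])
  also have "\<dots> = dual_comult H \<psi> (\<lambda>a x. a u * \<kappa> (\<lambda>y. x (y * v)))"
    by (rule tensor_eval_cong[OF is_vspace_dual is_vspace_dual dt]) (simp add: inner)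
  also have "\<dots> = (\<Sum>i\<in>B. coord i u * \<kappa> (\<lambda>y. \<psi> (i * (y * v))))"
    by (rule dual_comult_eval[OF \<psi> b4])
  also have "\<dots> = \<kappa> (\<lambda>y. \<psi> (u * (y * v)))"
    by (rule lin_expansion[OF l])
  finally show "\<gamma> (sweedler3 D (dual_comult H) ?f \<psi>) = \<gamma> (K (\<lambda>x. \<psi> (u * x * v)))"
    by (simp add: \<kappa>_def mult.assoc)
qed

text \<open>The passage from vectors to scalars: trilinearity controls both nested definite
  descriptions, so a functional moves through them and each evaluation of the coproduct becomes a
  basis sum.\<close>

lemma
  assumes U: "is_vspace U"
    and f: "\<And>b c. linear_on H U (\<lambda>a. f a b c)" "\<And>a c. linear_on H U (\<lambda>b. f a b c)" "\<And>a b. linear_on H U (f a b)"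
  shows sweedler3_closed: "sweedler3 H (comult H) f h \<in> space U"
    and sweedler3_form: "linear_on U ground \<gamma> \<Longrightarrow>
      \<gamma> (sweedler3 H (comult H) f h) = sw3 h (\<lambda>a b c. \<gamma> (f a b c))"
proof -
  have b1: "bilinear_on H H U (f a)" for a by (intro bilinear_onI f)
  have "bilinear_on (tensor H H) H U (\<lambda>t a. tlift H H (f a) t)"
    by (rule bilinear_on_tlift[OF is_vspace_H U b1 f(1) is_vspace_H])
  then have b2: "bilinear_on H H U (\<lambda>a x. tlift H H (f a) (comult H x))"
    by (intro bilinear_onI linear_on_compose[OF linear_comult tensor_universal(1)[OF is_vspace_H U b1]])
      (rule bilinear_onD(1)[OF _ comult_in_tensor])
  show "sweedler3 H (comult H) f h \<in> space U"
    unfolding sweedler3_def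
    using linear_onD(1)[OF tensor_universal(1)[OF is_vspace_H U b2] comult_in_tensor] .
  assume \<gamma>: "linear_on U ground \<gamma>"
  have l: "lin (\<lambda>a. \<gamma> (f a b c))" "lin (\<lambda>b. \<gamma> (f a b c))" "lin (\<lambda>c. \<gamma> (f a b c))" for a b c
    by (rule linear_on_compose[OF _ \<gamma>], rule f)+
  show "\<gamma> (sweedler3 H (comult H) f h) = sw3 h (\<lambda>a b c. \<gamma> (f a b c))"
    unfolding sweedler3_def sw3_def form_tlift[OF U b2 \<gamma> comult_in_tensor]
      form_tlift[OF U b1 \<gamma> comult_in_tensor]
  proof -
    have "comult H x (\<lambda>b c. \<gamma> (f a b c)) = sw x (\<lambda>b c. \<gamma> (f a b c))" for a x
      by (intro comult_eval lin_intros l)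
    then show "comult H h (\<lambda>a x. comult H x (\<lambda>b c. \<gamma> (f a b c))) = sw h (\<lambda>a x. sw x (\<lambda>b c. \<gamma> (f a b c)))"
      by (simp only:) (intro comult_eval lin_intros l)
  qed
qed

lemma convolution_eq:
  assumes "lin \<phi>" "lin \<psi>"
  shows "convolution H \<phi> \<psi> x = sw x (\<lambda>a b. \<phi> a * \<psi> b)"
  unfolding convolution_def
  by (subst tlift_ground[OF _ comult_in_tensor]) (intro comult_eval lin_intros assms)+

lemma lin_convolution: "lin \<phi> \<Longrightarrow> lin \<psi> \<Longrightarrow> lin (convolution H \<phi> \<psi>)"
  using lin_sw[OF endo_intros(1), of "\<lambda>a b. \<phi> a * \<psi> b"] by (simp add: convolution_eq[symmetric])

section \<open>The multiplication of A(H)\<close>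

abbreviation AT :: "('k, ('k, 'h \<Rightarrow> 'k, 'h) tensor) vspace" where "AT \<equiv> tensor D H"

text \<open>What is left of the three legs of \<psi> once \<open>dual_sweedler3\<close> is applied
  with \<open>u = T c\<close> and \<open>v = S (S a)\<close>.\<close>

abbreviation twist :: "'h \<Rightarrow> 'h \<Rightarrow> ('h \<Rightarrow> 'k) \<Rightarrow> 'h \<Rightarrow> 'k" where
  "twist c a \<psi> \<equiv> \<lambda>x. \<psi> (T c * x * S (S a))"

text \<open>The product of two pure tensors, with legs \<phi>, \<open>h\<close> and \<psi>,
  \<open>g\<close>, after the Sweedler sum over \<psi> has been collapsed into
  \<open>twist\<close>.\<close>

definition AH_kernel :: "('h \<Rightarrow> 'k) \<Rightarrow> 'h \<Rightarrow> ('h \<Rightarrow> 'k) \<Rightarrow> 'h \<Rightarrow> ('k, 'h \<Rightarrow> 'k, 'h) tensor" where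
  "AH_kernel \<phi> h \<psi> g =
     sweedler3 H (comult H) (\<lambda>a b c. ptensor D H (convolution H \<phi> (twist c a \<psi>)) (b * g)) h"

lemma is_vspace_AT: "is_vspace AT"
  by (rule is_vspace_tensor[OF is_vspace_dual is_vspace_H])

lemma lin_twist: "lin \<psi> \<Longrightarrow> lin (twist c a \<psi>)"
  by (erule lin_comp) (intro endo_intros)

lemma linear_twist:
  assumes "lin \<psi>"
  shows "linear_on H D (\<lambda>a. twist c a \<psi>)" "linear_on H D (\<lambda>c. twist c a \<psi>)"
proof -
  show "linear_on H D (\<lambda>a. twist c a \<psi>)" "linear_on H D (\<lambda>c. twist c a \<psi>)"
    by (rule linear_on_dualI, rule lin_twist[OF assms], intro lin_comp[OF assms] endo_intros)+
qed

lemma ptensor_convolution_eval: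
  assumes "lin \<phi>" "lin \<psi>" "lin \<chi>"
  shows "ptensor D H (convolution H \<phi> \<psi>) w (\<lambda>\<phi> h. \<phi> x * \<chi> h) = sw x (\<lambda>a b. \<phi> a * \<psi> b) * \<chi> w"
  by (simp add: ptensor_eval[OF bilinear_dual_H_eval[OF assms(3)]] convolution_eq assms)

text \<open>The first three parts provide trilinearity in the legs of \<open>h\<close>; the last one
  concerns the map that plays the role of \<open>K\<close> in \<open>dual_sweedler3\<close>.\<close>

lemma linear_kernel_terms:
  assumes \<phi>: "lin \<phi>" and \<psi>: "lin \<psi>"
  shows "linear_on H AT (\<lambda>a. ptensor D H (convolution H \<phi> (twist c a \<psi>)) w)"
    and "linear_on H AT (\<lambda>b. ptensor D H (convolution H \<phi> \<psi>) (b * g))"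
    and "linear_on H AT (\<lambda>c. ptensor D H (convolution H \<phi> (twist c a \<psi>)) w)"
    and "linear_on D AT (\<lambda>\<psi>. ptensor D H (convolution H \<phi> \<psi>) w)"
proof -
  note LI = lin_intros lin_comp[OF \<phi>] lin_comp[OF \<psi>]
  have m: "ptensor D H (convolution H \<phi> \<psi>) w \<in> space AT" if "lin \<psi>" for \<psi> w
    by (rule ptensor_in_tensor) (simp_all add: lin_convolution \<phi> that)
  show "linear_on H AT (\<lambda>a. ptensor D H (convolution H \<phi> (twist c a \<psi>)) w)"
    by (rule linear_on_dual_H_tensorI[OF is_vspace_H m[OF lin_twist[OF \<psi>]]])
      (simp only: ptensor_convolution_eval[OF \<phi> lin_twist[OF \<psi>]], intro LI)
  show "linear_on H AT (\<lambda>b. ptensor D H (convolution H \<phi> \<psi>) (b * g))"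
    by (rule linear_on_dual_H_tensorI[OF is_vspace_H m[OF \<psi>]])
      (simp only: ptensor_convolution_eval[OF \<phi> \<psi>], intro linear_on_lin_intros, erule lin_comp, intro endo_intros)
  show "linear_on H AT (\<lambda>c. ptensor D H (convolution H \<phi> (twist c a \<psi>)) w)"
    by (rule linear_on_dual_H_tensorI[OF is_vspace_H m[OF lin_twist[OF \<psi>]]])
      (simp only: ptensor_convolution_eval[OF \<phi> lin_twist[OF \<psi>]], intro LI)
  have "linear_on D ground (\<lambda>\<psi>. convolution H \<phi> \<psi> x)" for x
  proof -
    have "linear_on D ground (\<lambda>\<psi>. sw x (\<lambda>a b. \<phi> a * \<psi> b))"
      by (intro linear_on_sw linear_on_lin_intros dual_eval)
    then show ?thesis
      using is_vspaceD(2,3)[OF is_vspace_dual[of H]]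
      by (simp add: linear_on_ground_iff[of D] convolution_eq[OF \<phi>])
  qed
  then have "linear_on D D (convolution H \<phi>)"
    by (intro linear_on_dualI) (simp_all add: lin_convolution \<phi>)
  then show "linear_on D AT (\<lambda>\<psi>. ptensor D H (convolution H \<phi> \<psi>) w)"
    by (rule linear_on_compose) (rule bilinear_onD(2)[OF bilinear_ptensor], simp)
qed

lemma
  assumes \<phi>: "lin \<phi>" and \<psi>: "lin \<psi>"
  shows AH_kernel_closed: "AH_kernel \<phi> h \<psi> g \<in> space AT"
    and AH_kernel_form: "linear_on AT ground \<gamma> \<Longrightarrow> \<gamma> (AH_kernel \<phi> h \<psi> g) =
      sw3 h (\<lambda>a b c. \<gamma> (ptensor D H (convolution H \<phi> (twist c a \<psi>)) (b * g)))"
    and AH_kernel_eval: "lin \<chi> \<Longrightarrow> AH_kernel \<phi> h \<psi> g (\<lambda>\<phi> h. \<phi> x * \<chi> h) =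
      sw3 h (\<lambda>a b c. sw x (\<lambda>x1 x2. \<phi> x1 * twist c a \<psi> x2) * \<chi> (b * g))"
proof -
  note tri = linear_kernel_terms(1)[OF \<phi> \<psi>] linear_kernel_terms(2)[OF \<phi> lin_twist[OF \<psi>]]
    linear_kernel_terms(3)[OF \<phi> \<psi>]
  show "AH_kernel \<phi> h \<psi> g \<in> space AT"
    unfolding AH_kernel_def by (rule sweedler3_closed[OF is_vspace_AT tri])
  show f: "\<gamma> (AH_kernel \<phi> h \<psi> g) =
      sw3 h (\<lambda>a b c. \<gamma> (ptensor D H (convolution H \<phi> (twist c a \<psi>)) (b * g)))"
    if "linear_on AT ground \<gamma>" for \<gamma>
    unfolding AH_kernel_def by (rule sweedler3_form[OF is_vspace_AT tri that])
  show "AH_kernel \<phi> h \<psi> g (\<lambda>\<phi> h. \<phi> x * \<chi> h) =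
      sw3 h (\<lambda>a b c. sw x (\<lambda>x1 x2. \<phi> x1 * twist c a \<psi> x2) * \<chi> (b * g))" if "lin \<chi>"
    by (simp add: f[OF linear_on_tensor_eval] ptensor_convolution_eval[OF \<phi> lin_twist[OF \<psi>] that])
qed

lemma AH_mult_eq:
  "AH_mult H x y = tlift D H (\<lambda>\<phi> h. tlift D H (AH_kernel \<phi> h) y) x"
  unfolding AH_mult_def
proof (intro tlift_cong)
  fix \<phi> h \<psi> g assume "\<phi> \<in> space D" "\<psi> \<in> space D"
  then have \<phi>: "lin \<phi>" and \<psi>: "lin \<psi>" by simp_all
  show "sweedler3 H (comult H) (\<lambda>h1 h2 h3.
           sweedler3 (dual H) (dual_comult H) (\<lambda>\<psi>1 \<psi>2 \<psi>3.
             scl (tensor (dual H) H)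
               (\<psi>1 (inv (antipode H) h3) * \<psi>3 (antipode H (antipode H h1)))
               (ptensor (dual H) H (convolution H \<phi> \<psi>2) (h2 * g)))
             \<psi>) h = AH_kernel \<phi> h \<psi> g"
    unfolding AH_kernel_def dual_sweedler3[OF is_vspace_AT linear_kernel_terms(4)[OF \<phi> \<psi>] \<psi>] ..
qed

lemma linear_AH_kernel:
  assumes \<phi>: "lin \<phi>" and \<psi>: "lin \<psi>"
  shows "linear_on D AT (\<lambda>\<phi>. AH_kernel \<phi> h \<psi> g)" "linear_on H AT (\<lambda>h. AH_kernel \<phi> h \<psi> g)"
    "linear_on D AT (\<lambda>\<psi>. AH_kernel \<phi> h \<psi> g)" "linear_on H AT (AH_kernel \<phi> h \<psi>)"
proof -
  \<comment> \<open>The evaluation formula of the kernel is known for linear functionals only, so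
    linearity in a dual variable is transferred on the carrier alone.\<close>
  have cong: "linear_on D ground f" if "linear_on D ground f'" "\<And>\<phi>. lin \<phi> \<Longrightarrow> f \<phi> = f' \<phi>" for f f'
    using that is_vspaceD(2,3)[OF is_vspace_dual[of H]] by (simp add: linear_on_ground_iff)
  show "linear_on D AT (\<lambda>\<phi>. AH_kernel \<phi> h \<psi> g)"
  proof (rule linear_on_dual_H_tensorI[OF is_vspace_dual])
    fix x \<chi> assume \<chi>: "lin \<chi>"
    show "linear_on D ground (\<lambda>\<phi>. AH_kernel \<phi> h \<psi> g (\<lambda>\<phi> h. \<phi> x * \<chi> h))"
      by (rule cong[OF _ AH_kernel_eval[OF _ \<psi> \<chi>]])
        (intro linear_on_sw3 linear_on_sw linear_on_lin_intros dual_eval)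
  qed (simp add: AH_kernel_closed \<psi>)
  show "linear_on H AT (\<lambda>h. AH_kernel \<phi> h \<psi> g)"
    by (rule linear_on_dual_H_tensorI[OF is_vspace_H AH_kernel_closed[OF \<phi> \<psi>]])
      (simp only: AH_kernel_eval[OF \<phi> \<psi>], intro lin_intros)
  show "linear_on D AT (\<lambda>\<psi>. AH_kernel \<phi> h \<psi> g)"
  proof (rule linear_on_dual_H_tensorI[OF is_vspace_dual])
    fix x \<chi> assume \<chi>: "lin \<chi>"
    show "linear_on D ground (\<lambda>\<psi>. AH_kernel \<phi> h \<psi> g (\<lambda>\<phi> h. \<phi> x * \<chi> h))"
      by (rule cong[OF _ AH_kernel_eval[OF \<phi> _ \<chi>]])
        (intro linear_on_sw3 linear_on_sw linear_on_lin_intros dual_eval)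
  qed (simp add: AH_kernel_closed \<phi>)
  show "linear_on H AT (AH_kernel \<phi> h \<psi>)"
    by (rule linear_on_dual_H_tensorI[OF is_vspace_H AH_kernel_closed[OF \<phi> \<psi>]])
      (simp only: AH_kernel_eval[OF \<phi> \<psi>], intro linear_on_sw3 linear_on_lin_intros, erule lin_comp, intro endo_intros)
qed

lemma bilinear_AH_kernel: "lin \<phi> \<Longrightarrow> bilinear_on D H AT (AH_kernel \<phi> h)"
  by (intro bilinear_onI linear_AH_kernel) simp_all

lemma bilinear_AH_kernel_lift:
  "y \<in> space AT \<Longrightarrow> bilinear_on D H AT (\<lambda>\<phi> h. tlift D H (AH_kernel \<phi> h) y)"
  "lin \<phi> \<Longrightarrow> linear_on AT AT (tlift D H (AH_kernel \<phi> h))"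
proof -
  have 1: "bilinear_on AT D AT (\<lambda>y \<phi>. tlift D H (AH_kernel \<phi> h) y)" for h
    by (rule bilinear_on_tlift[OF is_vspace_dual is_vspace_AT _ _ is_vspace_dual])
      (simp_all add: bilinear_AH_kernel linear_AH_kernel)
  have 2: "bilinear_on AT H AT (\<lambda>y h. tlift D H (AH_kernel \<phi> h) y)" if "lin \<phi>" for \<phi>
    by (rule bilinear_on_tlift[OF is_vspace_dual is_vspace_AT _ _ is_vspace_H])
      (simp_all add: bilinear_AH_kernel linear_AH_kernel that)
  show "bilinear_on D H AT (\<lambda>\<phi> h. tlift D H (AH_kernel \<phi> h) y)" if "y \<in> space AT"
    by (intro bilinear_onI bilinear_onD(1)[OF 1 that] bilinear_onD(1)[OF 2 that]) simp
  show "linear_on AT AT (tlift D H (AH_kernel \<phi> h))" if "lin \<phi>"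
    using tensor_universal(1)[OF is_vspace_dual is_vspace_AT bilinear_AH_kernel[OF that]] .
qed

lemma bilinear_AH_mult: "bilinear_on AT AT AT (AH_mult H)"
  unfolding AH_mult_eq
  by (rule bilinear_on_tlift[OF is_vspace_dual is_vspace_AT _ _ is_vspace_AT])
    (simp_all add: bilinear_AH_kernel_lift)

lemma AH_mult_ptensor:
  assumes "lin \<phi>"
  shows "y \<in> space AT \<Longrightarrow> AH_mult H (ptensor D H \<phi> h) y = tlift D H (AH_kernel \<phi> h) y"
    and "lin \<psi> \<Longrightarrow> AH_mult H (ptensor D H \<phi> h) (ptensor D H \<psi> g) = AH_kernel \<phi> h \<psi> g"
proof -
  show 1: "AH_mult H (ptensor D H \<phi> h) y = tlift D H (AH_kernel \<phi> h) y" if "y \<in> space AT" for y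
    unfolding AH_mult_eq
    by (rule tensor_universal(2)[OF is_vspace_dual is_vspace_AT bilinear_AH_kernel_lift(1)[OF that]])
      (simp_all add: assms)
  show "AH_mult H (ptensor D H \<phi> h) (ptensor D H \<psi> g) = AH_kernel \<phi> h \<psi> g" if "lin \<psi>"
    using tensor_universal(2)[OF is_vspace_dual is_vspace_AT bilinear_AH_kernel[OF assms], of \<psi> g] that
    by (simp add: 1 ptensor_in_tensor)
qed

lemma ptensor_in_AT: "lin \<phi> \<Longrightarrow> ptensor D H \<phi> h \<in> space AT"
  by (rule ptensor_in_tensor) simp_all

section \<open>Modules from two actions with a cross relation\<close>

lemma linear_cross_terms:
  assumes P: "bilinear_on D N N P" and A: "bilinear_on H N N A"
    and \<psi>: "lin \<psi>" and n: "n \<in> space N"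
  shows "linear_on H N (\<lambda>a. P (twist c a \<psi>) (A b n))" "linear_on H N (\<lambda>b. P (twist c a \<psi>) (A b n))"
    "linear_on H N (\<lambda>c. P (twist c a \<psi>) (A b n))"
proof -
  have m: "A b n \<in> space N" for b using bilinear_onD(3)[OF A _ n] by simp
  show "linear_on H N (\<lambda>a. P (twist c a \<psi>) (A b n))" "linear_on H N (\<lambda>c. P (twist c a \<psi>) (A b n))"
    by (rule linear_on_compose[OF linear_twist(1)[OF \<psi>] bilinear_onD(2)[OF P m]]
       linear_on_compose[OF linear_twist(2)[OF \<psi>] bilinear_onD(2)[OF P m]])+
  show "linear_on H N (\<lambda>b. P (twist c a \<psi>) (A b n))"
    by (rule linear_on_compose[OF bilinear_onD(2)[OF A n] bilinear_onD(1)[OF P]]) (simp add: lin_twist \<psi>)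
qed

text \<open>In \<open>P \<phi> (A h (P \<psi> (A g n)))\<close> the relation \<open>cross\<close>
  moves \<open>A h\<close> past \<open>P \<psi>\<close>; then \<open>P_conv\<close> and
  \<open>A_mult\<close> merge the neighbours, and the outcome is the product in A(H) term by term.
  The space \<open>N\<close> is kept general so that both a module and A(H) itself can be
  inserted.\<close>

lemma cross_module:
  assumes N: "is_vspace N" and P: "bilinear_on D N N P" and A: "bilinear_on H N N A"
    and P_conv: "\<And>\<phi> \<psi> n. lin \<phi> \<Longrightarrow> lin \<psi> \<Longrightarrow> n \<in> space N \<Longrightarrow> P (convolution H \<phi> \<psi>) n = P \<phi> (P \<psi> n)"
    and P_eps: "\<And>n. n \<in> space N \<Longrightarrow> P eps n = n"
    and A_mult: "\<And>g h n. n \<in> space N \<Longrightarrow> A (g * h) n = A g (A h n)"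
    and A_1: "\<And>n. n \<in> space N \<Longrightarrow> A 1 n = n"
    and cross: "\<And>\<psi> h n. lin \<psi> \<Longrightarrow> n \<in> space N \<Longrightarrow>
      A h (P \<psi> n) = sweedler3 H (comult H) (\<lambda>a b c. P (twist c a \<psi>) (A b n)) h"
  shows "left_module (AH H) N (\<lambda>x n. tlift D H (\<lambda>\<phi> h. P \<phi> (A h n)) x)"
proof -
  define lft where "lft x n = tlift D H (\<lambda>\<phi> h. P \<phi> (A h n)) x" for x n
  have An: "A h n \<in> space N" if "n \<in> space N" for h n
    using bilinear_onD(3)[OF A _ that] by simp
  have Pn: "P \<phi> n \<in> space N" if "lin \<phi>" "n \<in> space N" for \<phi> n
    using bilinear_onD(3)[OF P _ that(2)] that(1) by simp
  have b: "bilinear_on D H N (\<lambda>\<phi> h. P \<phi> (A h n))" if n: "n \<in> space N" for n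
    by (intro bilinear_onI linear_on_compose[OF bilinear_onD(2)[OF A n]] bilinear_onD(1)[OF P]
       bilinear_onD(2)[OF P] An n)
  have bl: "bilinear_on AT N N lft"
    unfolding lft_def
    by (rule bilinear_on_tlift[OF is_vspace_dual N b _ N], assumption,
        rule linear_on_compose[OF bilinear_onD(1)[OF A] bilinear_onD(1)[OF P]]) simp_all
  have pure: "lft (ptensor D H \<phi> h) n = P \<phi> (A h n)" if "lin \<phi>" "n \<in> space N" for \<phi> h n
    unfolding lft_def using that
    by (intro tensor_universal(2)[OF is_vspace_dual N b]) simp_all
  have kernel: "lft (AH_kernel \<phi> h \<psi> g) n = P \<phi> (A h (P \<psi> (A g n)))"
    if \<phi>: "lin \<phi>" and \<psi>: "lin \<psi>" and n: "n \<in> space N" for \<phi> h \<psi> g n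
  proof (rule functionals_separate[OF N])
    fix \<gamma> assume \<gamma>: "linear_on N ground \<gamma>"
    have 1: "linear_on AT ground (\<lambda>z. \<gamma> (lft z n))"
      by (rule linear_on_compose[OF bilinear_onD(2)[OF bl n] \<gamma>])
    have 2: "linear_on N ground (\<lambda>m. \<gamma> (P \<phi> m))"
      by (rule linear_on_compose[OF bilinear_onD(1)[OF P] \<gamma>]) (simp add: \<phi>)
    have "\<gamma> (lft (AH_kernel \<phi> h \<psi> g) n) =
        sw3 h (\<lambda>a b c. \<gamma> (lft (ptensor D H (convolution H \<phi> (twist c a \<psi>)) (b * g)) n))"
      by (rule AH_kernel_form[OF \<phi> \<psi> 1])
    also have "\<dots> = sw3 h (\<lambda>a b c. \<gamma> (P \<phi> (P (twist c a \<psi>) (A b (A g n)))))"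
      by (simp add: pure lin_convolution P_conv lin_twist \<phi> \<psi> n An A_mult)
    also have "\<dots> = \<gamma> (P \<phi> (A h (P \<psi> (A g n))))"
      unfolding cross[OF \<psi> An[OF n]]
      by (rule sweedler3_form[OF N linear_cross_terms[OF P A \<psi> An[OF n]] 2, symmetric])
    finally show "\<gamma> (lft (AH_kernel \<phi> h \<psi> g) n) = \<gamma> (P \<phi> (A h (P \<psi> (A g n))))" .
  qed
  have mult: "lft (AH_mult H x y) n = lft x (lft y n)"
    if x: "x \<in> space AT" and y: "y \<in> space AT" and n: "n \<in> space N" for x y n
  proof -
    have lyn: "lft y n \<in> space N" if "y \<in> space AT" for y by (rule bilinear_onD(3)[OF bl that n])
    have p: "lft (AH_mult H (ptensor D H \<phi> h) y) n = lft (ptensor D H \<phi> h) (lft y n)"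
      if \<phi>: "lin \<phi>" for \<phi> h
    proof (rule tensor_unique[OF _ _ _ y])
      have pt: "ptensor D H \<phi> h \<in> space AT" by (rule ptensor_in_AT[OF \<phi>])
      show "linear_on AT N (\<lambda>y. lft (AH_mult H (ptensor D H \<phi> h) y) n)"
        by (rule linear_on_compose[OF bilinear_onD(1)[OF bilinear_AH_mult pt] bilinear_onD(2)[OF bl n]])
      show "linear_on AT N (\<lambda>y. lft (ptensor D H \<phi> h) (lft y n))"
        by (rule linear_on_compose[OF bilinear_onD(2)[OF bl n] bilinear_onD(1)[OF bl pt]])
    qed (simp add: AH_mult_ptensor(2) \<phi> kernel n pure An Pn)
    show ?thesis
    proof (rule tensor_unique[OF _ _ _ x])
      show "linear_on AT N (\<lambda>x. lft (AH_mult H x y) n)"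
        by (rule linear_on_compose[OF bilinear_onD(2)[OF bilinear_AH_mult y] bilinear_onD(2)[OF bl n]])
      show "linear_on AT N (\<lambda>x. lft x (lft y n))"
        by (rule bilinear_onD(2)[OF bl lyn[OF y]])
    qed (simp add: p)
  qed
  have "left_module (AH H) N lft"
    unfolding left_module_def
    by (simp add: N bilinear_on_AH bl mult pure lin_eps A_1 P_eps)
  then show ?thesis unfolding lft_def .
qed

section \<open>A(H) acting on itself by left multiplication\<close>

lemma
  assumes z: "z \<in> space AT"
  shows lin_eval_left: "lin \<chi> \<Longrightarrow> lin (\<lambda>x. z (\<lambda>\<phi> h. \<phi> x * \<chi> h))"
    and lin_eval_right: "lin \<chi> \<Longrightarrow> lin (\<lambda>b. z (\<lambda>\<phi> h. \<phi> x * \<chi> (b * h)))"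
proof -
  assume \<chi>: "lin \<chi>"
  have "bilinear_on H AT ground (\<lambda>x z. z (\<lambda>\<phi> h. \<phi> x * \<chi> h))"
    by (rule bilinear_on_eval[OF is_vspace_dual is_vspace_H bilinear_dual_H_eval[OF \<chi>]])
      (intro linear_on_lin_intros, simp)
  from bilinear_onD(2)[OF this z] show "lin (\<lambda>x. z (\<lambda>\<phi> h. \<phi> x * \<chi> h))" .
  have "bilinear_on H AT ground (\<lambda>b z. z (\<lambda>\<phi> h. \<phi> x * \<chi> (b * h)))"
    by (rule bilinear_on_eval[OF is_vspace_dual is_vspace_H bilinear_dual_H_eval])
      (intro linear_on_lin_intros lin_comp[OF \<chi>] endo_intros)+
  from bilinear_onD(2)[OF this z] show "lin (\<lambda>b. z (\<lambda>\<phi> h. \<phi> x * \<chi> (b * h)))" .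
qed

text \<open>The kernel formula on pure \<open>z\<close>, extended by linearity. A general
  \<open>z\<close> is kept because in threefold products it is itself a product and need not be a
  pure tensor.\<close>

lemma AH_mult_eval:
  assumes \<phi>: "lin \<phi>" and \<chi>: "lin \<chi>" and z: "z \<in> space AT"
  shows "AH_mult H (ptensor D H \<phi> h) z (\<lambda>\<phi> h. \<phi> x * \<chi> h) =
    sw x (\<lambda>x1 x2. \<phi> x1 * sw3 h (\<lambda>a b c. z (\<lambda>\<psi> g. \<psi> (T c * x2 * S (S a)) * \<chi> (b * g))))"
proof (rule tensor_unique[OF _ _ _ z])
  show "linear_on AT ground (\<lambda>z. AH_mult H (ptensor D H \<phi> h) z (\<lambda>\<phi> h. \<phi> x * \<chi> h))"
    by (rule linear_on_compose[OF bilinear_onD(1)[OF bilinear_AH_mult ptensor_in_AT[OF \<phi>]] linear_on_tensor_eval])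
  show "linear_on AT ground (\<lambda>z. sw x (\<lambda>x1 x2. \<phi> x1 * sw3 h (\<lambda>a b c. z (\<lambda>\<psi> g. \<psi> (T c * x2 * S (S a)) * \<chi> (b * g)))))"
    by (intro linear_on_sw linear_on_lin_intros linear_on_sw3 linear_on_tensor_eval)
  fix \<psi> g assume "\<psi> \<in> space D"
  then have \<psi>: "lin \<psi>" by simp
  have \<chi>': "lin (\<lambda>g. \<chi> (b * g))" for b by (rule lin_comp[OF \<chi> linear_mult(2)])
  have "AH_mult H (ptensor D H \<phi> h) (ptensor D H \<psi> g) (\<lambda>\<phi> h. \<phi> x * \<chi> h) =
      sw3 h (\<lambda>a b c. sw x (\<lambda>x1 x2. \<phi> x1 * twist c a \<psi> x2) * \<chi> (b * g))"
    unfolding AH_mult_ptensor(2)[OF \<phi> \<psi>] by (rule AH_kernel_eval[OF \<phi> \<psi> \<chi>])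
  also have "\<dots> = sw3 h (\<lambda>a b c. sw x (\<lambda>x1 x2. \<phi> x1 * (twist c a \<psi> x2 * \<chi> (b * g))))"
    by (simp add: sw_mult(2)[symmetric] mult.assoc)
  also have "\<dots> = sw x (\<lambda>x1 x2. \<phi> x1 * sw3 h (\<lambda>a b c. twist c a \<psi> x2 * \<chi> (b * g)))"
    by (simp only: sw_sw3_swap[symmetric] sw3_mult)
  finally show "AH_mult H (ptensor D H \<phi> h) (ptensor D H \<psi> g) (\<lambda>\<phi> h. \<phi> x * \<chi> h) =
    sw x (\<lambda>x1 x2. \<phi> x1 * sw3 h (\<lambda>a b c. ptensor D H \<psi> g (\<lambda>\<psi> g. \<psi> (T c * x2 * S (S a)) * \<chi> (b * g))))"
    by (simp only: ptensor_eval[OF bilinear_dual_H_eval[OF \<chi>']])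
qed

text \<open>\<open>T\<close> reverses the coproduct while the square of \<open>S\<close> preserves
  it, so the legs of \<open>c\<close> appear crossed and those of \<open>a\<close> in order. This is
  the arrangement of legs in \<open>sw3_nested\<close>.\<close>

lemma sw_twist:
  assumes f: "\<And>b. lin (\<lambda>a. f a b)" "\<And>a. lin (f a)"
  shows "sw (T c * x * S (S a)) f =
    sw a (\<lambda>a1 a2. sw c (\<lambda>c1 c2. sw x (\<lambda>x1 x2. f (T c2 * x1 * S (S a1)) (T c1 * x2 * S (S a2)))))"
proof -
  note LI = lin_intros lin_comp[OF f(1)] lin_comp[OF f(2)]
  have "sw (T c * x * S (S a)) f = sw (T c * x) (\<lambda>p q. sw (S (S a)) (\<lambda>r s. f (p * r) (q * s)))"
    by (intro sw_times f)
  also have "\<dots> = sw (T c) (\<lambda>p q. sw x (\<lambda>x1 x2. sw (S (S a)) (\<lambda>r s. f (p * x1 * r) (q * x2 * s))))"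
    by (intro sw_times LI)
  also have "\<dots> = sw c (\<lambda>c1 c2. sw x (\<lambda>x1 x2. sw (S (S a)) (\<lambda>r s. f (T c2 * x1 * r) (T c1 * x2 * s))))"
    by (intro sw_of_T LI)
  also have "\<dots> = sw c (\<lambda>c1 c2. sw (S (S a)) (\<lambda>r s. sw x (\<lambda>x1 x2. f (T c2 * x1 * r) (T c1 * x2 * s))))"
    by (intro sw_cong sw_swap)
  also have "\<dots> = sw (S (S a)) (\<lambda>r s. sw c (\<lambda>c1 c2. sw x (\<lambda>x1 x2. f (T c2 * x1 * r) (T c1 * x2 * s))))"
    by (rule sw_swap)
  also have "\<dots> = sw (S a) (\<lambda>s r. sw c (\<lambda>c1 c2. sw x (\<lambda>x1 x2. f (T c2 * x1 * S r) (T c1 * x2 * S s))))"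
    by (intro sw_of_S LI)
  also have "\<dots> = sw a (\<lambda>r s. sw c (\<lambda>c1 c2. sw x (\<lambda>x1 x2. f (T c2 * x1 * S (S r)) (T c1 * x2 * S (S s)))))"
    by (intro sw_of_S LI)
  finally show ?thesis .
qed

text \<open>\<open>T\<close> and \<open>S\<close> fix 1, so the twist by the legs of 1 is trivial
  and only convolution on the dual leg remains.\<close>

lemma AH_mult_dual_eval:
  assumes \<phi>: "lin \<phi>" and \<chi>: "lin \<chi>" and z: "z \<in> space AT"
  shows "AH_mult H (ptensor D H \<phi> 1) z (\<lambda>\<phi> h. \<phi> x * \<chi> h) =
    sw x (\<lambda>x1 x2. \<phi> x1 * z (\<lambda>\<psi> g. \<psi> x2 * \<chi> g))"
proof -
  note LE = lin_comp[OF lin_eval_left[OF z lin_comp[OF \<chi> linear_mult(2)]]] lin_comp[OF lin_eval_right[OF z \<chi>]]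
  have "sw3 1 (\<lambda>a b c. z (\<lambda>\<psi> g. \<psi> (T c * x2 * S (S a)) * \<chi> (b * g))) =
      z (\<lambda>\<psi> g. \<psi> (T 1 * x2 * S (S 1)) * \<chi> (1 * g))" for x2
    by (intro sw3_1 LE endo_intros)
  then show ?thesis by (simp add: AH_mult_eval[OF \<phi> \<chi> z] T_1 S_1)
qed

lemma AH_mult_alg_eval:
  assumes \<chi>: "lin \<chi>" and z: "z \<in> space AT"
  shows "AH_mult H (ptensor D H eps h) z (\<lambda>\<phi> h. \<phi> x * \<chi> h) =
    sw3 h (\<lambda>a b c. z (\<lambda>\<psi> g. \<psi> (T c * x * S (S a)) * \<chi> (b * g)))"
proof -
  note LE = lin_comp[OF lin_eval_left[OF z lin_comp[OF \<chi> linear_mult(2)]]]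
  show ?thesis
    unfolding AH_mult_eval[OF lin_eps \<chi> z] by (intro sw_counit(1) lin_intros LE)
qed

lemma AH_mult_closed: "x \<in> space AT \<Longrightarrow> y \<in> space AT \<Longrightarrow> AH_mult H x y \<in> space AT"
  by (rule bilinear_onD(3)[OF bilinear_AH_mult])

text \<open>A pure tensor factors into its two generators. This is expressed through operators on
  \<open>z\<close> because associativity is not yet available.\<close>

lemma AH_mult_factor:
  assumes \<phi>: "lin \<phi>" and z: "z \<in> space AT"
  shows "AH_mult H (ptensor D H \<phi> 1) (AH_mult H (ptensor D H eps h) z) = AH_mult H (ptensor D H \<phi> h) z"
proof (rule dual_H_tensor_eqI)
  note cl = AH_mult_closed ptensor_in_AT lin_eps \<phi> z
  show "AH_mult H (ptensor D H \<phi> 1) (AH_mult H (ptensor D H eps h) z) \<in> space AT"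
    "AH_mult H (ptensor D H \<phi> h) z \<in> space AT" by (intro cl)+
  fix x \<chi> assume \<chi>: "lin \<chi>"
  have "AH_mult H (ptensor D H eps h) z \<in> space AT" by (intro cl)
  then show "AH_mult H (ptensor D H \<phi> 1) (AH_mult H (ptensor D H eps h) z) (\<lambda>\<phi> h. \<phi> x * \<chi> h) =
      AH_mult H (ptensor D H \<phi> h) z (\<lambda>\<phi> h. \<phi> x * \<chi> h)"
    by (simp only: AH_mult_dual_eval[OF \<phi> \<chi>] AH_mult_eval[OF \<phi> \<chi> z] AH_mult_alg_eval[OF \<chi> z])
qed

lemma bilinear_AH_mult_dual: "bilinear_on D AT AT (\<lambda>\<phi>. AH_mult H (ptensor D H \<phi> 1))"
  by (intro bilinear_onI bilinear_onD(1)[OF bilinear_AH_mult]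
      linear_on_compose[OF bilinear_onD(2)[OF bilinear_ptensor] bilinear_onD(2)[OF bilinear_AH_mult]])
    (simp_all add: ptensor_in_AT)

lemma bilinear_AH_mult_alg: "bilinear_on H AT AT (\<lambda>h. AH_mult H (ptensor D H eps h))"
  by (intro bilinear_onI bilinear_onD(1)[OF bilinear_AH_mult]
      linear_on_compose[OF bilinear_onD(1)[OF bilinear_ptensor] bilinear_onD(2)[OF bilinear_AH_mult]])
    (simp_all add: ptensor_in_AT lin_eps)

text \<open>\<open>sw_twist\<close> splits both outer legs of \<open>h\<close>: \<open>a1\<close>
  and \<open>c2\<close> twist \<psi>, while \<open>a2\<close> and \<open>c1\<close> twist the
  argument of \<open>z\<close>. Read through \<open>sw3_nested\<close>, the latter two are the outer
  legs of the middle leg, and this is left multiplication by \<epsilon> \<otimes> b.\<close>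

lemma AH_mult_cross:
  assumes \<psi>: "lin \<psi>" and z: "z \<in> space AT"
  shows "AH_mult H (ptensor D H eps h) (AH_mult H (ptensor D H \<psi> 1) z) =
    sweedler3 H (comult H) (\<lambda>a b c. AH_mult H (ptensor D H (twist c a \<psi>) 1) (AH_mult H (ptensor D H eps b) z)) h"
proof (rule dual_H_tensor_eqI)
  note cl = AH_mult_closed ptensor_in_AT lin_eps \<psi> z
  note tri = linear_cross_terms[OF bilinear_AH_mult_dual bilinear_AH_mult_alg \<psi> z]
  show "AH_mult H (ptensor D H eps h) (AH_mult H (ptensor D H \<psi> 1) z) \<in> space AT" by (intro cl)
  show "sweedler3 H (comult H) (\<lambda>a b c. AH_mult H (ptensor D H (twist c a \<psi>) 1) (AH_mult H (ptensor D H eps b) z)) h \<in> space AT"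
    by (rule sweedler3_closed[OF is_vspace_AT tri])
  fix x \<chi> assume \<chi>: "lin \<chi>"
  have \<chi>': "lin (\<lambda>g. \<chi> (b * g))" for b by (rule lin_comp[OF \<chi> linear_mult(2)])
  have Pz: "AH_mult H (ptensor D H \<psi> 1) z \<in> space AT" by (intro cl)
  have Az: "AH_mult H (ptensor D H eps b) z \<in> space AT" for b by (intro cl)
  note LI = lin_intros lin_comp[OF lin_eval_left[OF z \<chi>']] lin_comp[OF lin_eval_right[OF z \<chi>]] lin_comp[OF \<psi>]
  define F where "F a a' b c' c = sw x (\<lambda>x1 x2. \<psi> (T c * x1 * S (S a)) *
      z (\<lambda>\<xi> g. \<xi> (T c' * x2 * S (S a')) * \<chi> (b * g)))" for a a' b c' c
  have "AH_mult H (ptensor D H eps h) (AH_mult H (ptensor D H \<psi> 1) z) (\<lambda>\<phi> h. \<phi> x * \<chi> h) =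
      sw3 h (\<lambda>a b c. sw (T c * x * S (S a)) (\<lambda>u v. \<psi> u * z (\<lambda>\<xi> g. \<xi> v * \<chi> (b * g))))"
    unfolding AH_mult_alg_eval[OF \<chi> Pz] AH_mult_dual_eval[OF \<psi> \<chi>' z] ..
  also have "\<dots> = sw3 h (\<lambda>a b c. sw a (\<lambda>a1 a2. sw c (\<lambda>c1 c2. F a1 a2 b c1 c2)))"
    unfolding F_def by (intro sw3_cong sw_twist lin_intros lin_eval_left[OF z \<chi>'] \<psi>)
  also have "\<dots> = sw3 h (\<lambda>a b c. sw3 b (\<lambda>a' b' c'. F a a' b' c' c))"
    unfolding F_def by (intro sw3_nested[symmetric] LI)
  also have "\<dots> = sw3 h (\<lambda>a b c. sw x (\<lambda>x1 x2. twist c a \<psi> x1 *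
      sw3 b (\<lambda>a' b' c'. z (\<lambda>\<xi> g. \<xi> (T c' * x2 * S (S a')) * \<chi> (b' * g)))))"
    unfolding F_def by (simp only: sw_sw3_swap[symmetric] sw3_mult)
  also have "\<dots> = sw3 h (\<lambda>a b c. AH_mult H (ptensor D H (twist c a \<psi>) 1)
      (AH_mult H (ptensor D H eps b) z) (\<lambda>\<phi> h. \<phi> x * \<chi> h))"
    by (simp only: AH_mult_dual_eval[OF lin_twist[OF \<psi>] \<chi> Az] AH_mult_alg_eval[OF \<chi> z])
  also have "\<dots> = sweedler3 H (comult H) (\<lambda>a b c. AH_mult H (ptensor D H (twist c a \<psi>) 1)
      (AH_mult H (ptensor D H eps b) z)) h (\<lambda>\<phi> h. \<phi> x * \<chi> h)"
    by (rule sweedler3_form[OF is_vspace_AT tri linear_on_tensor_eval, symmetric])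
  finally show "AH_mult H (ptensor D H eps h) (AH_mult H (ptensor D H \<psi> 1) z) (\<lambda>\<phi> h. \<phi> x * \<chi> h) = \<dots>" .
qed

text \<open>All twists are by 1, so the claim is associativity of convolution, that is,
  coassociativity of \<open>H\<close>.\<close>

lemma AH_mult_convolution:
  assumes \<phi>: "lin \<phi>" and \<psi>: "lin \<psi>" and z: "z \<in> space AT"
  shows "AH_mult H (ptensor D H (convolution H \<phi> \<psi>) 1) z =
    AH_mult H (ptensor D H \<phi> 1) (AH_mult H (ptensor D H \<psi> 1) z)"
proof (rule dual_H_tensor_eqI)
  note cl = AH_mult_closed ptensor_in_AT lin_convolution \<phi> \<psi> z
  have Pz: "AH_mult H (ptensor D H \<psi> 1) z \<in> space AT" by (intro cl)
  show "AH_mult H (ptensor D H (convolution H \<phi> \<psi>) 1) z \<in> space AT"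
    "AH_mult H (ptensor D H \<phi> 1) (AH_mult H (ptensor D H \<psi> 1) z) \<in> space AT" by (intro cl)+
  fix x \<chi> assume \<chi>: "lin \<chi>"
  let ?e = "\<lambda>x. z (\<lambda>\<psi> g. \<psi> x * \<chi> g)"
  have "sw x (\<lambda>x1 x2. sw x1 (\<lambda>u v. \<phi> u * \<psi> v * ?e x2)) = sw x (\<lambda>u y. sw y (\<lambda>v w. \<phi> u * \<psi> v * ?e w))"
    by (intro coassoc lin_intros \<phi> \<psi> lin_eval_left[OF z \<chi>])
  then show "AH_mult H (ptensor D H (convolution H \<phi> \<psi>) 1) z (\<lambda>\<phi> h. \<phi> x * \<chi> h) =
    AH_mult H (ptensor D H \<phi> 1) (AH_mult H (ptensor D H \<psi> 1) z) (\<lambda>\<phi> h. \<phi> x * \<chi> h)"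
    by (simp only: AH_mult_dual_eval[OF lin_convolution[OF \<phi> \<psi>] \<chi> z] AH_mult_dual_eval[OF \<phi> \<chi> Pz]
        AH_mult_dual_eval[OF \<psi> \<chi> z] convolution_eq[OF \<phi> \<psi>] sw_mult[symmetric] mult.assoc)
qed

lemma AH_mult_one_left:
  assumes z: "z \<in> space AT"
  shows "AH_mult H (ptensor D H eps 1) z = z"
proof (rule dual_H_tensor_eqI)
  show "AH_mult H (ptensor D H eps 1) z \<in> space AT" by (intro AH_mult_closed ptensor_in_AT lin_eps z)
  fix x \<chi> assume \<chi>: "lin \<chi>"
  show "AH_mult H (ptensor D H eps 1) z (\<lambda>\<phi> h. \<phi> x * \<chi> h) = z (\<lambda>\<phi> h. \<phi> x * \<chi> h)"
    unfolding AH_mult_dual_eval[OF lin_eps \<chi> z] by (intro sw_counit lin_eval_left[OF z \<chi>])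
qed (rule z)

text \<open>Nested twists compose: \<open>T (c * c') = T c' * T c\<close> puts the second twist
  outermost on the left, and \<open>S (S (a * a')) = S (S a) * S (S a')\<close> puts it outermost on
  the right.\<close>

lemma AH_mult_alg_mult:
  assumes z: "z \<in> space AT"
  shows "AH_mult H (ptensor D H eps (g * h)) z =
    AH_mult H (ptensor D H eps g) (AH_mult H (ptensor D H eps h) z)"
proof (rule dual_H_tensor_eqI)
  note cl = AH_mult_closed ptensor_in_AT lin_eps z
  have Az: "AH_mult H (ptensor D H eps h) z \<in> space AT" by (intro cl)
  show "AH_mult H (ptensor D H eps (g * h)) z \<in> space AT"
    "AH_mult H (ptensor D H eps g) (AH_mult H (ptensor D H eps h) z) \<in> space AT" by (intro cl)+
  fix x \<chi> assume \<chi>: "lin \<chi>"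
  have \<chi>': "lin (\<lambda>g. \<chi> (b * g))" for b by (rule lin_comp[OF \<chi> linear_mult(2)])
  note LE = lin_comp[OF lin_eval_left[OF z \<chi>']] lin_comp[OF lin_eval_right[OF z \<chi>]]
  have "sw3 (g * h) (\<lambda>a b c. z (\<lambda>\<psi> g. \<psi> (T c * x * S (S a)) * \<chi> (b * g))) =
    sw3 g (\<lambda>a b c. sw3 h (\<lambda>a' b' c'. z (\<lambda>\<psi> g. \<psi> (T (c * c') * x * S (S (a * a'))) * \<chi> (b * b' * g))))"
    by (intro sw3_times LE endo_intros)
  then show "AH_mult H (ptensor D H eps (g * h)) z (\<lambda>\<phi> h. \<phi> x * \<chi> h) =
    AH_mult H (ptensor D H eps g) (AH_mult H (ptensor D H eps h) z) (\<lambda>\<phi> h. \<phi> x * \<chi> h)"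
    by (simp only: AH_mult_alg_eval[OF \<chi> z] AH_mult_alg_eval[OF \<chi> Az] AH_mult_alg_eval[OF \<chi>' z]
        S_mult T_mult mult.assoc)
qed

text \<open>\<open>T\<close> and \<open>S\<close> preserve the counit, so twisting it only produces
  the factors \<open>eps c\<close> and \<open>eps a\<close>, which absorb the outer legs of
  \<open>h\<close>.\<close>

lemma AH_mult_one_right:
  assumes z: "z \<in> space AT"
  shows "AH_mult H z (ptensor D H eps 1) = z"
proof (rule tensor_unique[OF _ _ _ z])
  have e: "ptensor D H eps 1 \<in> space AT" by (rule ptensor_in_AT[OF lin_eps])
  show "linear_on AT AT (\<lambda>z. AH_mult H z (ptensor D H eps 1))"
    by (rule bilinear_onD(2)[OF bilinear_AH_mult e])
  show "linear_on AT AT (\<lambda>z. z)" by (simp add: linear_on_def)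
  fix \<phi> h assume "\<phi> \<in> space D"
  then have \<phi>: "lin \<phi>" by simp
  show "AH_mult H (ptensor D H \<phi> h) (ptensor D H eps 1) = ptensor D H \<phi> h"
  proof (rule dual_H_tensor_eqI)
    show "AH_mult H (ptensor D H \<phi> h) (ptensor D H eps 1) \<in> space AT" "ptensor D H \<phi> h \<in> space AT"
      by (intro AH_mult_closed ptensor_in_AT lin_eps \<phi>)+
    fix x \<chi> assume \<chi>: "lin \<chi>"
    have e: "sw x (\<lambda>x1 x2. \<phi> x1 * eps (T c * x2 * S (S a))) = eps c * eps a * \<phi> x" for a c
    proof -
      have "sw x (\<lambda>x1 x2. \<phi> x1 * eps (T c * x2 * S (S a))) = (eps c * eps a) * sw x (\<lambda>x1 x2. eps x2 * \<phi> x1)"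
        unfolding sw_mult[symmetric] by (simp add: eps_mult eps_T eps_S mult_ac)
      then show ?thesis by (simp add: sw_counit \<phi>)
    qed
    have "AH_mult H (ptensor D H \<phi> h) (ptensor D H eps 1) (\<lambda>\<phi> h. \<phi> x * \<chi> h) =
        sw3 h (\<lambda>a b c. eps c * eps a * \<phi> x * \<chi> (b * 1))"
      by (simp only: AH_mult_ptensor(2)[OF \<phi> lin_eps] AH_kernel_eval[OF \<phi> lin_eps \<chi>] e)
    also have "\<dots> = sw3 h (\<lambda>a b c. eps a * eps c * \<chi> b) * \<phi> x"
      unfolding sw3_mult(2)[symmetric] by (simp add: mult_ac)
    finally have "AH_mult H (ptensor D H \<phi> h) (ptensor D H eps 1) (\<lambda>\<phi> h. \<phi> x * \<chi> h) = \<dots>" .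
    then show "AH_mult H (ptensor D H \<phi> h) (ptensor D H eps 1) (\<lambda>\<phi> h. \<phi> x * \<chi> h) =
        ptensor D H \<phi> h (\<lambda>\<phi> h. \<phi> x * \<chi> h)"
      by (simp only: sw3_counit[OF \<chi>] ptensor_eval[OF bilinear_dual_H_eval[OF \<chi>]] mult.commute[of "\<chi> h"])
  qed
qed

text \<open>
  Associativity comes for free from the general construction of modules: the left multiplication
  operators of \<open>A(H)\<close> satisfy the cross relation, so \<open>A(H)\<close> is a module over itself.
\<close>

theorem unital_algebra_AH: "unital_algebra (AH H)"
proof -
  have "left_module (AH H) AT (\<lambda>x y. tlift D H
      (\<lambda>\<phi> h. AH_mult H (ptensor D H \<phi> 1) (AH_mult H (ptensor D H eps h) y)) x)"
    by (rule cross_module[OF is_vspace_AT bilinear_AH_mult_dual bilinear_AH_mult_alg AH_mult_convolution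
          AH_mult_one_left AH_mult_alg_mult AH_mult_one_left AH_mult_cross])
  then have 1: "AH_mult H (AH_mult H x y) z = AH_mult H x (AH_mult H y z)"
    if "x \<in> space AT" "y \<in> space AT" "z \<in> space AT" for x y z
  proof -
    \<comment> \<open>By \<open>AH_mult_factor\<close> the action assembled from the two kinds of
      generators is the product itself, so its module law is associativity.\<close>
    have e: "tlift D H (\<lambda>\<phi> h. AH_mult H (ptensor D H \<phi> 1) (AH_mult H (ptensor D H eps h) z)) x = AH_mult H x z"
      if "z \<in> space AT" for x z
      unfolding AH_mult_eq[of x z]
      by (rule tlift_cong) (simp add: AH_mult_factor AH_mult_ptensor(1) that)
    show ?thesis
      using \<open>left_module _ _ _\<close> that by (simp add: left_module_def e AH_mult_closed)
  qed
  have "is_vspace (AH H)"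
    using is_vspace_AT by (simp add: is_vspace_def)
  then show ?thesis
    by (simp add: unital_algebra_def bilinear_on_AH bilinear_AH_mult 1 ptensor_in_AT lin_eps
        AH_mult_one_left AH_mult_one_right)
qed

section \<open>Anti-Yetter-Drinfeld modules\<close>

text \<open>The functional that arises when \<phi> is applied to the leg \<open>c * m1 * S a\<close>
  of the anti-Yetter-Drinfeld condition.\<close>

abbreviation cotwist :: "'h \<Rightarrow> 'h \<Rightarrow> ('h \<Rightarrow> 'k) \<Rightarrow> 'h \<Rightarrow> 'k" where
  "cotwist c a \<phi> \<equiv> \<lambda>y. \<phi> (c * y * S a)"

lemma lin_cotwist: "lin \<phi> \<Longrightarrow> lin (cotwist c a \<phi>)"
  by (erule lin_comp) (intro endo_intros)

lemma linear_cotwist_terms: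
  assumes P: "bilinear_on D M M P" and A: "bilinear_on H M M A"
    and \<phi>: "lin \<phi>" and m: "m \<in> space M"
  shows "linear_on H M (\<lambda>a. A b (P (cotwist c a \<phi>) m))" "linear_on H M (\<lambda>b. A b (P (cotwist c a \<phi>) m))"
    "linear_on H M (\<lambda>c. A b (P (cotwist c a \<phi>) m))"
proof -
  have "linear_on H D (\<lambda>a. cotwist c a \<phi>)" "linear_on H D (\<lambda>c. cotwist c a \<phi>)"
    by (rule linear_on_dualI, rule lin_cotwist[OF \<phi>], intro lin_comp[OF \<phi>] endo_intros)+
  then show "linear_on H M (\<lambda>a. A b (P (cotwist c a \<phi>) m))" "linear_on H M (\<lambda>c. A b (P (cotwist c a \<phi>) m))"
    using linear_on_compose[OF _ linear_on_compose[OF bilinear_onD(2)[OF P m] bilinear_onD(1)[OF A]]]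
    by simp_all
  have "P (cotwist c a \<phi>) m \<in> space M"
    by (rule bilinear_onD(3)[OF P _ m]) (simp add: lin_cotwist \<phi>)
  then show "linear_on H M (\<lambda>b. A b (P (cotwist c a \<phi>) m))"
    by (rule bilinear_onD(2)[OF A])
qed

text \<open>
  The anti-Yetter-Drinfeld condition moves \<open>P\<close> to the right of \<open>A\<close>, the cross relation of \<open>A(H)\<close>
  moves it to the left; applying one after the other cancels all antipodes.
\<close>

lemma cross_of_ayd:
  assumes M: "is_vspace M" and P: "bilinear_on D M M P" and A: "bilinear_on H M M A"
    and ayd: "\<And>\<phi> h m. lin \<phi> \<Longrightarrow> m \<in> space M \<Longrightarrow>
      P \<phi> (A h m) = sweedler3 H (comult H) (\<lambda>a b c. A b (P (cotwist c a \<phi>) m)) h"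
    and \<psi>: "lin \<psi>" and m: "m \<in> space M"
  shows "A h (P \<psi> m) = sweedler3 H (comult H) (\<lambda>a b c. P (twist c a \<psi>) (A b m)) h"
proof (rule functionals_separate[OF M])
  fix \<gamma> assume \<gamma>: "linear_on M ground \<gamma>"
  \<comment> \<open>Expansion along the dual basis separates the dependencies: \<open>t j b\<close>
    involves only the acting leg, and the twists survive in a scalar factor. This is the shape that
    \<open>sw3_twist_untwist\<close> requires.\<close>
  define t where "t j b = \<gamma> (A b (P (coord j) m))" for j b
  have Pm: "P \<phi> m \<in> space M" if "lin \<phi>" for \<phi>
    using bilinear_onD(3)[OF P _ m] that by simp
  have t: "lin (t j)" for j
    unfolding t_def by (rule linear_on_compose[OF bilinear_onD(2)[OF A Pm[OF lin_coord]] \<gamma>])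
  have K: "linear_on D ground (\<lambda>\<phi>. \<gamma> (A b (P \<phi> m)))" for b
    by (rule linear_on_compose[OF bilinear_onD(2)[OF P m] linear_on_compose[OF bilinear_onD(1)[OF A] \<gamma>]]) simp
  have ex: "\<gamma> (A b (P \<phi> m)) = (\<Sum>j\<in>B. t j b * \<phi> j)" if "lin \<phi>" for b \<phi>
    using dual_form_expansion[OF K that, of b] by (simp add: t_def mult.commute)
  have "\<gamma> (sweedler3 H (comult H) (\<lambda>a b c. P (twist c a \<psi>) (A b m)) h) =
      sw3 h (\<lambda>a b c. \<gamma> (P (twist c a \<psi>) (A b m)))"
    by (rule sweedler3_form[OF M linear_cross_terms[OF P A \<psi> m] \<gamma>])
  also have "\<dots> = sw3 h (\<lambda>a b c. sw3 b (\<lambda>a' b' c'. \<gamma> (A b' (P (cotwist c' a' (twist c a \<psi>)) m))))"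
  proof (rule sw3_cong)
    fix a b c
    show "\<gamma> (P (twist c a \<psi>) (A b m)) = sw3 b (\<lambda>a' b' c'. \<gamma> (A b' (P (cotwist c' a' (twist c a \<psi>)) m)))"
      unfolding ayd[OF lin_twist[OF \<psi>] m]
      by (rule sweedler3_form[OF M linear_cotwist_terms[OF P A lin_twist[OF \<psi>] m] \<gamma>])
  qed
  also have "\<dots> = (\<Sum>j\<in>B. sw3 h (\<lambda>a b c. sw3 b (\<lambda>a' b' c'. t j b' * \<psi> (T c * (c' * j * S a') * S (S a)))))"
    by (simp only: ex[OF lin_cotwist[OF lin_twist[OF \<psi>]]] sw3_sum)
  also have "\<dots> = \<gamma> (A h (P \<psi> m))"
    by (simp only: sw3_twist_untwist(1)[OF t \<psi>] ex[OF \<psi>])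
  finally show "\<gamma> (A h (P \<psi> m)) = \<gamma> (sweedler3 H (comult H) (\<lambda>a b c. P (twist c a \<psi>) (A b m)) h)" by simp
qed

text \<open>Here the cross relation is inserted into the anti-Yetter-Drinfeld expression, so the
  twists nest in the opposite order: the legs now cancel as \<open>c * T c'\<close> and
  \<open>S (S a') * S a\<close>, by the second part of \<open>sw3_twist_untwist\<close>.\<close>

lemma ayd_of_cross:
  assumes M: "is_vspace M" and P: "bilinear_on D M M P" and A: "bilinear_on H M M A"
    and cross: "\<And>\<psi> h m. lin \<psi> \<Longrightarrow> m \<in> space M \<Longrightarrow>
      A h (P \<psi> m) = sweedler3 H (comult H) (\<lambda>a b c. P (twist c a \<psi>) (A b m)) h"
    and \<phi>: "lin \<phi>" and m: "m \<in> space M"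
  shows "P \<phi> (A h m) = sweedler3 H (comult H) (\<lambda>a b c. A b (P (cotwist c a \<phi>) m)) h"
proof (rule functionals_separate[OF M])
  fix \<gamma> assume \<gamma>: "linear_on M ground \<gamma>"
  define t where "t j b = \<gamma> (P (coord j) (A b m))" for j b
  have Am: "A b m \<in> space M" for b
    using bilinear_onD(3)[OF A _ m] by simp
  have t: "lin (t j)" for j
    unfolding t_def
    by (rule linear_on_compose[OF bilinear_onD(2)[OF A m] linear_on_compose[OF bilinear_onD(1)[OF P] \<gamma>]])
      (simp add: lin_coord)
  have K: "linear_on D ground (\<lambda>\<phi>. \<gamma> (P \<phi> (A b m)))" for b
    by (rule linear_on_compose[OF bilinear_onD(2)[OF P Am] \<gamma>])
  have ex: "\<gamma> (P \<phi> (A b m)) = (\<Sum>j\<in>B. t j b * \<phi> j)" if "lin \<phi>" for b \<phi>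
    using dual_form_expansion[OF K that, of b] by (simp add: t_def mult.commute)
  have "\<gamma> (sweedler3 H (comult H) (\<lambda>a b c. A b (P (cotwist c a \<phi>) m)) h) =
      sw3 h (\<lambda>a b c. \<gamma> (A b (P (cotwist c a \<phi>) m)))"
    by (rule sweedler3_form[OF M linear_cotwist_terms[OF P A \<phi> m] \<gamma>])
  also have "\<dots> = sw3 h (\<lambda>a b c. sw3 b (\<lambda>a' b' c'. \<gamma> (P (twist c' a' (cotwist c a \<phi>)) (A b' m))))"
  proof (rule sw3_cong)
    fix a b c
    show "\<gamma> (A b (P (cotwist c a \<phi>) m)) = sw3 b (\<lambda>a' b' c'. \<gamma> (P (twist c' a' (cotwist c a \<phi>)) (A b' m)))"
      unfolding cross[OF lin_cotwist[OF \<phi>] m]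
      by (rule sweedler3_form[OF M linear_cross_terms[OF P A lin_cotwist[OF \<phi>] m] \<gamma>])
  qed
  also have "\<dots> = (\<Sum>j\<in>B. sw3 h (\<lambda>a b c. sw3 b (\<lambda>a' b' c'. t j b' * \<phi> (c * (T c' * j * S (S a')) * S a))))"
    by (simp only: ex[OF lin_twist[OF lin_cotwist[OF \<phi>]]] sw3_sum)
  also have "\<dots> = \<gamma> (P \<phi> (A h m))"
    by (simp only: sw3_twist_untwist(2)[OF t \<phi>] ex[OF \<phi>])
  finally show "\<gamma> (P \<phi> (A h m)) = \<gamma> (sweedler3 H (comult H) (\<lambda>a b c. A b (P (cotwist c a \<phi>) m)) h)" by simp
qed

text \<open>Linearity in each of the three legs, for fixed \<open>t\<close>, lets evaluation at
  \<beta> pass through \<open>sweedler3\<close> and \<open>tlift\<close>; the compatibility of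
  action and coaction becomes a scalar identity.\<close>

lemma
  assumes M: "is_vspace M" and A: "bilinear_on H M M A" and t: "t \<in> space (tensor M H)"
  defines "s \<equiv> \<lambda>h. sweedler3 H (comult H) (\<lambda>a b c. tlift M H (\<lambda>m0 m1. ptensor M H (A b m0) (c * m1 * S a)) t) h"
  shows ayd_tensor_closed: "s h \<in> space (tensor M H)"
    and ayd_tensor_eval: "bilinear_on M H ground \<beta> \<Longrightarrow>
      s h \<beta> = sw3 h (\<lambda>a b c. t (\<lambda>m0 m1. \<beta> (A b m0) (c * m1 * S a)))"
proof -
  note MH = is_vspace_tensor[OF M is_vspace_H]
  have Am: "A b m \<in> space M" if "m \<in> space M" for b m
    using bilinear_onD(3)[OF A _ that] by simp
  have r: "linear_on H (tensor M H) (\<lambda>x. ptensor M H m (e x))" if "m \<in> space M" "endo e" for m e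
    by (rule linear_on_compose[OF that(2) bilinear_onD(1)[OF bilinear_ptensor that(1)]])
  have l: "linear_on M (tensor M H) (\<lambda>m. ptensor M H (A b m) x)" for b x
    by (rule linear_on_compose[OF bilinear_onD(1)[OF A] bilinear_onD(2)[OF bilinear_ptensor]]) simp_all
  have l': "linear_on H (tensor M H) (\<lambda>b. ptensor M H (A b m) x)" if "m \<in> space M" for m x
    by (rule linear_on_compose[OF bilinear_onD(2)[OF A that] bilinear_onD(2)[OF bilinear_ptensor]]) simp
  have b: "bilinear_on M H (tensor M H) (\<lambda>m0 m1. ptensor M H (A b m0) (c * m1 * S a))" for a b c
    by (intro bilinear_onI l r Am endo_intros)
  have "bilinear_on (tensor M H) H (tensor M H) (\<lambda>t a. tlift M H (\<lambda>m0 m1. ptensor M H (A b m0) (c * m1 * S a)) t)" for b c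
    by (rule bilinear_on_tlift[OF M MH b _ is_vspace_H]) (intro r Am endo_intros)
  note 1 = bilinear_onD(1)[OF this t]
  have "bilinear_on (tensor M H) H (tensor M H) (\<lambda>t b. tlift M H (\<lambda>m0 m1. ptensor M H (A b m0) (c * m1 * S a)) t)" for a c
    by (rule bilinear_on_tlift[OF M MH b _ is_vspace_H]) (intro l')
  note 2 = bilinear_onD(1)[OF this t]
  have "bilinear_on (tensor M H) H (tensor M H) (\<lambda>t c. tlift M H (\<lambda>m0 m1. ptensor M H (A b m0) (c * m1 * S a)) t)" for a b
    by (rule bilinear_on_tlift[OF M MH b _ is_vspace_H]) (intro r Am endo_intros)
  note 3 = bilinear_onD(1)[OF this t]
  show "s h \<in> space (tensor M H)"
    unfolding s_def by (rule sweedler3_closed[OF MH 1 2 3])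
  assume \<beta>: "bilinear_on M H ground \<beta>"
  have "s h \<beta> = sw3 h (\<lambda>a b c. tlift M H (\<lambda>m0 m1. ptensor M H (A b m0) (c * m1 * S a)) t \<beta>)"
    unfolding s_def by (rule sweedler3_form[OF MH 1 2 3 linear_on_tensor_eval])
  then show "s h \<beta> = sw3 h (\<lambda>a b c. t (\<lambda>m0 m1. \<beta> (A b m0) (c * m1 * S a)))"
    by (simp only: form_tlift[OF MH b linear_on_tensor_eval t] ptensor_eval[OF \<beta>])
qed

section \<open>Coactions as actions of the dual algebra\<close>

definition slice :: "('k, 'm::ab_group_add, 'z) vspace_scheme \<Rightarrow> ('m \<Rightarrow> ('k, 'm, 'h) tensor) \<Rightarrow>
    ('h \<Rightarrow> 'k) \<Rightarrow> 'm \<Rightarrow> 'm" where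
  "slice M \<rho> \<phi> m = tlift M H (\<lambda>m0 m1. scl M (\<phi> m1) m0) (\<rho> m)"

lemma bilinear_slice_form:
  assumes "linear_on M ground \<gamma>" "lin \<phi>"
  shows "bilinear_on M H ground (\<lambda>m0 m1. \<phi> m1 * \<gamma> m0)"
  by (intro bilinear_onI linear_on_lin_intros assms)

text \<open>Contracting the comodule leg with \<phi> is the action of the dual attached to a
  coaction. Under a functional it is evaluation of \<open>\<rho> m\<close> at a product form, and
  bilinearity can be read off from that.\<close>

lemma
  assumes M: "is_vspace M" and \<rho>: "linear_on M (tensor M H) \<rho>"
  shows slice_form: "linear_on M ground \<gamma> \<Longrightarrow> lin \<phi> \<Longrightarrow> m \<in> space M \<Longrightarrow>
      \<gamma> (slice M \<rho> \<phi> m) = \<rho> m (\<lambda>m0 m1. \<phi> m1 * \<gamma> m0)"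
    and bilinear_slice: "bilinear_on D M M (slice M \<rho>)"
proof -
  note L = is_vspaceD[OF M]
  have b: "bilinear_on M H M (\<lambda>m0 m1. scl M (\<phi> m1) m0)" if "lin \<phi>" for \<phi>
  proof (rule bilinear_onI)
    show "linear_on H M (\<lambda>m1. scl M (\<phi> m1) m)" if "m \<in> space M" for m
      by (rule linear_on_scl_left[OF M that \<open>lin \<phi>\<close>])
    show "linear_on M M (\<lambda>m. scl M (\<phi> h) m)" for h
      by (auto simp: linear_on_def L mult.commute)
  qed
  have \<rho>m: "\<rho> m \<in> space (tensor M H)" if "m \<in> space M" for m
    by (rule linear_onD(1)[OF \<rho> that])
  show f: "\<gamma> (slice M \<rho> \<phi> m) = \<rho> m (\<lambda>m0 m1. \<phi> m1 * \<gamma> m0)"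
    if \<gamma>: "linear_on M ground \<gamma>" and \<phi>: "lin \<phi>" and m: "m \<in> space M" for \<gamma> \<phi> m
    unfolding slice_def form_tlift[OF M b[OF \<phi>] \<gamma> \<rho>m[OF m]]
    by (rule tensor_eval_cong[OF M is_vspace_H \<rho>m[OF m]]) (rule linear_on_ground_scl[OF \<gamma>])
  show "bilinear_on D M M (slice M \<rho>)"
  proof (rule bilinear_onI)
    fix \<phi> assume "\<phi> \<in> space D"
    then show l: "linear_on M M (slice M \<rho> \<phi>)"
      unfolding slice_def
      by (intro linear_on_compose[OF \<rho> tensor_universal(1)[OF M M b]]) simp
  next
    fix m assume m: "m \<in> space M"
    show "linear_on D M (\<lambda>\<phi>. slice M \<rho> \<phi> m)"
    proof (rule linear_on_functionalsI[OF is_vspace_dual M])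
      show "slice M \<rho> \<phi> m \<in> space M" if "\<phi> \<in> space D" for \<phi>
        unfolding slice_def using that by (intro linear_onD(1)[OF tensor_universal(1)[OF M M b] \<rho>m[OF m]]) simp
      fix \<gamma> assume \<gamma>: "linear_on M ground \<gamma>"
      have "bilinear_on D (tensor M H) ground (\<lambda>\<phi> t. t (\<lambda>m0 m1. \<phi> m1 * \<gamma> m0))"
        by (rule bilinear_on_eval[OF M is_vspace_dual])
          (simp_all add: bilinear_slice_form \<gamma> linear_on_lin_intros)
      from bilinear_onD(2)[OF this \<rho>m[OF m]]
      show "linear_on D ground (\<lambda>\<phi>. \<gamma> (slice M \<rho> \<phi> m))"
        using is_vspaceD(2,3)[OF is_vspace_dual[of H]]
        by (simp add: linear_on_ground_iff[of D] f[OF \<gamma> _ m])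
    qed
  qed
qed

lemma bilinear_on_hopf_alg: "bilinear_on (hopf_alg H) M M act \<longleftrightarrow> bilinear_on H M M act"
  by (simp add: bilinear_on_def linear_on_def hopf_alg_def)

text \<open>The axioms of the coaction are transposed to \<open>P\<close>: the counit axiom gives
  \<open>P_eps\<close>, coassociativity gives \<open>P_conv\<close>, and compatibility with the
  action gives the cotwist rule \<open>ayd'\<close>.\<close>

theorem left_module_of_ayd:
  assumes ayd: "ayd_module H M A \<rho>"
  shows "left_module (AH H) M (AH_action H M A \<rho>)"
proof -
  have M: "is_vspace M" and \<rho>: "linear_on M (tensor M H) \<rho>"
    and coassoc': "\<And>m. m \<in> space M \<Longrightarrow> tassoc M H H (tmap M H (tensor M H) H \<rho> id (\<rho> m)) =
                  tmap M H M (tensor H H) id (comult H) (\<rho> m)"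
    and counit': "\<And>m. m \<in> space M \<Longrightarrow> tlift M H (\<lambda>m' h. scl M (eps h) m') (\<rho> m) = m"
    using ayd unfolding ayd_module_def right_comodule_def by blast+
  have A: "bilinear_on H M M A"
    and A_mult: "\<And>g h m. m \<in> space M \<Longrightarrow> A (g * h) m = A g (A h m)"
    and A_1: "\<And>m. m \<in> space M \<Longrightarrow> A 1 m = m"
    using ayd unfolding ayd_module_def left_module_def bilinear_on_hopf_alg
    by (simp_all add: hopf_alg_def)
  have comp: "\<And>h m. m \<in> space M \<Longrightarrow> \<rho> (A h m) =
      sweedler3 H (comult H) (\<lambda>h1 h2 h3.
            tlift M H (\<lambda>m0 m1. ptensor M H (A h2 m0) (h3 * m1 * S h1)) (\<rho> m)) h"
    using ayd unfolding ayd_module_def by blast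
  define P where "P = slice M \<rho>"
  have P: "bilinear_on D M M P" unfolding P_def by (rule bilinear_slice[OF M \<rho>])
  have Pf: "\<gamma> (P \<phi> m) = \<rho> m (\<lambda>m0 m1. \<phi> m1 * \<gamma> m0)"
    if "linear_on M ground \<gamma>" "lin \<phi>" "m \<in> space M" for \<gamma> \<phi> m
    unfolding P_def by (rule slice_form[OF M \<rho> that])
  have \<rho>m: "\<rho> m \<in> space (tensor M H)" if "m \<in> space M" for m
    by (rule linear_onD(1)[OF \<rho> that])
  have Am: "A b m \<in> space M" if "m \<in> space M" for b m
    using bilinear_onD(3)[OF A _ that] by simp
  have Pm: "P \<phi> m \<in> space M" if "lin \<phi>" "m \<in> space M" for \<phi> m
    using bilinear_onD(3)[OF P _ that(2)] that(1) by simp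
  have P_eps: "P eps m = m" if "m \<in> space M" for m
    unfolding P_def slice_def by (rule counit'[OF that])
  have P_conv: "P (convolution H \<phi> \<psi>) m = P \<phi> (P \<psi> m)"
    if \<phi>: "lin \<phi>" and \<psi>: "lin \<psi>" and m: "m \<in> space M" for \<phi> \<psi> m
  proof (rule functionals_separate[OF M])
    fix \<gamma> assume \<gamma>: "linear_on M ground \<gamma>"
    \<comment> \<open>Coassociativity is paired with \<phi> and \<psi> on the two copies of
      \<open>H\<close>. In the left bracketing \<psi> meets the leg split off first and \<phi> the
      one split off second, whence the order \<open>P \<phi> (P \<psi> m)\<close>.\<close>
    let ?\<theta> = "\<lambda>a b. \<phi> a * \<psi> b"
    have \<theta>: "bilinear_on H H ground ?\<theta>" by (intro lin_intros \<phi> \<psi>)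
    have id: "linear_on M M id" "linear_on H H id" by (simp_all add: linear_on_def)
    note HH = is_vspace_tensor[OF is_vspace_H is_vspace_H]
    note MH = is_vspace_tensor[OF M is_vspace_H]
    have b1: "bilinear_on M (tensor H H) ground (\<lambda>m t. t ?\<theta> * \<gamma> m)"
      by (intro bilinear_onI linear_on_lin_intros linear_on_tensor_eval \<gamma>)
    have b2: "bilinear_on (tensor M H) H ground (\<lambda>s w. \<psi> w * s (\<lambda>u v. \<phi> v * \<gamma> u))"
      by (intro bilinear_onI linear_on_lin_intros linear_on_tensor_eval \<psi>)
    have b2': "(\<lambda>s w. s (\<lambda>u v. ptensor H H v w ?\<theta> * \<gamma> u)) = (\<lambda>s w. s (\<lambda>u v. \<psi> w * (\<phi> v * \<gamma> u)))"
      by (simp add: ptensor_eval[OF \<theta>] mult_ac)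
    note tm = tmap_eval(1)[OF M is_vspace_H MH is_vspace_H \<rho> id(2) \<rho>m[OF m]]
    have "tassoc M H H (tmap M H (tensor M H) H \<rho> id (\<rho> m)) (\<lambda>m t. t ?\<theta> * \<gamma> m) =
        tmap M H (tensor M H) H \<rho> id (\<rho> m) (\<lambda>s w. s (\<lambda>u v. \<psi> w * (\<phi> v * \<gamma> u)))"
      unfolding tassoc_eval(2)[OF M is_vspace_H is_vspace_H tm b1] b2' ..
    also have "\<dots> = tmap M H (tensor M H) H \<rho> id (\<rho> m) (\<lambda>s w. \<psi> w * s (\<lambda>u v. \<phi> v * \<gamma> u))"
      by (rule tensor_eval_cong[OF MH is_vspace_H tm])
        (rule tensor_eval_mult[OF bilinear_slice_form[OF \<gamma> \<phi>]])
    also have "\<dots> = \<rho> m (\<lambda>m0 m1. \<psi> m1 * \<rho> m0 (\<lambda>u v. \<phi> v * \<gamma> u))"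
      by (simp add: tmap_eval(2)[OF M is_vspace_H MH is_vspace_H \<rho> id(2) \<rho>m[OF m] b2])
    also have "\<dots> = \<rho> m (\<lambda>m0 m1. \<psi> m1 * \<gamma> (P \<phi> m0))"
      by (rule tensor_eval_cong[OF M is_vspace_H \<rho>m[OF m]]) (simp add: Pf[OF \<gamma> \<phi>])
    also have "\<dots> = \<gamma> (P \<phi> (P \<psi> m))"
      by (rule Pf[OF linear_on_compose[OF bilinear_onD(1)[OF P] \<gamma>] \<psi> m, symmetric]) (simp add: \<phi>)
    finally have 1: "tassoc M H H (tmap M H (tensor M H) H \<rho> id (\<rho> m)) (\<lambda>m t. t ?\<theta> * \<gamma> m) = \<gamma> (P \<phi> (P \<psi> m))" .
    have "tmap M H M (tensor H H) id (comult H) (\<rho> m) (\<lambda>m t. t ?\<theta> * \<gamma> m) =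
        \<rho> m (\<lambda>m0 m1. convolution H \<phi> \<psi> m1 * \<gamma> m0)"
      by (simp add: tmap_eval(2)[OF M is_vspace_H M HH id(1) linear_comult \<rho>m[OF m] b1]
          comult_eval[OF \<theta>] convolution_eq[OF \<phi> \<psi>])
    also have "\<dots> = \<gamma> (P (convolution H \<phi> \<psi>) m)"
      by (rule Pf[OF \<gamma> lin_convolution[OF \<phi> \<psi>] m, symmetric])
    finally show "\<gamma> (P (convolution H \<phi> \<psi>) m) = \<gamma> (P \<phi> (P \<psi> m))"
      using 1 coassoc'[OF m] by simp
  qed
  have ayd': "P \<phi> (A h m) = sweedler3 H (comult H) (\<lambda>a b c. A b (P (cotwist c a \<phi>) m)) h"
    if \<phi>: "lin \<phi>" and m: "m \<in> space M" for \<phi> h m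
  proof (rule functionals_separate[OF M])
    fix \<gamma> assume \<gamma>: "linear_on M ground \<gamma>"
    have \<gamma>A: "linear_on M ground (\<lambda>m. \<gamma> (A b m))" for b
      by (rule linear_on_compose[OF bilinear_onD(1)[OF A] \<gamma>]) simp
    have "\<gamma> (P \<phi> (A h m)) = \<rho> (A h m) (\<lambda>m0 m1. \<phi> m1 * \<gamma> m0)"
      by (rule Pf[OF \<gamma> \<phi> Am[OF m]])
    also have "\<dots> = sw3 h (\<lambda>a b c. \<rho> m (\<lambda>m0 m1. cotwist c a \<phi> m1 * \<gamma> (A b m0)))"
      unfolding comp[OF m] by (rule ayd_tensor_eval[OF M A \<rho>m[OF m] bilinear_slice_form[OF \<gamma> \<phi>]])
    also have "\<dots> = sw3 h (\<lambda>a b c. \<gamma> (A b (P (cotwist c a \<phi>) m)))"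
      by (simp only: Pf[OF \<gamma>A lin_cotwist[OF \<phi>] m])
    also have "\<dots> = \<gamma> (sweedler3 H (comult H) (\<lambda>a b c. A b (P (cotwist c a \<phi>) m)) h)"
      by (rule sweedler3_form[OF M linear_cotwist_terms[OF P A \<phi> m] \<gamma>, symmetric])
    finally show "\<gamma> (P \<phi> (A h m)) = \<dots>" .
  qed
  have cross: "A h (P \<psi> m) = sweedler3 H (comult H) (\<lambda>a b c. P (twist c a \<psi>) (A b m)) h"
    if "lin \<psi>" "m \<in> space M" for \<psi> h m
    by (rule cross_of_ayd[OF M P A _ that]) (rule ayd')
  have "left_module (AH H) M (\<lambda>x m. tlift D H (\<lambda>\<phi> h. P \<phi> (A h m)) x)"
    by (rule cross_module[OF M P A P_conv P_eps A_mult A_1 cross])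
  then show ?thesis
    unfolding AH_action_def[abs_def] P_def slice_def .
qed

text \<open>The coaction is the action of the canonical element of the dual and \<open>H\<close>, so
  the comodule axioms and the compatibility condition reduce to identities for that element together
  with the relations between generators of A(H).\<close>

theorem ayd_of_left_module:
  assumes mod: "left_module (AH H) M act"
  shows "ayd_module H M (H_action H act) (H_coaction H B M act)"
proof -
  have M: "is_vspace M" and act: "bilinear_on AT M M act"
    and act_mult: "\<And>x y m. x \<in> space AT \<Longrightarrow> y \<in> space AT \<Longrightarrow> m \<in> space M \<Longrightarrow>
      act (AH_mult H x y) m = act x (act y m)"
    and act_1: "\<And>m. m \<in> space M \<Longrightarrow> act (ptensor D H eps 1) m = m"
    using mod unfolding left_module_def by (simp_all add: bilinear_on_AH)
  define A where "A = H_action H act"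
  define P where "P \<phi> = act (ptensor D H \<phi> 1)" for \<phi>
  define \<rho> where "\<rho> = H_coaction H B M act"
  have A_eq: "A h m = act (ptensor D H eps h) m" for h m by (simp add: A_def H_action_def)
  have \<rho>_eq: "\<rho> m = (\<Sum>b\<in>B. ptensor M H (P (coord b) m) b)" for m
    by (simp add: \<rho>_def H_coaction_def P_def)
  \<comment> \<open>The relations between generators were obtained as identities of left
    multiplications; applied to the unit they become relations between elements, to which the module
    law applies.\<close>
  note e = ptensor_in_AT[OF lin_eps, of 1]
  note MH = is_vspace_tensor[OF M is_vspace_H]
  note HH = is_vspace_tensor[OF is_vspace_H is_vspace_H]
  have P: "bilinear_on D M M P"
    unfolding P_def
    by (intro bilinear_onI bilinear_onD(1)[OF act] ptensor_in_AT
        linear_on_compose[OF bilinear_onD(2)[OF bilinear_ptensor] bilinear_onD(2)[OF act]]) simp_all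
  have A: "bilinear_on H M M A"
    unfolding A_eq[abs_def]
    by (intro bilinear_onI bilinear_onD(1)[OF act] ptensor_in_AT lin_eps
        linear_on_compose[OF bilinear_onD(1)[OF bilinear_ptensor] bilinear_onD(2)[OF act]])
      (simp_all add: lin_eps)
  have Am: "A b m \<in> space M" if "m \<in> space M" for b m
    using bilinear_onD(3)[OF A _ that] by simp
  have Pm: "P \<phi> m \<in> space M" if "lin \<phi>" "m \<in> space M" for \<phi> m
    using bilinear_onD(3)[OF P _ that(2)] that(1) by simp
  have A_mult: "A (g * h) m = A g (A h m)" if "m \<in> space M" for g h m
    using AH_mult_alg_mult[OF e, of g h] act_mult[OF ptensor_in_AT[OF lin_eps] ptensor_in_AT[OF lin_eps] that]
    by (simp add: A_eq AH_mult_one_right ptensor_in_AT lin_eps)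
  have P_conv: "P (convolution H \<phi> \<psi>) m = P \<phi> (P \<psi> m)" if "lin \<phi>" "lin \<psi>" "m \<in> space M" for \<phi> \<psi> m
    using AH_mult_convolution[OF that(1,2) e] act_mult[OF ptensor_in_AT[OF that(1)] ptensor_in_AT[OF that(2)] that(3)]
    by (simp add: P_def AH_mult_one_right ptensor_in_AT lin_convolution that)
  have cross: "A h (P \<psi> m) = sweedler3 H (comult H) (\<lambda>a b c. P (twist c a \<psi>) (A b m)) h"
    if \<psi>: "lin \<psi>" and m: "m \<in> space M" for \<psi> h m
  proof (rule functionals_separate[OF M])
    fix \<gamma> assume \<gamma>: "linear_on M ground \<gamma>"
    have \<gamma>': "linear_on AT ground (\<lambda>x. \<gamma> (act x m))"
      by (rule linear_on_compose[OF bilinear_onD(2)[OF act m] \<gamma>])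
    note pAT = ptensor_in_AT[OF lin_twist[OF \<psi>]] ptensor_in_AT[OF \<psi>] ptensor_in_AT[OF lin_eps]
    have "A h (P \<psi> m) = act (AH_mult H (ptensor D H eps h) (AH_mult H (ptensor D H \<psi> 1) (ptensor D H eps 1))) m"
      by (simp only: A_eq P_def act_mult[OF pAT(3,2) m] AH_mult_one_right[OF pAT(2)])
    then have "\<gamma> (A h (P \<psi> m)) = sw3 h (\<lambda>a b c. \<gamma> (act (AH_mult H (ptensor D H (twist c a \<psi>) 1)
        (AH_mult H (ptensor D H eps b) (ptensor D H eps 1))) m))"
      unfolding AH_mult_cross[OF \<psi> e]
      by (simp only: sweedler3_form[OF is_vspace_AT
          linear_cross_terms[OF bilinear_AH_mult_dual bilinear_AH_mult_alg \<psi> e] \<gamma>'])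
    also have "\<dots> = sw3 h (\<lambda>a b c. \<gamma> (P (twist c a \<psi>) (A b m)))"
      by (simp only: A_eq P_def act_mult[OF pAT(1,3) m] AH_mult_one_right[OF pAT(3)])
    also have "\<dots> = \<gamma> (sweedler3 H (comult H) (\<lambda>a b c. P (twist c a \<psi>) (A b m)) h)"
      by (rule sweedler3_form[OF M linear_cross_terms[OF P A \<psi> m] \<gamma>, symmetric])
    finally show "\<gamma> (A h (P \<psi> m)) = \<dots>" .
  qed
  have ayd: "P \<phi> (A h m) = sweedler3 H (comult H) (\<lambda>a b c. A b (P (cotwist c a \<phi>) m)) h"
    if "lin \<phi>" "m \<in> space M" for \<phi> h m
    by (rule ayd_of_cross[OF M P A _ that]) (rule cross)
  have \<rho>m: "\<rho> m \<in> space (tensor M H)" if "m \<in> space M" for m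
    unfolding \<rho>_eq using that
    by (intro is_vspaceD(4)[OF MH] ptensor_in_tensor) (simp_all add: Pm lin_coord)
  have \<rho>_eval: "\<rho> m \<beta> = (\<Sum>b\<in>B. \<beta> (P (coord b) m) b)" if "bilinear_on M H ground \<beta>" for m \<beta>
    by (simp add: \<rho>_eq sum_fun_apply ptensor_eval[OF that])
  have \<rho>: "linear_on M (tensor M H) \<rho>"
  proof (rule linear_on_functionalsI[OF M MH \<rho>m])
    fix \<gamma> assume \<gamma>: "linear_on (tensor M H) ground \<gamma>"
    have b: "bilinear_on M H ground (\<lambda>m h. \<gamma> (ptensor M H m h))"
      by (rule bilinear_on_compose[OF bilinear_ptensor \<gamma>])
    have "linear_on M ground (\<lambda>m. \<Sum>b\<in>B. \<gamma> (ptensor M H (P (coord b) m) b))"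
      by (intro linear_on_lin_intros linear_on_compose[OF bilinear_onD(1)[OF P] bilinear_onD(2)[OF b]])
        (simp_all add: lin_coord)
    then show "linear_on M ground (\<lambda>m. \<gamma> (\<rho> m))"
      using is_vspaceD(2,3)[OF M]
      by (simp add: linear_on_ground_iff[of M] form_tensor[OF M is_vspace_H \<gamma> \<rho>m] \<rho>_eval[OF b])
  qed
  have counit': "tlift M H (\<lambda>m' h. scl M (eps h) m') (\<rho> m) = m" if m: "m \<in> space M" for m
  proof (rule functionals_separate[OF M])
    fix \<gamma> assume \<gamma>: "linear_on M ground \<gamma>"
    \<comment> \<open>Contraction with the counit is \<open>slice\<close> at \<open>eps\<close>, and
      the counit is the combination of the dual basis with coefficients \<open>eps b\<close>; so it
      is the unit of A(H) that acts.\<close>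
    have "\<gamma> (slice M \<rho> eps m) = (\<Sum>b\<in>B. eps b * \<gamma> (P (coord b) m))"
      by (simp add: slice_form[OF M \<rho> \<gamma> lin_eps m] \<rho>_eval[OF bilinear_slice_form[OF \<gamma> lin_eps]])
    also have "\<dots> = \<gamma> (P eps m)"
      by (rule dual_form_expansion[OF linear_on_compose[OF bilinear_onD(2)[OF P m] \<gamma>] lin_eps])
    also have "P eps m = m" unfolding P_def by (rule act_1[OF m])
    finally show "\<gamma> (tlift M H (\<lambda>m' h. scl M (eps h) m') (\<rho> m)) = \<gamma> m" unfolding slice_def .
  qed
  have coassoc': "tassoc M H H (tmap M H (tensor M H) H \<rho> id (\<rho> m)) =
      tmap M H M (tensor H H) id (comult H) (\<rho> m)" if m: "m \<in> space M" for m
  proof (rule tensor_eqI)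
    have id: "linear_on M M id" "linear_on H H id" by (simp_all add: linear_on_def)
    note tm = tmap_eval(1)[OF M is_vspace_H MH is_vspace_H \<rho> id(2) \<rho>m[OF m]]
    show "tassoc M H H (tmap M H (tensor M H) H \<rho> id (\<rho> m)) \<in> space (tensor M (tensor H H))"
      by (rule tassoc_eval(1)[OF M is_vspace_H is_vspace_H tm])
    show "tmap M H M (tensor H H) id (comult H) (\<rho> m) \<in> space (tensor M (tensor H H))"
      by (rule tmap_eval(1)[OF M is_vspace_H M HH id(1) linear_comult \<rho>m[OF m]])
    fix \<beta> assume \<beta>: "bilinear_on M (tensor H H) ground \<beta>"
    have l1: "linear_on M ground (\<lambda>u. \<beta> u (ptensor H H v w))" for v w
      by (rule bilinear_onD(2)[OF \<beta> ptensor_in_tensor]) simp_all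
    have l2: "lin (\<lambda>v. \<beta> u (ptensor H H v w))" "lin (\<lambda>w. \<beta> u (ptensor H H v w))" if "u \<in> space M" for u v w
      by (rule linear_on_compose[OF bilinear_onD(2)[OF bilinear_ptensor] bilinear_onD(1)[OF \<beta> that]], simp)
        (rule linear_on_compose[OF bilinear_onD(1)[OF bilinear_ptensor] bilinear_onD(1)[OF \<beta> that]], simp)
    have b1: "bilinear_on M H ground (\<lambda>u v. \<beta> u (ptensor H H v w))" for w
      by (intro bilinear_onI l1 l2)
    have b2': "bilinear_on H (tensor M H) ground (\<lambda>w s. s (\<lambda>u v. \<beta> u (ptensor H H v w)))"
      by (rule bilinear_on_eval[OF M is_vspace_H b1 l2(2)])
    have b2: "bilinear_on (tensor M H) H ground (\<lambda>s w. s (\<lambda>u v. \<beta> u (ptensor H H v w)))"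
      by (intro bilinear_onI bilinear_onD(2)[OF b2'] bilinear_onD(1)[OF b2']) simp_all
    have b3: "bilinear_on M H ground (\<lambda>m0 w. \<rho> m0 (\<lambda>u v. \<beta> u (ptensor H H v w)))"
      by (intro bilinear_onI bilinear_onD(1)[OF b2] linear_on_compose[OF \<rho> bilinear_onD(2)[OF b2]] \<rho>m) simp_all
    have b4: "bilinear_on M H ground (\<lambda>m0 x. \<beta> m0 (comult H x))"
      by (intro bilinear_onI linear_on_compose[OF linear_comult bilinear_onD(1)[OF \<beta>]]
         bilinear_onD(2)[OF \<beta> comult_in_tensor])
    define \<kappa> where "\<kappa> d c b = \<beta> (P (coord d) m) (ptensor H H c b)" for d c b
    have \<kappa>: "bilinear_on H H ground (\<kappa> d)" for d
      unfolding \<kappa>_def by (intro lin_intros l2 Pm lin_coord m)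
    \<comment> \<open>The structure constants of convolution in the dual basis are those of the
      coproduct: the coefficient of \<open>coord d\<close> in the product of \<open>coord c\<close>
      and \<open>coord b\<close> is the value of that product at \<open>d\<close>.\<close>
    have pc: "\<beta> (P (coord c) (P (coord b) m)) (ptensor H H c b) =
        (\<Sum>d\<in>B. comult H d (\<lambda>u v. coord c u * coord b v) * \<kappa> d c b)" for b c
    proof -
      have K: "linear_on D ground (\<lambda>\<phi>. \<beta> (P \<phi> m) (ptensor H H c b))"
        by (rule linear_on_compose[OF bilinear_onD(2)[OF P m] l1])
      have cv: "convolution H (coord c) (coord b) d = comult H d (\<lambda>u v. coord c u * coord b v)" for d
        unfolding convolution_eq[OF lin_coord lin_coord] by (rule comult_eval[symmetric]) (intro lin_intros)
      show ?thesis
        using dual_form_expansion[OF K lin_convolution[OF lin_coord lin_coord], of c b]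
        by (simp add: P_conv lin_coord m cv \<kappa>_def)
    qed
    have "tassoc M H H (tmap M H (tensor M H) H \<rho> id (\<rho> m)) \<beta> =
        \<rho> m (\<lambda>m0 w. \<rho> m0 (\<lambda>u v. \<beta> u (ptensor H H v w)))"
      by (simp add: tassoc_eval(2)[OF M is_vspace_H is_vspace_H tm \<beta>]
          tmap_eval(2)[OF M is_vspace_H MH is_vspace_H \<rho> id(2) \<rho>m[OF m] b2])
    also have "\<dots> = (\<Sum>b\<in>B. \<Sum>c\<in>B. \<beta> (P (coord c) (P (coord b) m)) (ptensor H H c b))"
      unfolding \<rho>_eval[OF b3] by (simp only: \<rho>_eval[OF b1])
    also have "\<dots> = (\<Sum>c\<in>B. \<Sum>b\<in>B. \<Sum>d\<in>B. comult H d (\<lambda>u v. coord c u * coord b v) * \<kappa> d c b)"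
      unfolding pc by (rule sum.swap)
    also have "\<dots> = (\<Sum>c\<in>B. \<Sum>d\<in>B. \<Sum>b\<in>B. comult H d (\<lambda>u v. coord c u * coord b v) * \<kappa> d c b)"
      by (intro sum.cong refl sum.swap)
    also have "\<dots> = (\<Sum>d\<in>B. sw d (\<kappa> d))"
      unfolding sw_def by (rule sum.swap)
    also have "\<dots> = (\<Sum>d\<in>B. \<beta> (P (coord d) m) (comult H d))"
    proof (rule sum.cong[OF refl])
      fix d
      have "\<beta> (P (coord d) m) (comult H d) = comult H d (\<kappa> d)"
        unfolding \<kappa>_def
        by (rule form_tensor[OF is_vspace_H is_vspace_H bilinear_onD(1)[OF \<beta> Pm[OF lin_coord m]] comult_in_tensor])
      then show "sw d (\<kappa> d) = \<beta> (P (coord d) m) (comult H d)"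
        by (simp add: comult_eval[OF \<kappa>])
    qed
    also have "\<dots> = tmap M H M (tensor H H) id (comult H) (\<rho> m) \<beta>"
      by (simp add: tmap_eval(2)[OF M is_vspace_H M HH id(1) linear_comult \<rho>m[OF m] \<beta>] \<rho>_eval[OF b4])
    finally show "tassoc M H H (tmap M H (tensor M H) H \<rho> id (\<rho> m)) \<beta> = \<dots>" .
  qed
  have comp: "\<rho> (A h m) = sweedler3 H (comult H) (\<lambda>h1 h2 h3.
            tlift M H (\<lambda>m0 m1. ptensor M H (A h2 m0) (h3 * m1 * S h1)) (\<rho> m)) h" (is "_ = ?s")
    if m: "m \<in> space M" for h m
  proof (rule tensor_eqI[OF \<rho>m[OF Am[OF m]] ayd_tensor_closed[OF M A \<rho>m[OF m]]])
    fix \<beta> assume \<beta>: "bilinear_on M H ground \<beta>"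
    have \<beta>1: "linear_on M ground (\<lambda>n. \<beta> n b)" for b by (rule bilinear_onD(2)[OF \<beta>]) simp
    have \<beta>A: "linear_on M ground (\<lambda>n. \<beta> (A x n) b)" for x b
      by (rule linear_on_compose[OF bilinear_onD(1)[OF A] \<beta>1]) simp
    have b: "bilinear_on M H ground (\<lambda>m0 m1. \<beta> (A x m0) (c * m1 * S a))" for a x c
      by (intro bilinear_onI \<beta>A linear_on_compose[OF _ bilinear_onD(1)[OF \<beta>]] endo_intros Am)
    \<comment> \<open>Applying the transpose of a linear map to the dual leg of the canonical
      element equals applying the map to the other leg; here the map is
      \<open>\<lambda>y. c * y * S a\<close>.\<close>
    have inner: "(\<Sum>b\<in>B. \<beta> (A x (P (cotwist c a (coord b)) m)) b) =
        (\<Sum>i\<in>B. \<beta> (A x (P (coord i) m)) (c * i * S a))" for a x c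
    proof -
      have "\<beta> (A x (P (cotwist c a (coord b)) m)) b =
          (\<Sum>i\<in>B. coord b (c * i * S a) * \<beta> (A x (P (coord i) m)) b)" for b
        by (rule dual_form_expansion[OF linear_on_compose[OF bilinear_onD(2)[OF P m] \<beta>A]
              lin_cotwist[OF lin_coord], symmetric])
      then have "(\<Sum>b\<in>B. \<beta> (A x (P (cotwist c a (coord b)) m)) b) =
          (\<Sum>i\<in>B. \<Sum>b\<in>B. coord b (c * i * S a) * \<beta> (A x (P (coord i) m)) b)"
        by (simp only:) (rule sum.swap)
      then show ?thesis
        by (simp only: lin_expansion[OF bilinear_onD(1)[OF \<beta> Am[OF Pm[OF lin_coord m]]]])
    qed
    have "\<rho> (A h m) \<beta> = (\<Sum>b\<in>B. sw3 h (\<lambda>a x c. \<beta> (A x (P (cotwist c a (coord b)) m)) b))"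
      unfolding \<rho>_eval[OF \<beta>] ayd[OF lin_coord m]
      by (intro sum.cong refl sweedler3_form[OF M linear_cotwist_terms[OF P A lin_coord m] \<beta>1])
    also have "\<dots> = sw3 h (\<lambda>a x c. \<rho> m (\<lambda>m0 m1. \<beta> (A x m0) (c * m1 * S a)))"
      by (simp only: sw3_sum[symmetric] inner \<rho>_eval[OF b])
    also have "\<dots> = ?s \<beta>"
      by (rule ayd_tensor_eval[OF M A \<rho>m[OF m] \<beta>, symmetric])
    finally show "\<rho> (A h m) \<beta> = ?s \<beta>" .
  qed
  have "left_module (hopf_alg H) M A"
    unfolding left_module_def bilinear_on_hopf_alg
    using M A A_mult act_1 by (simp add: hopf_alg_def A_eq)
  moreover have "right_comodule H M \<rho>"
    unfolding right_comodule_def using M \<rho> counit' coassoc' by blast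
  ultimately have "ayd_module H M A \<rho>"
    unfolding ayd_module_def using comp by blast
  then show ?thesis unfolding A_def \<rho>_def .
qed

end

theorem proposition4p2:
  fixes H :: "('k::field, 'h::ring_1) hopf"
    and B :: "'h set"
    and M :: "('k, 'm::ab_group_add) vspace"
  assumes "hopf_algebra H"
    and "bij (antipode H)"
    and "finite_dimensional_vector_space (scl H) B"
  shows "unital_algebra (AH H) \<and>
    (\<forall>act \<rho>. ayd_module H M act \<rho> \<longrightarrow> left_module (AH H) M (AH_action H M act \<rho>)) \<and>
    (\<forall>act. left_module (AH H) M act \<longrightarrow>
       ayd_module H M (H_action H act) (H_coaction H B M act))"
proof -
  interpret finite_hopf H B
    using assms by (rule finite_hopf.intro)
  show ?thesis
    using unital_algebra_AH left_module_of_ayd ayd_of_left_module by blast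
qed

end
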